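(* Let $A$ be a finite subset of $\omega$, let $f(n)=4^n$, and let $\dot a$ be an $\mathbf{AS}$-name. For every $n\in\omega$ and every $(p_0,T)\in\mathbf{AS}$: if $(p_0,T)\Vdash\dot a\in A$, then there exist $(p_0,T')\le_n(p_0,T)$ and $B\subseteq A$ of size $\le f(n)$ such that $(p_0,T')\Vdash\dot a\in B$.
   Context: A tree is a subset of $2^{<\omega}$ closed under initial segments; $s\unlhd t$ means that $s$ is an initial segment of $t$. A node $t\in T$ is splitting if $t^\frown 0,t^\frown 1\in T$; $\mathrm{Split}(T)$ is the set of splitting nodes of $T$. $T$ is perfect if every node of $T$ extends to a splitting node of $T$. For a finite tree $p$, $\mathrm{Term}(p)$ is the set of its terminal nodes. For a finite subtree $p$ of $T$, $p\sqsubseteq T$ ("$T$ end-extends $p$") means that for every $t\in T\setminus p$ there is $s\in\mathrm{Term}(p)$ with $s\unlhd t$; $p\sqsubset T$ means $p\sqsubseteq T$ and $p\neq T$. For a tree $T$ (perfect or finite) order $\mathrm{Split}(T)$ by: $s\preccurlyeq t$ iff $s$ has strictly fewer proper initial segments in $\mathrm{Split}(T)$ than $t$ has, or they have equally many and $s$ is lexicographically $\le t$. (For perfect $T$ this is the order induced by the natural isomorphism $\mathrm{Split}(T)\to2^{<\omega}$, comparing first lengths and then lexicographically.) The depth $d(t,T)$ of $t\in\mathrm{Split}(T)$ is the number of $s\in\mathrm{Split}(T)$ with $s\preccurlyeq t$, $s\ne t$. A perfect tree $T$ is good iff for all $s,t\in\mathrm{Split}(T)$, $s\preccurlyeq t$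 implies $|s|\le|t|$. Amoeba-Sacks $\mathbf{AS}$ is the poset of all pairs $(p,T)$ where $T$ is a good perfect tree and $p\sqsubset T$ is a finite subtree, ordered by $(p',T')\le(p,T)$ iff $T'\subseteq T$ and $p'$ end-extends $p$. For $n\in\omega$, $T\upharpoonright^* n:=\{t\in T:\exists k\le n\ \exists s\in\mathrm{Split}(T)\ \exists i\in\{0,1\}\ (d(s,T)=k\wedge t\unlhd s^\frown i)\}$, and for perfect trees $T'\subseteq_n T$ means $T'\subseteq T$ and $T'\upharpoonright^* n=T\upharpoonright^* n$; $T'\subseteq_{-1}T$ means just $T'\subseteq T$. For $(p_0,T)\in\mathbf{AS}$ let $p\sqsupseteq p_0$ be the $\sqsubseteq$-maximal finite tree such that $p\sqsubset T'$ for every $T'\subseteq T$ with $(p_0,T')\in\mathbf{AS}$ (such $p$ exists), and let $N:=\max\{k\in\omega:\exists t\in\mathrm{Split}(p)\ (d(t,p)=k)\}$, with $N:=-1$ if $\mathrm{Split}(p)=\emptyset$. Define $(p_0',T')\le_n(p_0,T)$ iff $(p_0',T')\le(p_0,T)$, $p_0'=p_0$ and $T'\subseteq_{n+N}T$. *)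

theory Defs
  imports "HOL-Library.Sublist"
begin

section \<open>Trees of finite binary sequences\<close>

text \<open>Nodes of the full binary tree are lists of booleans, with \<open>False\<close> for 0 and \<open>True\<close> for 1.\<close>

type_synonym node = "bool list"
type_synonym tree = "node set"

definition is_tree :: "tree \<Rightarrow> bool" where
  "is_tree T \<longleftrightarrow> (\<forall>t\<in>T. \<forall>s. prefix s t \<longrightarrow> s \<in> T)"

definition Split :: "tree \<Rightarrow> tree" where
  "Split T = {t \<in> T. t @ [False] \<in> T \<and> t @ [True] \<in> T}"

definition perfect_tree :: "tree \<Rightarrow> bool" where
  "perfect_tree T \<longleftrightarrow> is_tree T \<and> (\<forall>t\<in>T. \<exists>s\<in>Split T. prefix t s)"

definition Term :: "tree \<Rightarrow> tree" where
  "Term p = {t \<in> p. \<not> (\<exists>s\<in>p. strict_prefix t s)}"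

definition end_ext :: "tree \<Rightarrow> tree \<Rightarrow> bool"  (infix \<open>\<sqsubseteq>\<^sub>e\<close> 50) where
  "p \<sqsubseteq>\<^sub>e T \<longleftrightarrow> is_tree p \<and> finite p \<and> is_tree T \<and> p \<subseteq> T \<and>
     (\<forall>t\<in>T - p. \<exists>s\<in>Term p. prefix s t)"

definition strict_end_ext :: "tree \<Rightarrow> tree \<Rightarrow> bool"  (infix \<open>\<sqsubset>\<^sub>e\<close> 50) where
  "p \<sqsubset>\<^sub>e T \<longleftrightarrow> p \<sqsubseteq>\<^sub>e T \<and> p \<noteq> T"

definition split_level :: "tree \<Rightarrow> node \<Rightarrow> nat" where
  "split_level T t = card {s \<in> Split T. strict_prefix s t}"

definition split_le :: "tree \<Rightarrow> node \<Rightarrow> node \<Rightarrow> bool" where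
  "split_le T s t \<longleftrightarrow> split_level T s < split_level T t \<or>
     (split_level T s = split_level T t \<and> ord_class.lexordp_eq s t)"

definition depth :: "node \<Rightarrow> tree \<Rightarrow> nat" where
  "depth t T = card {s \<in> Split T. split_le T s t \<and> s \<noteq> t}"

definition good_tree :: "tree \<Rightarrow> bool" where
  "good_tree T \<longleftrightarrow> perfect_tree T \<and>
     (\<forall>s\<in>Split T. \<forall>t\<in>Split T. split_le T s t \<longrightarrow> length s \<le> length t)"

definition restr :: "tree \<Rightarrow> nat \<Rightarrow> tree" where
  "restr T n = {t \<in> T. \<exists>k\<le>n. \<exists>s\<in>Split T. \<exists>i. depth s T = k \<and> prefix t (s @ [i])}"

text \<open>The index may be \<open>-1\<close>, in which case the relation is plain inclusion.\<close>

definition sub_upto :: "int \<Rightarrow> tree \<Rightarrow> tree \<Rightarrow> bool" where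
  "sub_upto k T' T \<longleftrightarrow> T' \<subseteq> T \<and> (0 \<le> k \<longrightarrow> restr T' (nat k) = restr T (nat k))"


section \<open>Amoeba-Sacks forcing\<close>

type_synonym cond = "tree \<times> tree"

definition AS :: "cond set" where
  "AS = {(p, T). good_tree T \<and> p \<sqsubset>\<^sub>e T}"

definition AS_le :: "cond \<Rightarrow> cond \<Rightarrow> bool" where
  "AS_le c' c \<longleftrightarrow> c' \<in> AS \<and> c \<in> AS \<and> snd c' \<subseteq> snd c \<and> fst c \<sqsubseteq>\<^sub>e fst c'"

text \<open>The greatest condition.\<close>

definition AS_top :: cond where
  "AS_top = ({[]}, UNIV)"

definition decided :: "tree \<Rightarrow> tree \<Rightarrow> tree \<Rightarrow> bool" where
  "decided p0 T p \<longleftrightarrow> finite p \<and> is_tree p \<and> p0 \<sqsubseteq>\<^sub>e p \<and>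
     (\<forall>T'. T' \<subseteq> T \<and> (p0, T') \<in> AS \<longrightarrow> p \<sqsubset>\<^sub>e T')"

text \<open>The union of two trees satisfying \<open>decided p0 T\<close> satisfies it again and end-extends
  both, so for \<open>(p0, T) \<in> AS\<close> a maximal such tree is unique.\<close>

definition core :: "tree \<Rightarrow> tree \<Rightarrow> tree" where
  "core p0 T = (THE p. decided p0 T p \<and> (\<forall>q. decided p0 T q \<and> p \<sqsubseteq>\<^sub>e q \<longrightarrow> q = p))"

definition max_depth :: "tree \<Rightarrow> int" where
  "max_depth p = (if Split p = {} then -1
     else int (Max {k. \<exists>t\<in>Split p. depth t p = k}))"

definition AS_le_n :: "nat \<Rightarrow> cond \<Rightarrow> cond \<Rightarrow> bool" where
  "AS_le_n n c' c \<longleftrightarrow> AS_le c' c \<and> fst c' = fst c \<and>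
     sub_upto (int n + max_depth (core (fst c) (snd c))) (snd c') (snd c)"


section \<open>Names and the forcing relation\<close>

text \<open>A name is a set of pairs (name, condition), here given as the range of a partial family
  indexed by the type \<open>'i\<close>; letting \<open>'i\<close> vary yields names of every size.\<close>

datatype ('c, 'i) pname = PName "'i \<Rightarrow> (('c, 'i) pname \<times> 'c) option"

primrec elts :: "('c, 'i) pname \<Rightarrow> (('c, 'i) pname \<times> 'c) set" where
  "elts (PName F) = ran F"

inductive is_name :: "'c set \<Rightarrow> ('c, 'i) pname \<Rightarrow> bool" for P where
  "(\<And>\<pi> s. (\<pi>, s) \<in> elts \<tau> \<Longrightarrow> s \<in> P \<and> is_name P \<pi>) \<Longrightarrow> is_name P \<tau>"

definition name_rel :: "(('c, 'i) pname \<times> ('c, 'i) pname) set" where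
  "name_rel = {(\<pi>, \<tau>). \<exists>s. (\<pi>, s) \<in> elts \<tau>}"

lemma wf_name_rel: "wf name_rel"
proof (rule wfUNIVI)
  fix Q :: "('c, 'i) pname \<Rightarrow> bool" and \<tau>
  assume *: "\<forall>\<tau>. (\<forall>\<pi>. (\<pi>, \<tau>) \<in> name_rel \<longrightarrow> Q \<pi>) \<longrightarrow> Q \<tau>"
  show "Q \<tau>"
  proof (induction \<tau>)
    case (PName F)
    have "Q \<pi>" if "(\<pi>, PName F) \<in> name_rel" for \<pi>
    proof -
      from that obtain s i where i: "F i = Some (\<pi>, s)"
        by (auto simp: name_rel_def ran_def)
      show ?thesis
        by (rule PName.IH[of "F i" "(\<pi>, s)"]) (auto simp: i intro: rangeI[of F i, unfolded i])
    qed
    with * show ?case by blast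
  qed
qed

definition dense_below :: "'c set \<Rightarrow> ('c \<Rightarrow> 'c \<Rightarrow> bool) \<Rightarrow> 'c set \<Rightarrow> 'c \<Rightarrow> bool" where
  "dense_below P le D p \<longleftrightarrow> (\<forall>q\<in>P. le q p \<longrightarrow> (\<exists>r\<in>D. r \<in> P \<and> le r q))"

text \<open>The usual recursive definition, in the ground model, of the forcing relation for atomic
  formulas: \<open>forces_eq P le \<sigma> \<tau> p\<close> and \<open>forces_mem P le \<sigma> \<tau> p\<close> say that the condition \<open>p\<close> of
  the preorder \<open>(P, le)\<close> forces \<open>\<sigma> = \<tau>\<close> and \<open>\<sigma> \<in> \<tau>\<close>, respectively.\<close>

function forces_eq ::
  "'c set \<Rightarrow> ('c \<Rightarrow> 'c \<Rightarrow> bool) \<Rightarrow> ('c, 'i) pname \<Rightarrow> ('c, 'i) pname \<Rightarrow> 'c \<Rightarrow> bool"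
where
  "forces_eq P le \<sigma> \<tau> p \<longleftrightarrow>
     (\<forall>(\<pi>, s)\<in>elts \<sigma>. dense_below P le
        {q \<in> P. le q s \<longrightarrow> (\<exists>(\<rho>, r)\<in>elts \<tau>. le q r \<and> forces_eq P le \<pi> \<rho> q)} p) \<and>
     (\<forall>(\<rho>, r)\<in>elts \<tau>. dense_below P le
        {q \<in> P. le q r \<longrightarrow> (\<exists>(\<pi>, s)\<in>elts \<sigma>. le q s \<and> forces_eq P le \<pi> \<rho> q)} p)"
  by pat_completeness auto
termination
  by (relation "inv_image name_rel (\<lambda>(P, le, \<sigma>, \<tau>, p). \<sigma>)")
     (use wf_name_rel in \<open>auto simp: name_rel_def\<close>)

declare forces_eq.simps [simp del]

definition forces_mem ::
  "'c set \<Rightarrow> ('c \<Rightarrow> 'c \<Rightarrow> bool) \<Rightarrow> ('c, 'i) pname \<Rightarrow> ('c, 'i) pname \<Rightarrow> 'c \<Rightarrow> bool"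
where
  "forces_mem P le \<sigma> \<tau> p \<longleftrightarrow>
     dense_below P le {q \<in> P. \<exists>(\<rho>, r)\<in>elts \<tau>. le q r \<and> forces_eq P le \<sigma> \<rho> q} p"

text \<open>Canonical names for the natural numbers (as von Neumann ordinals) and for sets of natural
  numbers; \<open>one\<close> is the greatest condition. The index type contains a copy of \<open>nat\<close>
  to make room for them.\<close>

function check_nat :: "'c \<Rightarrow> nat \<Rightarrow> ('c, nat + 'i) pname" where
  "check_nat one n = PName (\<lambda>i. case i of
       Inl k \<Rightarrow> if k < n then Some (check_nat one k, one) else None
     | Inr _ \<Rightarrow> None)"
  by pat_completeness auto
termination
  by (relation "measure snd") auto

declare check_nat.simps [simp del]

definition check_set :: "'c \<Rightarrow> nat set \<Rightarrow> ('c, nat + 'i) pname" where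
  "check_set one A = PName (\<lambda>i. case i of
       Inl k \<Rightarrow> if k \<in> A then Some (check_nat one k, one) else None
     | Inr _ \<Rightarrow> None)"

definition AS_forces_in :: "cond \<Rightarrow> (cond, nat + 'i) pname \<Rightarrow> nat set \<Rightarrow> bool" where
  "AS_forces_in c a A \<longleftrightarrow> forces_mem AS AS_le a (check_set AS_top A) c"

end

theory Submission
  imports Defs
begin

text \<open>The statement rests on pure decision for Amoeba-Sacks forcing (\<open>pure_decision\<close>): if a condition
forces a name into a finite set \<open>A\<close>, then above any level \<open>h\<close> of its good tree \<open>S\<close> one can thin \<open>S\<close>
out, leaving all nodes of length at most \<open>h\<close> alone, so that the condition whose finite part is the
truncation of \<open>S\<close> at \<open>h\<close> decides the value of the name.

Given pure decision, the bound \<open>4 ^ n\<close> is a count (\<open>forces_few_values\<close>). The relation \<open>\<le>\<^sub>n\<close> prescribes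
the first \<open>n + N + 1\<close> splitting nodes of \<open>T\<close>, where \<open>N + 1\<close> is at most the number of splitting nodes of
the core. Thin \<open>T\<close> so that an initial stretch of its splitting nodes, containing these and those of
the core, survives while all others become longer than some \<open>h\<close>. A stronger condition may still drop
some of the kept nodes, but the nodes of the core must split, and all kept nodes except for at most
\<open>n\<close> turn out to be forced in this way. Below \<open>h\<close> its tree is determined by which of the two successors of
each unforced node it contains. So there are at most \<open>4 ^ n\<close> possibilities for the level \<open>h\<close> of its
tree, and pure decision, applied to one possibility after the other, attaches one value to each.

Pure decision is a Ramsey statement. Thin \<open>S\<close> first so that it is decisive: whether a subtree can be
thinned so as to decide a value depends only on its level just above a splitting node, and if so, every
subtree with this level decides. Suppose that no thinning decides at \<open>h\<close>. The next
splitting node \<open>z\<close> of a subtree lies above one node of the level \<open>h\<close>, and every other node \<open>i\<close> of the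
level runs along some branch up to a node \<open>w i\<close> of length \<open>|z| + 1\<close>. Colour \<open>z\<close> and \<open>w\<close> by the value
that the level decides, if any. The Halpern-Laeuchli theorem (\<open>halpern_lauchli\<close>) yields perfect subtrees of the
cones on which this colour is constant. A constant value would be decided already at \<open>h\<close>, hence the
colour is "no decision", and failure to decide propagates from one splitting node to the next. A
fusion produces a subtree in which no level ever decides, contradicting that the conditions deciding
a value are dense.

The Halpern-Laeuchli theorem follows from a theorem of Carlson and Simpson on left variable words
(\<open>left_variable_words\<close>) by reading a word over the alphabet of all maps from \<open>I\<close> to \<open>{0, 1}\<close> as an
\<open>I\<close>-tuple of addresses of the same length. The theorem on words comes from the algebra of
ultrafilters on free monoids: an idempotent ultrafilter \<open>V\<close> that is minimal satisfies
\<open>V = V \<star> [a] \<star> Y[a] \<star> V\<close> for all letters \<open>a\<close>, with one ultrafilter \<open>Y\<close> on variable words serving all letters.\<close>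

section \<open>Ultrafilters on words\<close>

text \<open>An ultrafilter is represented as the quantifier ``for almost all'': \<open>p P\<close> says that \<open>P\<close> holds on a set
of the ultrafilter. Products and images of ultrafilters are then composition of quantifiers, and
their algebraic laws hold by unfolding.\<close>

definition ultra :: "(('a \<Rightarrow> bool) \<Rightarrow> bool) \<Rightarrow> bool" where
  "ultra p \<longleftrightarrow> (\<forall>P Q. p P \<longrightarrow> (\<forall>x. P x \<longrightarrow> Q x) \<longrightarrow> p Q) \<and>
     (\<forall>P Q. p P \<longrightarrow> p Q \<longrightarrow> p (\<lambda>x. P x \<and> Q x)) \<and> (\<forall>P. p (\<lambda>x. \<not> P x) \<longleftrightarrow> \<not> p P)"

lemma ultra_mono:
  assumes "ultra p" "p P" "\<And>x. P x \<Longrightarrow> Q x"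
  shows "p Q"
proof -
  have "p P \<longrightarrow> (\<forall>x. P x \<longrightarrow> Q x) \<longrightarrow> p Q" using assms(1) by (simp add: ultra_def)
  then show ?thesis using assms(2,3) by simp
qed

lemma ultra_not: "ultra p \<Longrightarrow> p (\<lambda>x. \<not> P x) \<longleftrightarrow> \<not> p P"
  by (simp add: ultra_def)

lemma ultra_conj:
  assumes "ultra p"
  shows "p (\<lambda>x. P x \<and> Q x) \<longleftrightarrow> p P \<and> p Q"
proof -
  have "p P \<longrightarrow> p Q \<longrightarrow> p (\<lambda>x. P x \<and> Q x)" using assms by (simp add: ultra_def)
  then show ?thesis
    using ultra_mono[OF assms, of "\<lambda>x. P x \<and> Q x" P] ultra_mono[OF assms, of "\<lambda>x. P x \<and> Q x" Q] by auto
qed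

lemma ultra_True: assumes "ultra p" shows "p (\<lambda>x. True)"
proof (cases "p (\<lambda>x. True)")
  case False
  then have "p (\<lambda>x. \<not> True)" by (simp only: ultra_not[OF assms, of "\<lambda>x. True"] not_False_eq_True)
  then show ?thesis by (rule ultra_mono[OF assms]) simp
qed

lemma ultra_False: "ultra p \<Longrightarrow> \<not> p (\<lambda>x. False)"
  using ultra_not[of p "\<lambda>_. True"] ultra_True[of p] by simp

lemma ultra_ex: assumes "ultra p" "p P" shows "\<exists>x. P x"
proof (rule ccontr)
  assume "\<nexists>x. P x"
  then have "P = (\<lambda>x. False)" by auto
  then show False using ultra_False[OF assms(1)] assms(2) by simp
qed

lemma ultra_ball:
  assumes "ultra p" "finite I"
  shows "p (\<lambda>x. \<forall>i\<in>I. P i x) \<longleftrightarrow> (\<forall>i\<in>I. p (P i))"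
  using assms(2)
proof induction
  case empty then show ?case by (simp add: ultra_True assms(1))
next
  case (insert i I)
  then show ?case using ultra_conj[OF assms(1), of "P i" "\<lambda>x. \<forall>j\<in>I. P j x"] by simp
qed

lemma ultra_bex:
  assumes "ultra p" "finite I"
  shows "p (\<lambda>x. \<exists>i\<in>I. P i x) \<longleftrightarrow> (\<exists>i\<in>I. p (P i))"
proof -
  have "p (\<lambda>x. \<exists>i\<in>I. P i x) \<longleftrightarrow> \<not> p (\<lambda>x. \<forall>i\<in>I. \<not> P i x)"
    using ultra_not[OF assms(1), of "\<lambda>x. \<forall>i\<in>I. \<not> P i x"] by simp
  then show ?thesis
    using ultra_ball[OF assms, of "\<lambda>i x. \<not> P i x"] ultra_not[OF assms(1)] by simp
qed

lemma ultra_ext: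
  assumes "ultra p" "ultra q" "\<And>P. p P \<Longrightarrow> q P"
  shows "p = q"
proof (rule ext)
  fix P show "p P = q P"
    using assms(3)[of P] assms(3)[of "\<lambda>x. \<not> P x"] ultra_not[OF assms(1), of P] ultra_not[OF assms(2), of P] by blast
qed

text \<open>The ultrafilter lemma: by Zorn's lemma a filter base is contained in a maximal family with the
finite intersection property, and maximality decides every set.\<close>

lemma ultra_exists:
  assumes ne: "F \<noteq> {}" and dir: "\<And>P Q. P \<in> F \<Longrightarrow> Q \<in> F \<Longrightarrow> \<exists>R\<in>F. R \<subseteq> P \<inter> Q"
    and ex: "{} \<notin> F"
  shows "\<exists>p. ultra p \<and> (\<forall>P\<in>F. p (\<lambda>x. x \<in> P))"
proof -
  define fip where "fip M \<longleftrightarrow> (\<forall>G. finite G \<longrightarrow> G \<subseteq> M \<longrightarrow> \<Inter>G \<noteq> {})" for M :: "'a set set"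
  have fipF: "fip F"
    unfolding fip_def
  proof (intro allI impI)
    fix G assume "finite G" "G \<subseteq> F"
    then have "\<exists>R\<in>F. R \<subseteq> \<Inter>G"
    proof induction
      case empty then show ?case using ne by blast
    next
      case (insert P G)
      then obtain R where R: "R \<in> F" "R \<subseteq> \<Inter>G" by blast
      obtain R' where "R' \<in> F" "R' \<subseteq> P \<inter> R" using dir[of P R] R(1) insert.prems by blast
      then show ?case using R(2) by blast
    qed
    then show "\<Inter>G \<noteq> {}" using ex by (metis subset_empty)
  qed
  have "\<exists>M\<in>{M. F \<subseteq> M \<and> fip M}. \<forall>X\<in>{M. F \<subseteq> M \<and> fip M}. M \<subseteq> X \<longrightarrow> X = M"
  proof (rule subset_Zorn_nonempty)
    show "{M. F \<subseteq> M \<and> fip M} \<noteq> {}" using fipF by blast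
    fix \<C> assume ne: "\<C> \<noteq> {}" and ch: "subset.chain {M. F \<subseteq> M \<and> fip M} \<C>"
    then have CA: "\<C> \<subseteq> {M. F \<subseteq> M \<and> fip M}" unfolding subset.chain_def by simp
    have "fip (\<Union>\<C>)"
      unfolding fip_def
    proof (intro allI impI)
      fix G assume G: "finite G" "G \<subseteq> \<Union>\<C>"
      obtain B where B: "B \<in> \<C>" "G \<subseteq> B" by (rule finite_subset_Union_chain[OF G ne ch])
      then have "fip B" using CA by blast
      then show "\<Inter>G \<noteq> {}" using G(1) B(2) unfolding fip_def by blast
    qed
    moreover have "F \<subseteq> \<Union>\<C>" using ne CA by blast
    ultimately show "\<Union>\<C> \<in> {M. F \<subseteq> M \<and> fip M}" by simp
  qed
  then obtain M where M0: "M \<in> {M. F \<subseteq> M \<and> fip M}"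
    and max0: "\<forall>X\<in>{M. F \<subseteq> M \<and> fip M}. M \<subseteq> X \<longrightarrow> X = M" by (rule bexE)
  have M: "F \<subseteq> M" "fip M" using M0 by simp_all
  have max: "X = M" if "F \<subseteq> X" "fip X" "M \<subseteq> X" for X
    using max0[THEN bspec, of X] that by simp
  \<comment> \<open>A set that meets all finite intersections can be added, so maximality puts it into \<open>M\<close>.\<close>
  have key: "P \<in> M" if *: "\<And>G. finite G \<Longrightarrow> G \<subseteq> M \<Longrightarrow> P \<inter> \<Inter>G \<noteq> {}" for P
  proof -
    have "fip (insert P M)"
      unfolding fip_def
    proof (intro allI impI)
      fix G assume G: "finite G" "G \<subseteq> insert P M"
      have "P \<inter> \<Inter>(G - {P}) \<noteq> {}" by (rule *) (use G in auto)
      moreover have "P \<inter> \<Inter>(G - {P}) \<subseteq> \<Inter>G" by blast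
      ultimately show "\<Inter>G \<noteq> {}" by blast
    qed
    then have "insert P M = M" using M(1) by (intro max) auto
    then show ?thesis by blast
  qed
  have fipM: "\<Inter>G \<noteq> {}" if "finite G" "G \<subseteq> M" for G
    using M(2) that unfolding fip_def by blast
  have conj: "Q \<in> M" if PM: "P \<in> M" "P' \<in> M" and imp: "P \<inter> P' \<subseteq> Q" for P P' Q
  proof (rule key)
    fix G assume "finite G" "G \<subseteq> M"
    then have "\<Inter>(insert P (insert P' G)) \<noteq> {}" by (intro fipM) (use PM in auto)
    then show "Q \<inter> \<Inter>G \<noteq> {}" using imp by blast
  qed
  have neg: "- P \<in> M \<longleftrightarrow> P \<notin> M" for P
  proof
    assume "- P \<in> M"
    then show "P \<notin> M" using fipM[of "{P, - P}"] by auto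
  next
    assume "P \<notin> M"
    then obtain G where G: "finite G" "G \<subseteq> M" "P \<inter> \<Inter>G = {}" using key[of P] by blast
    show "- P \<in> M"
    proof (rule key)
      fix H assume "finite H" "H \<subseteq> M"
      then have "\<Inter>(G \<union> H) \<noteq> {}" by (intro fipM) (use G in auto)
      then show "- P \<inter> \<Inter>H \<noteq> {}" using G(3) by blast
    qed
  qed
  have "ultra (\<lambda>P. Collect P \<in> M)"
    unfolding ultra_def
  proof (intro conjI allI impI)
    fix P Q :: "'a \<Rightarrow> bool" assume P: "Collect P \<in> M" "\<forall>x. P x \<longrightarrow> Q x"
    show "Collect Q \<in> M" by (rule conj[OF P(1) P(1)]) (use P(2) in auto)
  next
    fix P Q assume "Collect P \<in> M" "Collect Q \<in> M"
    then show "{x. P x \<and> Q x} \<in> M" by (rule conj) auto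
  next
    fix P show "{x. \<not> P x} \<in> M \<longleftrightarrow> Collect P \<notin> M" using neg[of "Collect P"] by (simp add: Collect_neg_eq)
  qed
  then show ?thesis using M(1) by (intro exI[of _ "\<lambda>P. Collect P \<in> M"]) auto
qed

text \<open>The extension of concatenation to ultrafilters, written so that the map from \<open>p\<close> to \<open>p \<star> q\<close> is continuous.\<close>

definition star :: "(('a list \<Rightarrow> bool) \<Rightarrow> bool) \<Rightarrow> (('a list \<Rightarrow> bool) \<Rightarrow> bool) \<Rightarrow> (('a list \<Rightarrow> bool) \<Rightarrow> bool)"
  (infixl \<open>\<star>\<close> 70) where
  "p \<star> q = (\<lambda>P. p (\<lambda>s. q (\<lambda>t. P (s @ t))))"

lemma star_assoc: "(p \<star> q) \<star> r = p \<star> (q \<star> r)"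
  by (simp add: star_def)

lemma ultra_star: assumes p: "ultra p" and q: "ultra q" shows "ultra (p \<star> q)"
  unfolding ultra_def
proof (intro conjI allI impI)
  fix P Q :: "'a list \<Rightarrow> bool" assume "(p \<star> q) P" "\<forall>x. P x \<longrightarrow> Q x"
  then have PQ: "p (\<lambda>s. q (\<lambda>t. P (s @ t)))" "\<And>x. P x \<Longrightarrow> Q x" by (simp_all add: star_def)
  have "q (\<lambda>t. Q (s @ t))" if "q (\<lambda>t. P (s @ t))" for s
    using that by (rule ultra_mono[OF q]) (rule PQ(2))
  then show "(p \<star> q) Q"
    unfolding star_def using ultra_mono[OF p PQ(1), of "\<lambda>s. q (\<lambda>t. Q (s @ t))"] by simp
next
  fix P Q :: "'a list \<Rightarrow> bool" assume "(p \<star> q) P" "(p \<star> q) Q"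
  then show "(p \<star> q) (\<lambda>x. P x \<and> Q x)"
    unfolding star_def by (simp add: ultra_conj[OF p] ultra_conj[OF q])
next
  fix P :: "'a list \<Rightarrow> bool"
  show "(p \<star> q) (\<lambda>x. \<not> P x) \<longleftrightarrow> \<not> (p \<star> q) P"
    unfolding star_def by (simp add: ultra_not[OF p] ultra_not[OF q])
qed

definition push :: "('a \<Rightarrow> 'b) \<Rightarrow> (('a \<Rightarrow> bool) \<Rightarrow> bool) \<Rightarrow> (('b \<Rightarrow> bool) \<Rightarrow> bool)" where
  "push h p = (\<lambda>P. p (\<lambda>x. P (h x)))"

lemma ultra_push: assumes p: "ultra p" shows "ultra (push h p)"
  unfolding ultra_def
proof (intro conjI allI impI)
  fix P Q :: "'b \<Rightarrow> bool" assume "push h p P" "\<forall>x. P x \<longrightarrow> Q x"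
  then show "push h p Q"
    unfolding push_def using ultra_mono[OF p, of "\<lambda>x. P (h x)" "\<lambda>x. Q (h x)"] by simp
qed (simp_all add: push_def ultra_conj[OF p] ultra_not[OF p])

lemma push_star: "(\<And>s t. h (s @ t) = h s @ h t) \<Longrightarrow> push h (p \<star> q) = push h p \<star> push h q"
  by (simp add: push_def star_def)

lemma ultra_point: "ultra (\<lambda>P. P x)"
  by (simp add: ultra_def)

text \<open>The closed sets of the Stone space: every ultrafilter that contains the common sets of \<open>K\<close> is in \<open>K\<close>.\<close>

definition uclosed :: "(('a \<Rightarrow> bool) \<Rightarrow> bool) set \<Rightarrow> bool" where
  "uclosed K \<longleftrightarrow> (\<forall>p\<in>K. ultra p) \<and> (\<forall>p. ultra p \<longrightarrow> (\<forall>P. (\<forall>q\<in>K. q P) \<longrightarrow> p P) \<longrightarrow> p \<in> K)"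

lemma uclosed_ultra_mem: "uclosed K \<Longrightarrow> p \<in> K \<Longrightarrow> ultra p"
  by (simp add: uclosed_def)

lemma uclosedD:
  assumes K: "uclosed K" and p: "ultra p" "\<And>P. (\<And>q. q \<in> K \<Longrightarrow> q P) \<Longrightarrow> p P"
  shows "p \<in> K"
proof -
  have "\<forall>p. ultra p \<longrightarrow> (\<forall>P. (\<forall>q\<in>K. q P) \<longrightarrow> p P) \<longrightarrow> p \<in> K"
    using K unfolding uclosed_def by (rule conjunct2)
  note 1 = this[THEN spec[of _ p], THEN mp[OF _ p(1)]]
  show ?thesis
  proof (intro 1[THEN mp] allI impI)
    fix P assume *: "\<forall>q\<in>K. q P"
    show "p P" by (rule p(2), rule *[THEN bspec])
  qed
qed

lemma uclosedI:
  assumes "\<And>p. p \<in> K \<Longrightarrow> ultra p"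
    and "\<And>p. ultra p \<Longrightarrow> (\<And>P. (\<And>q. q \<in> K \<Longrightarrow> q P) \<Longrightarrow> p P) \<Longrightarrow> p \<in> K"
  shows "uclosed K"
  unfolding uclosed_def
proof (intro conjI ballI allI impI)
  fix p assume p: "ultra p" "\<forall>P. (\<forall>q\<in>K. q P) \<longrightarrow> p P"
  show "p \<in> K"
  proof (rule assms(2)[OF p(1)])
    fix P assume "\<And>q. q \<in> K \<Longrightarrow> q P"
    then have "\<forall>q\<in>K. q P" by (rule ballI)
    then show "p P" by (rule p(2)[THEN spec, THEN mp])
  qed
qed (rule assms(1))

lemma nonempty_if_mem: "x \<in> A \<Longrightarrow> A \<noteq> {}" by blast

text \<open>Compactness of the Stone space, in the only case that Zorn's lemma needs. The sets common to all
members of some element of the chain form a filter base, and any ultrafilter containing it lies in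
every element of the chain.\<close>

lemma uclosed_Inter_chain:
  assumes ne: "\<C> \<noteq> {}" and ch: "\<And>X Y. X \<in> \<C> \<Longrightarrow> Y \<in> \<C> \<Longrightarrow> X \<subseteq> Y \<or> Y \<subseteq> X"
    and cl: "\<And>X. X \<in> \<C> \<Longrightarrow> uclosed X \<and> X \<noteq> {}"
  shows "uclosed (\<Inter>\<C>) \<and> \<Inter>\<C> \<noteq> {}"
proof
  have u: "ultra p" if "p \<in> X" "X \<in> \<C>" for p X
    using cl[OF that(2)] that(1) by (intro uclosed_ultra_mem[of X]) simp_all
  show "uclosed (\<Inter>\<C>)"
  proof (rule uclosedI)
    obtain X where X: "X \<in> \<C>" using ne by blast
    fix p assume "p \<in> \<Inter>\<C>"
    then have "p \<in> X" by (rule InterD[OF _ X])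
    then show "ultra p" by (rule u[OF _ X])
  next
    fix p assume p: "ultra p" "\<And>P. (\<And>q. q \<in> \<Inter>\<C> \<Longrightarrow> q P) \<Longrightarrow> p P"
    have "p \<in> X" if X: "X \<in> \<C>" for X
    proof (rule uclosedD[OF _ p(1)])
      show "uclosed X" using cl[OF X] by (rule conjunct1)
      fix P assume *: "\<And>q. q \<in> X \<Longrightarrow> q P"
      show "p P"
      proof (rule p(2))
        fix q assume "q \<in> \<Inter>\<C>"
        then have "q \<in> X" by (rule InterD[OF _ X])
        then show "q P" by (rule *)
      qed
    qed
    then show "p \<in> \<Inter>\<C>" by (rule InterI)
  qed
  define F where "F = {P. \<exists>X\<in>\<C>. \<forall>q\<in>X. q (\<lambda>x. x \<in> P)}"
  have FI: "P \<in> F" if "X \<in> \<C>" "\<And>q. q \<in> X \<Longrightarrow> q (\<lambda>x. x \<in> P)" for P X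
    unfolding F_def by (rule CollectI, rule bexI[OF _ that(1)], rule ballI, rule that(2))
  have FE: "\<exists>X\<in>\<C>. \<forall>q\<in>X. q (\<lambda>x. x \<in> P)" if "P \<in> F" for P
    using that unfolding F_def by (rule CollectD)
  have "\<exists>p. ultra p \<and> (\<forall>P\<in>F. p (\<lambda>x. x \<in> P))"
  proof (rule ultra_exists)
    obtain X where X: "X \<in> \<C>" using ne by blast
    have "UNIV \<in> F" by (rule FI[OF X]) (simp add: ultra_True[OF u[OF _ X]])
    then show "F \<noteq> {}" by blast
  next
    fix P Q assume PQ: "P \<in> F" "Q \<in> F"
    from FE[OF PQ(1)] obtain X where X: "X \<in> \<C>" "\<forall>q\<in>X. q (\<lambda>x. x \<in> P)" ..
    from FE[OF PQ(2)] obtain Y where Y: "Y \<in> \<C>" "\<forall>q\<in>Y. q (\<lambda>x. x \<in> Q)" ..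
    obtain Z where Z: "Z \<in> \<C>" "Z \<subseteq> X" "Z \<subseteq> Y"
      using ch[OF X(1) Y(1)] X(1) Y(1) by (metis order_refl)
    have "P \<inter> Q \<in> F"
    proof (rule FI[OF Z(1)])
      fix q assume q: "q \<in> Z"
      have "q (\<lambda>x. x \<in> P)" by (rule X(2)[THEN bspec, OF subsetD[OF Z(2) q]])
      moreover have "q (\<lambda>x. x \<in> Q)" by (rule Y(2)[THEN bspec, OF subsetD[OF Z(3) q]])
      ultimately show "q (\<lambda>x. x \<in> P \<inter> Q)" by (simp add: ultra_conj[OF u[OF q Z(1)]])
    qed
    then show "\<exists>R\<in>F. R \<subseteq> P \<inter> Q" by blast
  next
    show "{} \<notin> F"
    proof
      assume "{} \<in> F"
      from FE[OF this] obtain X where X: "X \<in> \<C>" "\<forall>q\<in>X. q (\<lambda>x. x \<in> {})" ..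
      have "X \<noteq> {}" using cl[OF X(1)] by (rule conjunct2)
      then obtain q where q: "q \<in> X" by blast
      have "q (\<lambda>x. x \<in> {})" by (rule X(2)[THEN bspec, OF q])
      then show False using ultra_False[OF u[OF q X(1)]] by simp
    qed
  qed
  then obtain p where p: "ultra p" "\<forall>P\<in>F. p (\<lambda>x. x \<in> P)" by (elim exE conjE)
  have "p \<in> X" if X: "X \<in> \<C>" for X
  proof (rule uclosedD[OF _ p(1)])
    show "uclosed X" using cl[OF X] by (rule conjunct1)
    fix P assume *: "\<And>q. q \<in> X \<Longrightarrow> q P"
    have "Collect P \<in> F" by (rule FI[OF X]) (simp add: *)
    from p(2)[THEN bspec, OF this] show "p P" by simp
  qed
  then have "p \<in> \<Inter>\<C>" by (rule InterI)
  then show "\<Inter>\<C> \<noteq> {}" by (rule nonempty_if_mem)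
qed

lemma minimal_uclosed:
  assumes K0: "uclosed K0" "K0 \<noteq> {}" "Pr K0"
    and Int: "\<And>\<C>. \<C> \<noteq> {} \<Longrightarrow> (\<And>X. X \<in> \<C> \<Longrightarrow> Pr X) \<Longrightarrow> Pr (\<Inter>\<C>)"
  obtains K where "K \<subseteq> K0" "uclosed K" "K \<noteq> {}" "Pr K"
    "\<And>K'. K' \<subseteq> K \<Longrightarrow> uclosed K' \<Longrightarrow> K' \<noteq> {} \<Longrightarrow> Pr K' \<Longrightarrow> K' = K"
proof -
  define \<A> where "\<A> = {K. K \<subseteq> K0 \<and> uclosed K \<and> K \<noteq> {} \<and> Pr K}"
  have "\<exists>m\<in>\<A>. \<forall>a\<in>\<A>. a \<subseteq> m \<longrightarrow> a = m"
  proof (rule predicate_Zorn[where P = "\<lambda>x y. y \<subseteq> x"])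
    show "partial_order_on \<A> (relation_of (\<lambda>x y. y \<subseteq> x) \<A>)"
      by (rule partial_order_on_relation_ofI) (use subset_trans subset_antisym in \<open>blast+\<close>)
    fix C assume C: "C \<in> Chains (relation_of (\<lambda>x y. y \<subseteq> x) \<A>)"
    show "\<exists>u\<in>\<A>. \<forall>a\<in>C. u \<subseteq> a"
    proof (cases "C = {}")
      case True
      have "K0 \<in> \<A>" unfolding \<A>_def using K0 by (intro CollectI conjI) simp_all
      then show ?thesis using True by (intro bexI[of _ K0]) simp_all
    next
      case False
      have CC: "X \<in> \<A> \<and> (X \<subseteq> Y \<or> Y \<subseteq> X)" if "X \<in> C" "Y \<in> C" for X Y
      proof -
        have "\<forall>x\<in>C. \<forall>y\<in>C. (x, y) \<in> relation_of (\<lambda>x y. y \<subseteq> x) \<A> \<or> (y, x) \<in> relation_of (\<lambda>x y. y \<subseteq> x) \<A>"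
          using C unfolding Chains_def by (rule CollectD)
        from this[THEN bspec, OF that(1), THEN bspec, OF that(2)] show ?thesis
          unfolding relation_of_def by (elim disjE CollectE case_prodE) simp_all
      qed
      note CA = CC[THEN conjunct1]
      have C3: "X \<subseteq> K0" "uclosed X \<and> X \<noteq> {}" "Pr X" if "X \<in> C" for X
        using CA[OF that that] unfolding \<A>_def by simp_all
      have ch: "X \<subseteq> Y \<or> Y \<subseteq> X" if "X \<in> C" "Y \<in> C" for X Y
        using CC[OF that] by (rule conjunct2)
      have 1: "uclosed (\<Inter>C) \<and> \<Inter>C \<noteq> {}"
        by (rule uclosed_Inter_chain[OF False ch C3(2)])
      have 2: "Pr (\<Inter>C)" by (rule Int[OF False C3(3)])
      have 3: "\<Inter>C \<subseteq> K0" using False C3(1) by (rule Inf_less_eq[rotated])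
      have "\<Inter>C \<in> \<A>" unfolding \<A>_def using 1 2 3 by (intro CollectI conjI) (elim conjE, assumption)+
      then show ?thesis by (rule bexI[rotated]) (simp add: Inter_lower)
    qed
  qed
  then obtain m where m: "m \<subseteq> K0" "uclosed m" "m \<noteq> {}" "Pr m"
    and min: "\<forall>a\<in>\<A>. a \<subseteq> m \<longrightarrow> a = m" unfolding \<A>_def by (elim bexE CollectE conjE)
  show thesis
  proof (rule that[OF m])
    fix K' assume K': "K' \<subseteq> m" "uclosed K'" "K' \<noteq> {}" "Pr K'"
    then have "K' \<in> \<A>" unfolding \<A>_def using m(1) by (intro CollectI conjI order_trans[OF K'(1)])
    then show "K' = m" by (rule min[THEN bspec, THEN mp]) (rule K'(1))
  qed
qed

text \<open>The continuous image of a compact set. A limit \<open>r\<close> of products with \<open>q\<close> has the form \<open>p \<star> q\<close> for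
every ultrafilter \<open>p\<close> that contains the \<open>q\<close>-sections of the sets in \<open>r\<close> as well as the common sets of \<open>K\<close>.\<close>

lemma uclosed_star:
  assumes K: "uclosed K" "K \<noteq> {}" and q: "ultra q"
  shows "uclosed ((\<lambda>p. p \<star> q) ` K)"
proof (rule uclosedI)
  note uK = uclosed_ultra_mem[OF K(1)]
  fix p assume "p \<in> (\<lambda>p. p \<star> q) ` K" then show "ultra p" by (elim imageE) (simp add: ultra_star[OF uK q])
next
  note uK = uclosed_ultra_mem[OF K(1)]
  fix r assume r: "ultra r" and rK: "\<And>P. (\<And>q'. q' \<in> (\<lambda>p. p \<star> q) ` K \<Longrightarrow> q' P) \<Longrightarrow> r P"
  define F where "F = {{s. q (\<lambda>t. s @ t \<in> P)} \<inter> R | P R. r (\<lambda>x. x \<in> P) \<and> (\<forall>p\<in>K. p (\<lambda>x. x \<in> R))}"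
  have FI: "{s. q (\<lambda>t. s @ t \<in> P)} \<inter> R \<in> F" if "r (\<lambda>x. x \<in> P)" "\<And>p. p \<in> K \<Longrightarrow> p (\<lambda>x. x \<in> R)" for P R
    unfolding F_def
    by (rule CollectI, rule exI[of _ P], rule exI[of _ R]) (simp add: that)
  have FE: thesis' if "A \<in> F"
    "\<And>P R. A = {s. q (\<lambda>t. s @ t \<in> P)} \<inter> R \<Longrightarrow> r (\<lambda>x. x \<in> P) \<Longrightarrow> \<forall>p\<in>K. p (\<lambda>x. x \<in> R) \<Longrightarrow> thesis'"
    for A thesis'
  proof -
    have "\<exists>P R. A = {s. q (\<lambda>t. s @ t \<in> P)} \<inter> R \<and> r (\<lambda>x. x \<in> P) \<and> (\<forall>p\<in>K. p (\<lambda>x. x \<in> R))"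
      using that(1) unfolding F_def by (rule CollectD)
    then show thesis' using that(2) by (elim exE conjE)
  qed
  have "\<exists>p. ultra p \<and> (\<forall>P\<in>F. p (\<lambda>x. x \<in> P))"
  proof (rule ultra_exists)
    have "{s. q (\<lambda>t. s @ t \<in> UNIV)} \<inter> UNIV \<in> F"
      by (rule FI) (simp_all add: ultra_True[OF r] ultra_True[OF uK])
    then show "F \<noteq> {}" by blast
  next
    fix A B assume AB: "A \<in> F" "B \<in> F"
    obtain P R where A: "A = {s. q (\<lambda>t. s @ t \<in> P)} \<inter> R" "r (\<lambda>x. x \<in> P)" "\<forall>p\<in>K. p (\<lambda>x. x \<in> R)"
      by (rule FE[OF AB(1)])
    obtain P' R' where B: "B = {s. q (\<lambda>t. s @ t \<in> P')} \<inter> R'" "r (\<lambda>x. x \<in> P')" "\<forall>p\<in>K. p (\<lambda>x. x \<in> R')"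
      by (rule FE[OF AB(2)])
    have "{s. q (\<lambda>t. s @ t \<in> P \<inter> P')} \<inter> (R \<inter> R') \<in> F"
    proof (rule FI)
      show "r (\<lambda>x. x \<in> P \<inter> P')" using A(2) B(2) by (simp add: ultra_conj[OF r])
      fix p assume p: "p \<in> K"
      show "p (\<lambda>x. x \<in> R \<inter> R')"
        using A(3)[THEN bspec, OF p] B(3)[THEN bspec, OF p] by (simp add: ultra_conj[OF uK[OF p]])
    qed
    moreover have "{s. q (\<lambda>t. s @ t \<in> P \<inter> P')} \<inter> (R \<inter> R') \<subseteq> A \<inter> B"
      by (auto simp: A(1) B(1) ultra_conj[OF q])
    ultimately show "\<exists>C\<in>F. C \<subseteq> A \<inter> B" by (rule bexI[rotated])
  next
    show "{} \<notin> F"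
    proof
      assume "{} \<in> F"
      then obtain P R where A: "{} = {s. q (\<lambda>t. s @ t \<in> P)} \<inter> R" "r (\<lambda>x. x \<in> P)" "\<forall>p\<in>K. p (\<lambda>x. x \<in> R)"
        by (rule FE)
      have no: "q (\<lambda>t. s @ t \<notin> P)" if "s \<in> R" for s
        using A(1) that ultra_not[OF q, of "\<lambda>t. s @ t \<in> P"] by blast
      have "(p \<star> q) (\<lambda>x. x \<notin> P)" if p: "p \<in> K" for p
        unfolding star_def
        by (rule ultra_mono[OF uK[OF p], of "\<lambda>x. x \<in> R"]) (rule A(3)[THEN bspec, OF p], rule no)
      then have "r (\<lambda>x. x \<notin> P)" by (intro rK) (elim imageE, simp)
      then show False using ultra_not[OF r, of "\<lambda>x. x \<in> P"] A(2) by simp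
    qed
  qed
  then obtain p where p: "ultra p" "\<forall>A\<in>F. p (\<lambda>x. x \<in> A)" by (elim exE conjE)
  have pF: "p (\<lambda>s. q (\<lambda>t. s @ t \<in> P) \<and> s \<in> R)"
    if "r (\<lambda>x. x \<in> P)" "\<And>p. p \<in> K \<Longrightarrow> p (\<lambda>x. x \<in> R)" for P R
  proof -
    have "{s. q (\<lambda>t. s @ t \<in> P)} \<inter> R \<in> F" by (rule FI) (fact that)+
    from p(2)[THEN bspec, OF this] show ?thesis by simp
  qed
  have "p \<in> K"
  proof (rule uclosedD[OF K(1) p(1)])
    fix R assume *: "\<And>q. q \<in> K \<Longrightarrow> q R"
    have "p (\<lambda>s. q (\<lambda>t. s @ t \<in> UNIV) \<and> s \<in> Collect R)"
      by (rule pF) (simp_all add: ultra_True[OF r] *)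
    then show "p R" by (simp add: ultra_True[OF q])
  qed
  moreover have "r = p \<star> q"
  proof (rule ultra_ext[OF r ultra_star[OF p(1) q]])
    fix P assume P: "r P"
    have "p (\<lambda>s. q (\<lambda>t. s @ t \<in> Collect P) \<and> s \<in> UNIV)"
      by (rule pF) (simp_all add: P ultra_True[OF uK])
    then show "(p \<star> q) P" by (simp add: star_def)
  qed
  ultimately show "r \<in> (\<lambda>p. p \<star> q) ` K" by simp
qed

text \<open>Ellis' lemma. In a minimal closed subsemigroup \<open>K1\<close> every element \<open>e\<close> is idempotent: by minimality
\<open>K1 \<star> e = K1\<close>, so the set of \<open>p\<close> with \<open>p \<star> e = e\<close> is a nonempty closed subsemigroup, hence again
all of \<open>K1\<close>.\<close>

lemma Ellis_idempotent:
  assumes K: "uclosed K" "K \<noteq> {}" "\<And>p q. p \<in> K \<Longrightarrow> q \<in> K \<Longrightarrow> p \<star> q \<in> K"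
  obtains e where "e \<in> K" "e \<star> e = e"
proof -
  obtain K1 where K1: "K1 \<subseteq> K" "uclosed K1" "K1 \<noteq> {}" "\<forall>p\<in>K1. \<forall>q\<in>K1. p \<star> q \<in> K1"
    and min: "\<And>K'. K' \<subseteq> K1 \<Longrightarrow> uclosed K' \<Longrightarrow> K' \<noteq> {} \<Longrightarrow> \<forall>p\<in>K'. \<forall>q\<in>K'. p \<star> q \<in> K' \<Longrightarrow> K' = K1"
  proof (rule minimal_uclosed[where Pr = "\<lambda>K. \<forall>p\<in>K. \<forall>q\<in>K. p \<star> q \<in> K" and ?K0.0 = K])
    show "\<forall>p\<in>\<Inter>\<C>. \<forall>q\<in>\<Inter>\<C>. p \<star> q \<in> \<Inter>\<C>"
      if "\<And>X. X \<in> \<C> \<Longrightarrow> \<forall>p\<in>X. \<forall>q\<in>X. p \<star> q \<in> X" for \<C>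
      using that by simp
  qed (use K in simp_all)
  obtain e where e: "e \<in> K1" using K1 by blast
  note u = uclosed_ultra_mem[OF K1(2)]
  have "(\<lambda>p. p \<star> e) ` K1 = K1"
  proof (rule min)
    show "uclosed ((\<lambda>p. p \<star> e) ` K1)" by (rule uclosed_star) (use K1 u e in auto)
    show "\<forall>p\<in>(\<lambda>p. p \<star> e) ` K1. \<forall>q\<in>(\<lambda>p. p \<star> e) ` K1. p \<star> q \<in> (\<lambda>p. p \<star> e) ` K1"
      using K1(4) e by (auto simp flip: star_assoc)
  qed (use K1 e in auto)
  then obtain p0 where p0: "p0 \<in> K1" "p0 \<star> e = e" using e by (metis imageE)
  \<comment> \<open>The stabiliser of \<open>e\<close> is closed because it is the preimage of a point.\<close>
  let ?L = "{p\<in>K1. p \<star> e = e}"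
  have "?L = K1"
  proof (rule min)
    show "uclosed ?L"
    proof (rule uclosedI)
      fix p assume p: "ultra p" "\<And>P. (\<And>q. q \<in> ?L \<Longrightarrow> q P) \<Longrightarrow> p P"
      have "p \<in> K1"
      proof (rule uclosedD[OF K1(2) p(1)])
        fix P assume *: "\<And>q. q \<in> K1 \<Longrightarrow> q P"
        show "p P" by (rule p(2), rule *) simp
      qed
      moreover have "e = p \<star> e"
      proof (rule ultra_ext[OF u[OF e] ultra_star[OF p(1) u[OF e]]])
        fix P assume "e P"
        show "(p \<star> e) P"
          unfolding star_def
        proof (rule p(2))
          fix q assume "q \<in> ?L"
          then have "(q \<star> e) P" using \<open>e P\<close> by simp
          then show "q (\<lambda>s. e (\<lambda>t. P (s @ t)))" by (simp add: star_def)
        qed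
      qed
      ultimately show "p \<in> ?L" by simp
    qed (use u in simp)
    show "\<forall>p\<in>?L. \<forall>q\<in>?L. p \<star> q \<in> ?L" using K1(4) by (auto simp: star_assoc)
  qed (use p0 in auto)
  then have "e \<star> e = e" using e by blast
  then show thesis using that e K1(1) by blast
qed

section \<open>Minimal idempotents\<close>

text \<open>An idempotent of a minimal left ideal, characterised without mentioning ideals: \<open>e\<close> is recovered from
every product \<open>p \<star> e\<close> by a further multiplication on the left.\<close>

definition min_idem :: "(('a list \<Rightarrow> bool) \<Rightarrow> bool) \<Rightarrow> bool" where
  "min_idem e \<longleftrightarrow> ultra e \<and> e \<star> e = e \<and> (\<forall>p. ultra p \<longrightarrow> (\<exists>u. ultra u \<and> u \<star> (p \<star> e) = e))"

lemma min_idemD: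
  assumes "min_idem e"
  shows "ultra e" "e \<star> e = e" "ultra p \<Longrightarrow> \<exists>u. ultra u \<and> u \<star> (p \<star> e) = e"
  using assms by (simp_all add: min_idem_def)

lemma uclosed_ultra: "uclosed (Collect ultra)"
  by (simp add: uclosed_def)

text \<open>A minimal closed left ideal \<open>L\<close> contains an idempotent \<open>e\<close>, and the left ideal generated by \<open>p \<star> e\<close> is
closed and contained in \<open>L\<close>, hence equal to \<open>L\<close> and contains \<open>e\<close>.\<close>

lemma min_idem_exists:
  fixes K :: "(('a list \<Rightarrow> bool) \<Rightarrow> bool) set"
  assumes K: "uclosed K" "K \<noteq> {}" "\<And>p q. ultra p \<Longrightarrow> q \<in> K \<Longrightarrow> p \<star> q \<in> K"
  obtains e where "e \<in> K" "min_idem e"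
proof -
  obtain L where L: "L \<subseteq> K" "uclosed L" "L \<noteq> {}" "\<forall>p q. ultra p \<longrightarrow> q \<in> L \<longrightarrow> p \<star> q \<in> L"
    and min: "\<And>K'. K' \<subseteq> L \<Longrightarrow> uclosed K' \<Longrightarrow> K' \<noteq> {} \<Longrightarrow> \<forall>p q. ultra p \<longrightarrow> q \<in> K' \<longrightarrow> p \<star> q \<in> K' \<Longrightarrow> K' = L"
  proof (rule minimal_uclosed[where Pr = "\<lambda>K. \<forall>p q. ultra p \<longrightarrow> q \<in> K \<longrightarrow> p \<star> q \<in> K" and ?K0.0 = K])
    show "\<forall>p q. ultra p \<longrightarrow> q \<in> \<Inter>\<C> \<longrightarrow> p \<star> q \<in> \<Inter>\<C>"
      if "\<And>X. X \<in> \<C> \<Longrightarrow> \<forall>p q. ultra p \<longrightarrow> q \<in> X \<longrightarrow> p \<star> q \<in> X" for \<C>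
      using that by simp
  qed (use K in simp_all)
  note u = uclosed_ultra_mem[OF L(2)]
  obtain e where e: "e \<in> L" "e \<star> e = e" by (rule Ellis_idempotent[OF L(2,3)]) (use L(4) u in auto)
  have "\<exists>u. ultra u \<and> u \<star> (p \<star> e) = e" if p: "ultra p" for p
  proof -
    let ?q = "p \<star> e"
    have q: "?q \<in> L" using L(4) p e by blast
    have "(\<lambda>r. r \<star> ?q) ` Collect ultra = L"
    proof (rule min)
      show "uclosed ((\<lambda>r. r \<star> ?q) ` Collect ultra)"
        by (rule uclosed_star[OF uclosed_ultra _ u[OF q]]) (use p in auto)
      show "\<forall>s t. ultra s \<longrightarrow> t \<in> (\<lambda>r. r \<star> ?q) ` Collect ultra \<longrightarrow> s \<star> t \<in> (\<lambda>r. r \<star> ?q) ` Collect ultra"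
      proof (intro allI impI)
        fix s t :: "('a list \<Rightarrow> bool) \<Rightarrow> bool"
        assume "ultra s" "t \<in> (\<lambda>r. r \<star> ?q) ` Collect ultra"
        then obtain r where "ultra r" "t = r \<star> ?q" by auto
        then show "s \<star> t \<in> (\<lambda>r. r \<star> ?q) ` Collect ultra"
          using \<open>ultra s\<close> by (intro image_eqI[of _ _ "s \<star> r"]) (simp_all add: star_assoc ultra_star)
      qed
    qed (use L(4) q p in auto)
    then show ?thesis using e(1) by (metis (no_types, lifting) imageE mem_Collect_eq)
  qed
  then have "min_idem e" using e u unfolding min_idem_def by blast
  then show thesis using that e L(1) by blast
qed

section \<open>Left variable words\<close>

text \<open>Variable words are words over the letters and the variable \<open>None\<close>.\<close>

definition subst_letter :: "'l \<Rightarrow> 'l option list \<Rightarrow> 'l list" where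
  "subst_letter a w = map (\<lambda>x. case x of None \<Rightarrow> a | Some b \<Rightarrow> b) w"

lemma subst_letter_append: "subst_letter a (s @ t) = subst_letter a s @ subst_letter a t"
  by (simp add: subst_letter_def)

lemma subst_letter_Some: "subst_letter a (map Some w) = w"
  by (simp add: subst_letter_def comp_def)

text \<open>Let \<open>V\<close> be a minimal idempotent on constant words and \<open>J\<close> its copy among the variable words. A minimal
idempotent below \<open>J\<close> yields an idempotent \<open>g\<close> on variable words all of whose substitution instances
equal \<open>V\<close>, because they are idempotents below the minimal \<open>V\<close>. The ultrafilters that \<open>g\<close> fixes on both
sides form a group with unit \<open>g\<close>, so \<open>g \<star> x \<star> g\<close> has an inverse, where \<open>x\<close> is the variable. Substituting a letter \<open>a\<close> into
\<open>g \<star> x \<star> l = g\<close> gives the claim for all letters with the same \<open>l\<close>.\<close>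

lemma min_idem_absorbs_letter:
  obtains V :: "('l list \<Rightarrow> bool) \<Rightarrow> bool" and Y where "ultra V" "V \<star> V = V" "ultra Y"
    "\<And>a. V \<star> (\<lambda>P. P [a]) \<star> push (subst_letter a) Y \<star> V = V"
proof -
  obtain V :: "('l list \<Rightarrow> bool) \<Rightarrow> bool" where V: "min_idem V"
  proof (rule min_idem_exists[of "Collect ultra :: (('l list \<Rightarrow> bool) \<Rightarrow> bool) set"])
    have "(\<lambda>P :: 'l list \<Rightarrow> bool. P []) \<in> Collect ultra" by (simp add: ultra_point)
    then show "Collect ultra \<noteq> ({} :: (('l list \<Rightarrow> bool) \<Rightarrow> bool) set)" by (rule nonempty_if_mem)
  qed (simp_all add: ultra_star uclosed_ultra)
  note uV = min_idemD(1)[OF V] and VV = min_idemD(2)[OF V]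
  define J where "J = push (map Some) V"
  let ?s = "\<lambda>a. push (subst_letter a)"
  have uJ: "ultra J" unfolding J_def by (rule ultra_push[OF uV])
  have JJ: "J \<star> J = J" unfolding J_def by (simp add: VV flip: push_star)
  have sJ: "?s a J = V" for a unfolding J_def push_def by (simp add: subst_letter_Some)
  have s_star: "?s a (p \<star> q) = ?s a p \<star> ?s a q" for a p q
    by (rule push_star) (rule subst_letter_append)
  obtain f where f: "f \<in> (\<lambda>p. p \<star> J) ` Collect ultra" "min_idem f"
  proof (rule min_idem_exists[of "(\<lambda>p. p \<star> J) ` Collect ultra"])
    show "uclosed ((\<lambda>p. p \<star> J) ` Collect ultra)"
      by (rule uclosed_star[OF uclosed_ultra _ uJ]) (use uJ in blast)
    show "(\<lambda>p. p \<star> J) ` Collect ultra \<noteq> {}" using uJ by auto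
    fix p q :: "('l option list \<Rightarrow> bool) \<Rightarrow> bool"
    assume "ultra p" "q \<in> (\<lambda>p. p \<star> J) ` Collect ultra"
    then obtain r where "ultra r" "q = r \<star> J" by auto
    then show "p \<star> q \<in> (\<lambda>p. p \<star> J) ` Collect ultra"
      using \<open>ultra p\<close> by (intro image_eqI[of _ _ "p \<star> r"]) (simp_all add: star_assoc ultra_star)
  qed
  note uf = min_idemD(1)[OF f(2)] and ff = min_idemD(2)[OF f(2)] and fmin = min_idemD(3)[OF f(2)]
  have fJ: "f \<star> J = f" using f(1) by (auto simp: star_assoc JJ)
  define g where "g = J \<star> f"
  have ug: "ultra g" unfolding g_def by (rule ultra_star[OF uJ uf])
  have gf: "g \<star> f = g" unfolding g_def by (simp add: star_assoc ff)
  have fg: "f \<star> g = f" unfolding g_def by (simp add: fJ ff flip: star_assoc)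
  have gg: "g \<star> g = g" by (metis fg g_def gf star_assoc)
  have Jg: "J \<star> g = g" unfolding g_def by (simp add: JJ flip: star_assoc)
  \<comment> \<open>The instance of \<open>g\<close> absorbs \<open>V\<close> on both sides, so minimality of \<open>V\<close> forces equality.\<close>
  have sg: "?s a g = V" for a
  proof -
    let ?v = "?s a g"
    have uv: "ultra ?v" by (rule ultra_push[OF ug])
    have vv: "?v \<star> ?v = ?v" by (metis gg s_star)
    have "g \<star> J = g" unfolding g_def by (simp add: star_assoc fJ)
    then have vV: "?v \<star> V = ?v" by (metis s_star sJ)
    have Vv: "V \<star> ?v = ?v" by (metis Jg s_star sJ)
    obtain u where u: "u \<star> (?v \<star> V) = V" using min_idemD(3)[OF V uv] by blast
    then have "V \<star> ?v = V" by (metis vV vv star_assoc)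
    then show ?thesis using Vv by simp
  qed
  define x where "x = (\<lambda>P :: 'l option list \<Rightarrow> bool. P [None])"
  have ux: "ultra x" unfolding x_def by (rule ultra_point)
  define r where "r = g \<star> x \<star> g"
  have gr: "g \<star> r = r" and rg: "r \<star> g = r" unfolding r_def by (metis gg star_assoc)+
  \<comment> \<open>Every element of \<open>g \<star> \<beta>W \<star> g\<close> has a left inverse there, and a monoid with left inverses is a group.\<close>
  have left_inv: "\<exists>l. ultra l \<and> g \<star> l = l \<and> l \<star> g = l \<and> l \<star> q = g"
    if q: "ultra q" "g \<star> q = q" "q \<star> g = q" for q
  proof -
    obtain u where u: "ultra u" "u \<star> ((q \<star> J) \<star> f) = f" using fmin[OF ultra_star[OF q(1) uJ]] by blast
    have "u \<star> q = f" using u(2) q(3) by (simp add: star_assoc g_def)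
    then have "(g \<star> u \<star> g) \<star> q = g" using q(2) gf by (simp add: star_assoc)
    moreover have "g \<star> (g \<star> u \<star> g) = g \<star> u \<star> g" "(g \<star> u \<star> g) \<star> g = g \<star> u \<star> g"
      by (metis gg star_assoc)+
    ultimately show ?thesis using ultra_star u(1) ug by blast
  qed
  obtain l where l: "ultra l" "g \<star> l = l" "l \<star> g = l" "l \<star> r = g"
    using left_inv[OF _ gr rg] ultra_star ug ux r_def by metis
  obtain l2 where l2: "l2 \<star> l = g" "l2 \<star> g = l2" using left_inv[OF l(1-3)] by blast
  have "r = l2" by (metis gr l(4) l2 star_assoc)
  then have rl: "r \<star> l = g" using l2 by simp
  have gxl: "g \<star> x \<star> l = g" using rl l(2) by (simp add: r_def star_assoc)
  show thesis
  proof (rule that[OF uV VV l(1)])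
    fix a
    have sx: "?s a x = (\<lambda>P. P [a])" by (simp add: x_def push_def subst_letter_def)
    have "V \<star> (\<lambda>P. P [a]) \<star> ?s a l = ?s a (g \<star> x \<star> l)" by (simp only: s_star sg sx)
    also have "\<dots> = V" by (simp add: gxl sg)
    finally show "V \<star> (\<lambda>P. P [a]) \<star> ?s a l \<star> V = V" by (simp add: VV)
  qed
qed

text \<open>The theorem of Carlson and Simpson for left variable words. Let \<open>U = Y \<star> V\<close>. A word \<open>s\<close> is good if it
has the colour \<open>k\<close> of almost all words and if for almost all variable words \<open>y\<close> the words \<open>s a y(a)\<close> have
it too. Since \<open>V = V \<star> [a] \<star> Y[a] \<star> V\<close>, almost all words are good, and almost all \<open>y\<close> keep a good word
good. So one can append variable words one at a time such that all instances so far stay good.\<close>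

theorem left_variable_words:
  fixes c :: "'l list \<Rightarrow> 'c"
  assumes "finite L" "finite (range c)"
  obtains k w0 and v :: "nat \<Rightarrow> 'l option list" where
    "\<And>as. set as \<subseteq> L \<Longrightarrow> c (w0 @ concat (map (\<lambda>i. as ! i # subst_letter (as ! i) (v i)) [0..<length as])) = k"
proof -
  obtain V :: "('l list \<Rightarrow> bool) \<Rightarrow> bool" and Y where V: "ultra V" "V \<star> V = V" and Y: "ultra Y"
    and VY: "\<And>a. V \<star> (\<lambda>P. P [a]) \<star> push (subst_letter a) Y \<star> V = V"
    using min_idem_absorbs_letter[where thesis = thesis] by blast
  have "V (\<lambda>s. \<exists>k\<in>range c. c s = k)" using ultra_True[OF V(1)] by simp
  then obtain k where k: "V (\<lambda>s. c s = k)" using ultra_bex[OF V(1) assms(2), of "\<lambda>k s. c s = k"] by blast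
  define U where "U = Y \<star> push (map Some) V"
  have U: "ultra U" unfolding U_def by (intro ultra_star Y ultra_push V)
  have Ueq: "U (\<lambda>y. P (subst_letter a y)) \<longleftrightarrow> Y (\<lambda>y. V (\<lambda>t. P (subst_letter a y @ t)))" for P a
    by (simp add: U_def star_def push_def subst_letter_append subst_letter_Some)
  \<comment> \<open>The absorption law, read as: extending a random word by \<open>a\<close> and a random variable word with \<open>a\<close>
    substituted gives a random word again.\<close>
  have VU: "V (\<lambda>s. U (\<lambda>y. P (s @ a # subst_letter a y))) \<longleftrightarrow> V P" for P a
  proof -
    have "V P \<longleftrightarrow> (V \<star> (\<lambda>P. P [a]) \<star> push (subst_letter a) Y \<star> V) P" by (simp only: VY)
    also have "\<dots> \<longleftrightarrow> V (\<lambda>s. Y (\<lambda>y. V (\<lambda>t. P (s @ a # subst_letter a y @ t))))"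
      by (simp add: star_def push_def)
    also have "\<dots> \<longleftrightarrow> V (\<lambda>s. U (\<lambda>y. P (s @ a # subst_letter a y)))"
      using Ueq[of "\<lambda>x. P (s @ a # x)" a for s] by simp
    finally show ?thesis by blast
  qed
  define good where "good s \<longleftrightarrow> c s = k \<and> (\<forall>a\<in>L. U (\<lambda>y. c (s @ a # subst_letter a y) = k))" for s
  have Vgood: "V good"
    unfolding good_def using k VU[of "\<lambda>s. c s = k"] by (simp add: ultra_conj[OF V(1)] ultra_ball[OF V(1) assms(1)])
  have step: "U (\<lambda>y. good (s @ a # subst_letter a y))" if s: "good s" and a: "a \<in> L" for s a
  proof -
    have h: "U (\<lambda>y. c (s @ a # subst_letter a y) = k)" using s a unfolding good_def by blast
    have "U (\<lambda>y. U (\<lambda>y'. c ((s @ a # subst_letter a y) @ b # subst_letter b y') = k))" for b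
    proof -
      have "Y (\<lambda>y. V (\<lambda>t. c (s @ a # subst_letter a y @ t) = k))" using h Ueq[of "\<lambda>x. c (s @ a # x) = k" a] by simp
      then have "Y (\<lambda>y. V (\<lambda>t. U (\<lambda>y'. c (s @ a # subst_letter a y @ t @ b # subst_letter b y') = k)))"
        using VU[of "\<lambda>t. c (s @ a # subst_letter a y @ t) = k" b for y] by simp
      then show ?thesis using Ueq[of "\<lambda>x. U (\<lambda>y'. c (s @ a # x @ b # subst_letter b y') = k)" a] by simp
    qed
    then show ?thesis using h unfolding good_def by (simp add: ultra_conj[OF U] ultra_ball[OF U assms(1)])
  qed
  obtain w0 where w0: "good w0" using ultra_ex[OF V(1) Vgood] by blast
  define admits where "admits F y \<longleftrightarrow> (\<forall>s\<in>F. \<forall>a\<in>L. good (s @ a # subst_letter a y))" for F y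
  have admits: "\<exists>y. admits F y" if F: "finite F" "\<forall>s\<in>F. good s" for F
  proof (rule ultra_ex[OF U])
    have "U (\<lambda>y. \<forall>a\<in>L. good (s @ a # subst_letter a y))" if "s \<in> F" for s
      unfolding ultra_ball[OF U assms(1)] using step F(2) that by blast
    then show "U (admits F)"
      unfolding admits_def by (simp add: ultra_ball[OF U F(1)])
  qed
  define ext where "ext F = (\<lambda>(s, a). s @ a # subst_letter a (SOME y. admits F y)) ` (F \<times> L)" for F
  \<comment> \<open>All instances of the first \<open>n\<close> variable words.\<close>
  define Fs where "Fs n = (ext ^^ n) {w0}" for n
  have Fs: "finite (Fs n) \<and> (\<forall>s\<in>Fs n. good s)" for n
  proof (induction n)
    case 0 then show ?case by (simp add: Fs_def w0)
  next
    case (Suc n)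
    then have "\<exists>y. admits (Fs n) y" using admits by blast
    then have "admits (Fs n) (SOME y. admits (Fs n) y)" by (rule someI_ex)
    then have "\<forall>s\<in>ext (Fs n). good s" unfolding ext_def admits_def by auto
    moreover have "finite (ext (Fs n))" unfolding ext_def using Suc assms(1) by simp
    ultimately show ?case by (simp add: Fs_def)
  qed
  define v where "v n = (SOME y. admits (Fs n) y)" for n
  show thesis
  proof (rule that)
    fix as assume "set as \<subseteq> L"
    then have "w0 @ concat (map (\<lambda>i. as ! i # subst_letter (as ! i) (v i)) [0..<length as]) \<in> Fs (length as)"
    proof (induction as rule: rev_induct)
      case Nil then show ?case by (simp add: Fs_def)
    next
      case (snoc a as)
      have eq: "map (\<lambda>i. (as @ [a]) ! i # subst_letter ((as @ [a]) ! i) (v i)) [0..<length as]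
        = map (\<lambda>i. as ! i # subst_letter (as ! i) (v i)) [0..<length as]"
        by (rule map_cong) (auto simp: nth_append)
      have ext: "s @ a # subst_letter a (v (length as)) \<in> Fs (Suc (length as))" if "s \<in> Fs (length as)" for s
      proof -
        have "(\<lambda>(s, a). s @ a # subst_letter a (v (length as))) (s, a) \<in> ext (Fs (length as))"
          unfolding ext_def v_def by (rule imageI) (use that snoc.prems in simp)
        then show ?thesis by (simp add: Fs_def)
      qed
      show ?case using ext[OF snoc.IH] snoc.prems by (simp add: eq)
    qed
    then show "c (w0 @ concat (map (\<lambda>i. as ! i # subst_letter (as ! i) (v i)) [0..<length as])) = k"
      using Fs unfolding good_def by blast
  qed
qed

section \<open>Perfect trees as branching maps\<close>

text \<open>A perfect tree is described by the map that sends an address, a finite binary sequence, to the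
splitting node reached by turning left and right as the address says.\<close>

definition emb :: "(bool list \<Rightarrow> node) \<Rightarrow> bool" where
  "emb E \<longleftrightarrow> (\<forall>\<sigma> b. prefix (E \<sigma> @ [b]) (E (\<sigma> @ [b])))"

definition tree_of :: "(bool list \<Rightarrow> node) \<Rightarrow> tree" where
  "tree_of E = {t. \<exists>\<sigma>. prefix t (E \<sigma>)}"

lemma emb_step: "emb E \<Longrightarrow> prefix (E \<sigma> @ [b]) (E (\<sigma> @ [b]))"
  by (simp add: emb_def)

lemma emb_mono:
  assumes "emb E" "prefix \<sigma> \<tau>"
  shows "prefix (E \<sigma>) (E \<tau>)"
proof -
  obtain \<rho> where "\<tau> = \<sigma> @ \<rho>" using assms(2) by (auto elim: prefixE)
  moreover have "prefix (E \<sigma>) (E (\<sigma> @ \<rho>))"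
  proof (induction \<rho> rule: rev_induct)
    case (snoc b \<rho>)
    have "prefix (E (\<sigma> @ \<rho>)) (E (\<sigma> @ \<rho>) @ [b])" by simp
    then show ?case using snoc emb_step[OF assms(1), of "\<sigma> @ \<rho>" b] by (metis append_assoc prefix_order.trans)
  qed simp
  ultimately show ?thesis by simp
qed

lemma emb_branch:
  assumes "emb E" "prefix (\<sigma> @ [b]) \<tau>"
  shows "prefix (E \<sigma> @ [b]) (E \<tau>)"
  using emb_step[OF assms(1)] emb_mono[OF assms] prefix_order.trans by blast

lemma diverge:
  assumes "prefix (s @ [b]) x" "prefix (s @ [c]) y" "b \<noteq> c"
  shows "\<not> prefix x y" "\<not> prefix y x"
  using assms by (auto simp: prefix_def)

text \<open>The node where two incomparable sequences part is unique; this identifies splitting nodes.\<close>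

lemma diverge_unique:
  assumes "prefix (s @ [b]) x" "prefix (s @ [c]) y" "b \<noteq> c"
    and "prefix (t @ [b']) x" "prefix (t @ [c']) y" "b' \<noteq> c'"
  shows "s = t"
proof -
  have 1: False if st: "strict_prefix s t" and x: "prefix (s @ [b]) x" "prefix (s @ [c]) y" "b \<noteq> c" "prefix t x" "prefix t y"
    for s t b c
  proof -
    obtain a where a: "prefix (s @ [a]) t" using st by (auto simp: strict_prefix_def prefix_def) (metis neq_Nil_conv)
    then have "a = b" "a = c" using x by (auto simp: prefix_def)
    then show False using x(3) by simp
  qed
  have p: "prefix s x" "prefix s y" "prefix t x" "prefix t y"
    using assms by (auto simp: prefix_def)
  then consider "strict_prefix s t" | "strict_prefix t s" | "s = t"
    using prefix_same_cases[OF p(1,3)] by (auto simp: strict_prefix_def)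
  then show ?thesis using 1[OF _ assms(1-3) p(3,4)] 1[OF _ assms(4-6) p(1,2)] by cases auto
qed

lemma list_compare:
  fixes \<sigma> \<tau> :: "bool list"
  obtains "prefix \<sigma> \<tau>" | b where "prefix (\<tau> @ [b]) \<sigma>"
    | \<rho> b where "prefix (\<rho> @ [b]) \<sigma>" "prefix (\<rho> @ [\<not> b]) \<tau>"
proof -
  consider "prefix \<sigma> \<tau>" | "strict_prefix \<tau> \<sigma>" | "\<sigma> \<parallel> \<tau>"
    unfolding parallel_def strict_prefix_def by auto
  then show thesis
  proof cases
    case 1 then show ?thesis by (rule that(1))
  next
    case 2
    then obtain b \<rho> where "\<sigma> = \<tau> @ b # \<rho>" by (rule strict_prefixE')
    then have "prefix (\<tau> @ [b]) \<sigma>" by simp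
    then show ?thesis by (rule that(2))
  next
    case 3
    from parallel_decomp[OF this] obtain as b bs c cs
      where d: "b \<noteq> c" "\<sigma> = as @ b # bs" "\<tau> = as @ c # cs" by (elim exE conjE)
    have "c = (\<not> b)" using d(1) by simp
    then have "prefix (as @ [b]) \<sigma>" "prefix (as @ [\<not> b]) \<tau>"
      unfolding d(2,3) prefix_def by simp_all
    then show ?thesis by (rule that(3))
  qed
qed

lemma emb_prefix_iff:
  assumes "emb E"
  shows "prefix (E \<sigma>) (E \<tau>) \<longleftrightarrow> prefix \<sigma> \<tau>"
proof
  assume P: "prefix (E \<sigma>) (E \<tau>)"
  show "prefix \<sigma> \<tau>"
  proof (rule list_compare[of \<sigma> \<tau>])
    fix b assume "prefix (\<tau> @ [b]) \<sigma>"
    then have "prefix (E \<tau> @ [b]) (E \<tau>)" using emb_branch[OF assms] P prefix_order.trans by blast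
    then show ?thesis by (auto dest: prefix_length_le)
  next
    fix \<rho> b assume "prefix (\<rho> @ [b]) \<sigma>" "prefix (\<rho> @ [\<not> b]) \<tau>"
    then show ?thesis using diverge(1)[OF emb_branch[OF assms] emb_branch[OF assms]] P by blast
  qed
qed (rule emb_mono[OF assms])

lemma emb_eq_iff: "emb E \<Longrightarrow> E \<sigma> = E \<tau> \<longleftrightarrow> \<sigma> = \<tau>"
  by (metis emb_prefix_iff prefix_order.antisym prefix_order.refl)

lemma emb_length_ge: "emb E \<Longrightarrow> length \<sigma> \<le> length (E \<sigma>)"
proof (induction \<sigma> rule: rev_induct)
  case (snoc b \<sigma>)
  then show ?case using prefix_length_le[OF emb_step[of E \<sigma> b]] by simp
qed simp

lemma is_tree_tree_of: "is_tree (tree_of E)"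
  unfolding is_tree_def tree_of_def using prefix_order.trans by blast

lemma tree_of_mem: "E \<sigma> \<in> tree_of E"
  by (auto simp: tree_of_def)

text \<open>Two extensions of a splitting node through its two successors lie below \<open>E \<sigma>\<close> and \<open>E \<tau>\<close> for incomparable
addresses, and these images part where the addresses do.\<close>

lemma Split_tree_of:
  assumes "emb E"
  shows "Split (tree_of E) = range E"
proof
  show "range E \<subseteq> Split (tree_of E)"
    using emb_step[OF assms] by (auto simp: Split_def tree_of_mem) (auto simp: tree_of_def)
  show "Split (tree_of E) \<subseteq> range E"
  proof
    fix t assume "t \<in> Split (tree_of E)"
    then obtain \<sigma> \<tau> where st: "prefix (t @ [False]) (E \<sigma>)" "prefix (t @ [True]) (E \<tau>)"
      by (auto simp: Split_def tree_of_def)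
    note n = diverge[OF this]
    show "t \<in> range E"
    proof (rule list_compare[of \<sigma> \<tau>])
      assume "prefix \<sigma> \<tau>" then show ?thesis using emb_mono[OF assms] n by blast
    next
      fix b assume "prefix (\<tau> @ [b]) \<sigma>"
      then show ?thesis using emb_mono[OF assms] n append_prefixD by blast
    next
      fix \<rho> b assume "prefix (\<rho> @ [b]) \<sigma>" "prefix (\<rho> @ [\<not> b]) \<tau>"
      then have "t = E \<rho>" using diverge_unique[OF st _ emb_branch[OF assms] emb_branch[OF assms]] by blast
      then show ?thesis by blast
    qed
  qed
qed

lemma perfect_tree_of: "emb E \<Longrightarrow> perfect_tree (tree_of E)"
  unfolding perfect_tree_def using is_tree_tree_of Split_tree_of by (auto simp: tree_of_def)

lemma tree_prefix: "is_tree T \<Longrightarrow> t \<in> T \<Longrightarrow> prefix s t \<Longrightarrow> s \<in> T"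
  unfolding is_tree_def by blast

lemma perfect_is_tree: "perfect_tree T \<Longrightarrow> is_tree T"
  by (simp add: perfect_tree_def)

lemma Split_in: "s \<in> Split T \<Longrightarrow> s \<in> T" "s \<in> Split T \<Longrightarrow> s @ [b] \<in> T"
  by (cases b; simp add: Split_def)+

lemma SplitI: "s @ [False] \<in> T \<Longrightarrow> s @ [True] \<in> T \<Longrightarrow> is_tree T \<Longrightarrow> s \<in> Split T"
  unfolding Split_def using tree_prefix[of T "s @ [False]" s] by simp

lemma Split_mono: "S \<subseteq> T \<Longrightarrow> Split S \<subseteq> Split T"
  unfolding Split_def by blast

lemma tree_of_subset: "is_tree T \<Longrightarrow> range E \<subseteq> T \<Longrightarrow> tree_of E \<subseteq> T"
  unfolding tree_of_def using tree_prefix by blast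

lemma perfect_long_split:
  assumes "perfect_tree T" "t \<in> T"
  shows "\<exists>s\<in>Split T. prefix t s \<and> n \<le> length s"
proof (induction n)
  case 0 then show ?case using assms unfolding perfect_tree_def by auto
next
  case (Suc n)
  then obtain s where s: "s \<in> Split T" "prefix t s" "n \<le> length s" by blast
  then obtain s' where s': "s' \<in> Split T" "prefix (s @ [False]) s'"
    using assms Split_in(2) unfolding perfect_tree_def by blast
  then have "prefix t s'" using s(2) append_prefixD prefix_order.trans by blast
  then show ?case using s s' prefix_length_le[OF s'(2)] by (intro bexI[of _ s']) auto
qed

text \<open>Addresses are consumed in reverse, so that primitive recursion adds the last turn; \<open>nx n t\<close> chooses the
splitting node above \<open>t\<close> for addresses of length \<open>n\<close>.\<close>

primrec grow :: "(nat \<Rightarrow> node \<Rightarrow> node) \<Rightarrow> bool list \<Rightarrow> node" where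
  "grow nx [] = nx 0 []"
| "grow nx (b # \<sigma>) = nx (Suc (length \<sigma>)) (grow nx \<sigma> @ [b])"

text \<open>The growth condition is used to make one tree split later than another at every address length.\<close>

lemma emb_into_perfect:
  fixes g :: "nat \<Rightarrow> nat"
  assumes T: "perfect_tree T" "T \<noteq> {}"
  obtains E where "emb E" "range E \<subseteq> Split T" "\<And>\<sigma>. g (length \<sigma>) < length (E \<sigma>)"
proof -
  define nx where "nx n t = (SOME s. s \<in> Split T \<and> prefix t s \<and> g n < length s)" for n t
  have nx: "nx n t \<in> Split T \<and> prefix t (nx n t) \<and> g n < length (nx n t)" if "t \<in> T" for n t
  proof -
    obtain s where "s \<in> Split T" "prefix t s" "Suc (g n) \<le> length s"
      using perfect_long_split[OF T(1) \<open>t \<in> T\<close>] by blast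
    then have "s \<in> Split T \<and> prefix t s \<and> g n < length s" by simp
    then show ?thesis unfolding nx_def by (rule someI)
  qed
  obtain t where "t \<in> T" using T(2) by blast
  then have "[] \<in> T" by (rule tree_prefix[OF perfect_is_tree[OF T(1)] _ Nil_prefix])
  have G: "grow nx \<sigma> \<in> Split T \<and> g (length \<sigma>) < length (grow nx \<sigma>)" for \<sigma>
  proof (induction \<sigma>)
    case Nil then show ?case using nx[OF \<open>[] \<in> T\<close>, of 0] by simp
  next
    case (Cons b \<sigma>)
    then have "grow nx \<sigma> @ [b] \<in> T" using Split_in(2) by blast
    from nx[OF this, of "Suc (length \<sigma>)"] show ?case by simp
  qed
  show thesis
  proof (rule that)
    show "emb (\<lambda>\<sigma>. grow nx (rev \<sigma>))"
      unfolding emb_def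
    proof (intro allI)
      fix \<sigma> b
      have "grow nx (rev \<sigma>) @ [b] \<in> T" using Split_in(2) G by blast
      from nx[OF this, of "Suc (length \<sigma>)"] show "prefix (grow nx (rev \<sigma>) @ [b]) (grow nx (rev (\<sigma> @ [b])))" by simp
    qed
    show "range (\<lambda>\<sigma>. grow nx (rev \<sigma>)) \<subseteq> Split T" using G by blast
    show "g (length \<sigma>) < length (grow nx (rev \<sigma>))" for \<sigma> using G[of "rev \<sigma>"] by simp
  qed
qed

section \<open>The Halpern-Laeuchli theorem\<close>

text \<open>The form of the Halpern-Laeuchli theorem for one splitting node and one node just above its height in
every other tree. Only sets of nodes are coloured, which suffices since the cones used later are
disjoint.

In each tree choose a branching map \<open>e i\<close> such that for \<open>i \<noteq> i0\<close> its nodes are longer than those of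
\<open>e i0\<close> at addresses of the same length. A word over the letters \<open>I \<rightarrow> {0, 1}\<close> gives an address for
every \<open>i\<close>, hence a splitting node \<open>z\<close> in the tree \<open>i0\<close> and the restriction of a node to length \<open>|z| + 1\<close>
in the others. Colour words accordingly. The instances of the left variable words supplied by
the theorem on words project in coordinate \<open>i\<close> to a branching map again: it branches immediately
because the variable comes first in each word, so the splitting nodes \<open>z\<close> of the new tree are exactly
those whose words have been coloured.\<close>

theorem halpern_lauchli:
  fixes T :: "'i \<Rightarrow> tree" and col :: "node set \<Rightarrow> 'c"
  assumes I: "finite I" "i0 \<in> I" and T: "\<And>i. i \<in> I \<Longrightarrow> perfect_tree (T i)" "\<And>i. i \<in> I \<Longrightarrow> T i \<noteq> {}"
    and col: "finite (range col)"
  obtains U k where "\<And>i. i \<in> I \<Longrightarrow> perfect_tree (U i)" "\<And>i. i \<in> I \<Longrightarrow> U i \<noteq> {}" "\<And>i. i \<in> I \<Longrightarrow> U i \<subseteq> T i"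
    "\<And>z w. z \<in> Split (U i0) \<Longrightarrow> (\<And>i. i \<in> I - {i0} \<Longrightarrow> w i \<in> U i \<and> length (w i) = Suc (length z)) \<Longrightarrow>
      col ({z @ [False], z @ [True]} \<union> w ` (I - {i0})) = k"
proof -
  obtain e0 where e0: "emb e0" "range e0 \<subseteq> Split (T i0)"
    using emb_into_perfect[OF T[OF I(2)], of "\<lambda>_. 0"] by metis
  define g where "g n = Max (length ` e0 ` {\<sigma>. length \<sigma> = n})" for n
  have g: "length (e0 \<sigma>) \<le> g (length \<sigma>)" for \<sigma>
    unfolding g_def
  proof (rule Max_ge)
    have "finite {\<tau>. set \<tau> \<subseteq> (UNIV :: bool set) \<and> length \<tau> = length \<sigma>}"
      by (rule finite_lists_length_eq) simp
    then show "finite (length ` e0 ` {\<tau>. length \<tau> = length \<sigma>})" by simp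
  qed auto
  have "\<exists>E. emb E \<and> range E \<subseteq> Split (T i) \<and> (\<forall>\<sigma>. g (length \<sigma>) < length (E \<sigma>))" if "i \<in> I" for i
    using emb_into_perfect[OF T[OF that], of g] by metis
  then have "\<exists>e1. \<forall>i\<in>I. emb (e1 i) \<and> range (e1 i) \<subseteq> Split (T i) \<and> (\<forall>\<sigma>. g (length \<sigma>) < length (e1 i \<sigma>))"
    by (intro bchoice ballI)
  then obtain e1 where "\<forall>i\<in>I. emb (e1 i) \<and> range (e1 i) \<subseteq> Split (T i) \<and> (\<forall>\<sigma>. g (length \<sigma>) < length (e1 i \<sigma>))" ..
  then have e1: "emb (e1 i)" "range (e1 i) \<subseteq> Split (T i)" "g (length \<sigma>) < length (e1 i \<sigma>)" if "i \<in> I" for i \<sigma>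
    using that by blast+
  define e where "e i = (if i = i0 then e0 else e1 i)" for i
  have e: "emb (e i)" "range (e i) \<subseteq> Split (T i)" if "i \<in> I" for i
    using e0 e1 that by (simp_all add: e_def)
  have elen: "length (e i0 \<sigma>) < length (e i \<tau>)" if "i \<in> I - {i0}" "length \<sigma> = length \<tau>" for i \<sigma> \<tau>
    using g[of \<sigma>] e1(3)[of i \<tau>] that by (simp add: e_def)
  define L where "L = (\<lambda>A x. x \<in> A) ` Pow I"
  have L: "finite L" unfolding L_def using I(1) by simp
  define proj where "proj i s = map (\<lambda>a. a i) s" for i :: 'i and s :: "('i \<Rightarrow> bool) list"
  define c where "c s = (let z = e i0 (proj i0 s) in
    col ({z @ [False], z @ [True]} \<union> (\<lambda>i. take (Suc (length z)) (e i (proj i s))) ` (I - {i0})))" for s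
  have "finite (range c)" by (rule finite_subset[OF _ col]) (auto simp: c_def Let_def)
  from left_variable_words[OF L this] obtain k w0 and v :: "nat \<Rightarrow> ('i \<Rightarrow> bool) option list" where
    mono: "\<And>as. set as \<subseteq> L \<Longrightarrow> c (w0 @ concat (map (\<lambda>i. as ! i # subst_letter (as ! i) (v i)) [0..<length as])) = k"
    by metis
  \<comment> \<open>Substitution commutes with projecting to the coordinate \<open>i\<close>, where the variable becomes a bit.\<close>
  define pr where "pr i b w = map (\<lambda>x. case x of None \<Rightarrow> b | Some a \<Rightarrow> a i) w"
    for i :: 'i and b :: bool and w :: "('i \<Rightarrow> bool) option list"
  define P where "P i bs = proj i w0 @ concat (map (\<lambda>j. bs ! j # pr i (bs ! j) (v j)) [0..<length bs])" for i bs
  have Psnoc: "P i (bs @ [b]) = P i bs @ b # pr i b (v (length bs))" for i bs b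
  proof -
    have eq: "map (\<lambda>j. (bs @ [b]) ! j # pr i ((bs @ [b]) ! j) (v j)) [0..<length bs]
      = map (\<lambda>j. bs ! j # pr i (bs ! j) (v j)) [0..<length bs]"
      by (rule map_cong) (auto simp: nth_append)
    show ?thesis by (simp add: P_def eq)
  qed
  \<comment> \<open>Instances of the same number of words have the same length in all coordinates; this is what the
    uniform lengths of variable words are for.\<close>
  have Plen: "length (P i bs) = length (P j cs)" if "length bs = length cs" for i j bs cs
    using that
  proof (induction bs arbitrary: cs rule: rev_induct)
    case Nil then show ?case by (simp add: P_def proj_def)
  next
    case (snoc b bs)
    then obtain cs' c where "cs = cs' @ [c]" by (metis append_butlast_last_id length_0_conv snoc_eq_iff_butlast)
    then show ?case using snoc by (simp add: Psnoc pr_def)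
  qed
  have Pproj: "P i (proj i as) = proj i (w0 @ concat (map (\<lambda>i. as ! i # subst_letter (as ! i) (v i)) [0..<length as]))" for i as
  proof -
    have eq: "map (\<lambda>j. proj i as ! j # pr i (proj i as ! j) (v j)) [0..<length as]
      = map (\<lambda>j. proj i (as ! j # subst_letter (as ! j) (v j))) [0..<length as]"
      by (rule map_cong) (auto simp: proj_def pr_def subst_letter_def split: option.splits)
    have "length (proj i as) = length as" by (simp add: proj_def)
    then have "P i (proj i as) = proj i w0 @ concat (map (\<lambda>j. proj i (as ! j # subst_letter (as ! j) (v j))) [0..<length as])"
      unfolding P_def by (simp only: eq)
    then show ?thesis by (simp add: proj_def map_concat comp_def)
  qed
  define E where "E i bs = e i (P i bs)" for i bs
  have E: "emb (E i)" if "i \<in> I" for i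
    unfolding emb_def E_def Psnoc
    by (intro allI emb_branch[OF e(1)[OF that]]) (simp add: prefix_def)
  define U where "U i = tree_of (E i)" for i
  show thesis
  proof (rule that[of U k])
    fix i assume i: "i \<in> I"
    show "perfect_tree (U i)" unfolding U_def by (rule perfect_tree_of[OF E[OF i]])
    show "U i \<noteq> {}" unfolding U_def using tree_of_mem by blast
    show "U i \<subseteq> T i"
      unfolding U_def by (rule tree_of_subset[OF perfect_is_tree[OF T(1)[OF i]]])
        (use e(2)[OF i] Split_in(1) in \<open>auto simp: E_def\<close>)
  next
    fix z w assume z: "z \<in> Split (U i0)"
      and w: "\<And>i. i \<in> I - {i0} \<Longrightarrow> w i \<in> U i \<and> length (w i) = Suc (length z)"
    obtain bs where bs: "z = E i0 bs" using z Split_tree_of[OF E[OF I(2)]] unfolding U_def by blast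
    have "\<exists>\<rho>. length \<rho> = length bs \<and> w i = take (Suc (length z)) (E i \<rho>)" if i: "i \<in> I - {i0}" for i
    proof -
      have iI: "i \<in> I" using i by blast
      obtain \<tau> where "prefix (w i) (E i \<tau>)" using w[OF i] unfolding U_def tree_of_def by blast
      \<comment> \<open>Pad the address, since \<open>w i\<close> need not lie below a value at an address as long as that of \<open>z\<close>.\<close>
      then have 1: "prefix (w i) (E i (\<tau> @ replicate (length bs) False))"
        using emb_mono[OF E[OF iI], of \<tau> "\<tau> @ replicate (length bs) False"] prefix_order.trans by fastforce
      define \<rho> where "\<rho> = take (length bs) (\<tau> @ replicate (length bs) False)"
      have len: "length \<rho> = length bs" by (simp add: \<rho>_def)
      have 2: "prefix (E i \<rho>) (E i (\<tau> @ replicate (length bs) False))"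
        unfolding \<rho>_def by (rule emb_mono[OF E[OF iI]]) (rule take_is_prefix)
      have "length z < length (E i \<rho>)"
        unfolding bs E_def by (rule elen[OF i]) (rule Plen, simp add: len)
      then have "prefix (w i) (E i \<rho>)"
        using prefix_length_prefix[OF 1 2] w[OF i] by simp
      then have "w i = take (Suc (length z)) (E i \<rho>)" using w[OF i] by (auto simp: prefix_def)
      then show ?thesis using len by blast
    qed
    then have "\<exists>\<rho>. \<forall>i\<in>I - {i0}. length (\<rho> i) = length bs \<and> w i = take (Suc (length z)) (E i (\<rho> i))"
      by (intro bchoice ballI)
    then obtain \<rho> where "\<forall>i\<in>I - {i0}. length (\<rho> i) = length bs \<and> w i = take (Suc (length z)) (E i (\<rho> i))" ..
    then have \<rho>: "length (\<rho> i) = length bs" "w i = take (Suc (length z)) (E i (\<rho> i))" if "i \<in> I - {i0}" for i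
      using that by blast+
    define \<rho>' where "\<rho>' i = (if i = i0 then bs else \<rho> i)" for i
    have \<rho>': "length (\<rho>' i) = length bs" if "i \<in> I" for i using \<rho>(1)[of i] that by (simp add: \<rho>'_def)
    define as where "as = map (\<lambda>j x. x \<in> {y\<in>I. \<rho>' y ! j}) [0..<length bs]"
    have "(\<lambda>x. x \<in> {y\<in>I. \<rho>' y ! j}) \<in> L" for j
      unfolding L_def by (rule imageI) blast
    then have "set as \<subseteq> L" unfolding as_def by auto
    have pas: "proj i as = \<rho>' i" if "i \<in> I" for i
      by (rule nth_equalityI) (use \<rho>'[OF that] that in \<open>auto simp: proj_def as_def\<close>)
    let ?W = "w0 @ concat (map (\<lambda>i. as ! i # subst_letter (as ! i) (v i)) [0..<length as])"
    have "e i (proj i ?W) = E i (\<rho>' i)" if "i \<in> I" for i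
      using pas[OF that] Pproj[of i as] by (simp add: E_def)
    then have "c ?W = (let z = E i0 (\<rho>' i0) in col ({z @ [False], z @ [True]} \<union> (\<lambda>i. take (Suc (length z)) (E i (\<rho>' i))) ` (I - {i0})))"
      unfolding c_def Let_def using I(2) by (intro arg_cong[of _ _ col] arg_cong2[of _ _ _ _ "(\<union>)"] image_cong) simp_all
    also have "\<dots> = col ({z @ [False], z @ [True]} \<union> w ` (I - {i0}))"
      unfolding Let_def by (intro arg_cong[of _ _ col] arg_cong2[of _ _ _ _ "(\<union>)"] image_cong) (use \<rho>(2) bs in \<open>auto simp: \<rho>'_def\<close>)
    finally show "col ({z @ [False], z @ [True]} \<union> w ` (I - {i0})) = k" using mono[OF \<open>set as \<subseteq> L\<close>] by simp
  qed
qed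

section \<open>Good trees and the order of their splitting nodes\<close>

text \<open>The position of an address in the order by length and then lexicographically. It numbers the full
binary tree like a heap, so that the children of \<open>k\<close> are \<open>2 * k + 1\<close> and \<open>2 * k + 2\<close>; sums with \<open>of_bool b\<close>
treat both at once.\<close>

definition idx :: "bool list \<Rightarrow> nat" where
  "idx \<sigma> = foldl (\<lambda>n b. 2 * n + 1 + of_bool b) 0 \<sigma>"

lemma idx_Nil [simp]: "idx [] = 0"
  by (simp add: idx_def)

lemma idx_snoc [simp]: "idx (\<sigma> @ [b]) = 2 * idx \<sigma> + 1 + of_bool b"
  by (simp add: idx_def)

lemma nat_child_cases:
  obtains "k = (0::nat)" | p b where "k = 2 * p + 1 + of_bool b" "p < k"
proof (cases "k = 0")
  case False
  then have "k = 2 * ((k - 1) div 2) + 1 + of_bool (even k)" "(k - 1) div 2 < k"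
    by (auto elim!: evenE oddE)
  then show ?thesis by (rule that(2))
qed (rule that(1))

lemma child_eq_iff: "2 * p + 1 + of_bool b = 2 * q + 1 + of_bool c \<longleftrightarrow> p = q \<and> b = c" for p q :: nat
  by (cases b; cases c) (simp_all, presburger+)

lemma idx_eq_iff: "idx \<sigma> = idx \<tau> \<longleftrightarrow> \<sigma> = \<tau>"
proof
  show "idx \<sigma> = idx \<tau> \<Longrightarrow> \<sigma> = \<tau>"
  proof (induction \<sigma> arbitrary: \<tau> rule: rev_induct)
    case Nil then show ?case by (cases \<tau> rule: rev_cases) auto
  next
    case (snoc a \<sigma>)
    then obtain \<tau>' b where \<tau>: "\<tau> = \<tau>' @ [b]" by (cases \<tau> rule: rev_cases) auto
    then have "idx \<sigma> = idx \<tau>' \<and> a = b" using snoc.prems child_eq_iff[of "idx \<sigma>" a "idx \<tau>'" b] by simp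
    then show ?case using snoc.IH \<tau> by simp
  qed
qed simp

lemma idx_surj: "\<exists>\<sigma>. idx \<sigma> = k"
proof (induction k rule: less_induct)
  case (less k)
  show ?case
  proof (rule nat_child_cases[of k])
    assume "k = 0" then show ?thesis by (intro exI[of _ "[]"]) simp
  next
    fix p b assume k: "k = 2 * p + 1 + of_bool b" "p < k"
    then obtain \<sigma> where "idx \<sigma> = p" using less by blast
    then show ?thesis using k by (intro exI[of _ "\<sigma> @ [b]"]) simp
  qed
qed

lemma idx_less:
  "idx \<sigma> < idx \<tau> \<Longrightarrow> length \<sigma> < length \<tau> \<or>
    length \<sigma> = length \<tau> \<and> (\<exists>\<rho>. prefix (\<rho> @ [False]) \<sigma> \<and> prefix (\<rho> @ [True]) \<tau>)"
proof (induction \<sigma> arbitrary: \<tau> rule: rev_induct)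
  case Nil then show ?case by (cases \<tau>) auto
next
  case (snoc a \<sigma>)
  then obtain \<tau>' b where \<tau>: "\<tau> = \<tau>' @ [b]" by (cases \<tau> rule: rev_cases) auto
  consider "idx \<sigma> < idx \<tau>'" | "idx \<sigma> = idx \<tau>'" "\<not> a" "b"
    using snoc.prems unfolding \<tau> by (cases a; cases b) (simp_all, linarith+)
  then show ?case
  proof cases
    case 1
    from snoc.IH[OF this] show ?thesis
    proof (elim disjE conjE exE)
      fix \<rho> assume "length \<sigma> = length \<tau>'" "prefix (\<rho> @ [False]) \<sigma>" "prefix (\<rho> @ [True]) \<tau>'"
      then have "length (\<sigma> @ [a]) = length \<tau>" "prefix (\<rho> @ [False]) (\<sigma> @ [a])" "prefix (\<rho> @ [True]) \<tau>"
        unfolding \<tau> by simp_all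
      then show ?thesis by blast
    qed (simp add: \<tau>)
  next
    case 2
    then have "\<sigma> = \<tau>'" using idx_eq_iff by blast
    then show ?thesis using 2 by (intro disjI2 conjI exI[of _ \<sigma>]) (simp_all add: \<tau>)
  qed
qed

lemma lexordp_eq_diverge:
  assumes "prefix (\<rho> @ [False]) x" "prefix (\<rho> @ [True]) y"
  shows "ord_class.lexordp_eq x y" "\<not> ord_class.lexordp_eq y x"
proof -
  obtain xs ys where "x = \<rho> @ False # xs" "y = \<rho> @ True # ys" using assms by (auto simp: prefix_def)
  moreover have "ord_class.lexordp_eq (\<rho> @ False # xs) (\<rho> @ True # ys) \<and>
      \<not> ord_class.lexordp_eq (\<rho> @ True # ys) (\<rho> @ False # xs)"
    by (induction \<rho>) simp_all
  ultimately show "ord_class.lexordp_eq x y" "\<not> ord_class.lexordp_eq y x" by simp_all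
qed

lemma emb_branch_iff:
  assumes "emb E"
  shows "prefix (E \<sigma> @ [b]) (E \<tau>) \<longleftrightarrow> prefix (\<sigma> @ [b]) \<tau>"
proof
  assume P: "prefix (E \<sigma> @ [b]) (E \<tau>)"
  then have "prefix (E \<sigma>) (E \<tau>)" by (rule append_prefixD)
  then have "prefix \<sigma> \<tau>" by (simp add: emb_prefix_iff[OF assms])
  moreover have "\<sigma> \<noteq> \<tau>" using P by (auto dest: prefix_length_le)
  ultimately obtain c \<rho> where \<tau>: "\<tau> = \<sigma> @ c # \<rho>" by (metis prefixE append_Nil2 neq_Nil_conv)
  then have "prefix (E \<sigma> @ [c]) (E \<tau>)" by (intro emb_branch[OF assms]) simp
  then have "b = c" using P by (auto simp: prefix_def)
  then show "prefix (\<sigma> @ [b]) \<tau>" using \<tau> by simp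
qed (rule emb_branch[OF assms])

lemma strict_prefix_iff_prefix: "strict_prefix s t \<longleftrightarrow> prefix s t \<and> s \<noteq> t"
  by (auto simp: strict_prefix_def)

lemma split_level_emb:
  assumes "emb E"
  shows "split_level (tree_of E) (E \<sigma>) = length \<sigma>"
proof -
  have "{s \<in> Split (tree_of E). strict_prefix s (E \<sigma>)} = E ` (set (prefixes \<sigma>) - {\<sigma>})"
    unfolding Split_tree_of[OF assms] strict_prefix_iff_prefix
    using emb_prefix_iff[OF assms] emb_eq_iff[OF assms] by auto
  moreover have "inj E" using emb_eq_iff[OF assms] by (auto intro: injI)
  moreover have "card (set (prefixes \<sigma>)) = length \<sigma> + 1"
    using distinct_card[OF distinct_prefixes[of \<sigma>]] by simp
  ultimately show ?thesis
    unfolding split_level_def by (simp add: card_image inj_on_subset card_Diff_singleton)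
qed

text \<open>The order of splitting nodes only depends on addresses: the level of \<open>E \<sigma>\<close> is the length of \<open>\<sigma>\<close>, and
\<open>E \<sigma>\<close> and \<open>E \<tau>\<close> part in the same direction as \<open>\<sigma>\<close> and \<open>\<tau>\<close>.\<close>

lemma split_le_emb:
  assumes "emb E"
  shows "split_le (tree_of E) (E \<sigma>) (E \<tau>) \<longleftrightarrow> idx \<sigma> \<le> idx \<tau>"
proof -
  have less: "split_le (tree_of E) (E \<sigma>) (E \<tau>) \<and> \<not> split_le (tree_of E) (E \<tau>) (E \<sigma>)" if "idx \<sigma> < idx \<tau>" for \<sigma> \<tau>
    using idx_less[OF that]
  proof (elim disjE conjE exE)
    fix \<rho> assume r: "length \<sigma> = length \<tau>" "prefix (\<rho> @ [False]) \<sigma>" "prefix (\<rho> @ [True]) \<tau>"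
    show ?thesis
      using lexordp_eq_diverge[OF emb_branch[OF assms r(2)] emb_branch[OF assms r(3)]] r(1)
      by (simp add: split_le_def split_level_emb[OF assms])
  qed (simp add: split_le_def split_level_emb[OF assms])
  consider "idx \<sigma> < idx \<tau>" | "\<sigma> = \<tau>" | "idx \<tau> < idx \<sigma>" using idx_eq_iff by (metis linorder_neqE_nat)
  then show ?thesis
  proof cases
    case 2 then show ?thesis by (simp add: split_le_def ord_class.lexordp_eq_refl)
  qed (use less in auto)
qed

lemma depth_emb:
  assumes "emb E"
  shows "depth (E \<sigma>) (tree_of E) = idx \<sigma>"
proof -
  have "{s \<in> Split (tree_of E). split_le (tree_of E) s (E \<sigma>) \<and> s \<noteq> E \<sigma>} = E ` {\<tau>. idx \<tau> < idx \<sigma>}"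
    unfolding Split_tree_of[OF assms]
    by (auto simp: split_le_emb[OF assms] emb_eq_iff[OF assms] less_le idx_eq_iff)
  moreover have "inj E" using emb_eq_iff[OF assms] by (auto intro: injI)
  moreover have "card {\<tau>. idx \<tau> < idx \<sigma>} = idx \<sigma>"
  proof -
    have "idx ` {\<tau>. idx \<tau> < idx \<sigma>} = {..<idx \<sigma>}" using idx_surj by (auto simp: image_iff) metis
    moreover have "inj_on idx {\<tau>. idx \<tau> < idx \<sigma>}" using idx_eq_iff by (auto intro: inj_onI)
    ultimately show ?thesis by (metis card_image card_lessThan)
  qed
  ultimately show ?thesis unfolding depth_def by (simp add: card_image inj_on_subset)
qed

text \<open>If \<open>m\<close> and \<open>s\<close> were to part, they would do so at a splitting node above \<open>t\<close> that is shorter than \<open>m\<close>.\<close>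

lemma shortest_split_prefix:
  assumes T: "is_tree T" and m: "m \<in> Split T" "prefix t m" "\<And>s. s \<in> Split T \<Longrightarrow> prefix t s \<Longrightarrow> length m \<le> length s"
    and s: "s \<in> Split T" "prefix t s"
  shows "prefix m s"
proof (rule list_compare[of m s])
  fix b assume "prefix (s @ [b]) m"
  then show ?thesis using m(3)[OF s] by (auto dest: prefix_length_le)
next
  fix \<rho> b assume r: "prefix (\<rho> @ [b]) m" "prefix (\<rho> @ [\<not> b]) s"
  have "\<rho> @ [b] \<in> T" "\<rho> @ [\<not> b] \<in> T"
    using tree_prefix[OF T] r Split_in(1) m(1) s(1) by blast+
  then have "\<rho> \<in> Split T" by (cases b) (auto intro: SplitI[OF _ _ T])
  moreover have "prefix t \<rho>"
  proof (rule ccontr)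
    assume "\<not> prefix t \<rho>"
    moreover have "prefix \<rho> m" using r(1) append_prefixD by blast
    ultimately have "prefix (\<rho> @ [b]) t"
      using m(2) r(1) by (metis prefix_same_cases prefix_snoc)
    then have "prefix (\<rho> @ [b]) s" using s(2) prefix_order.trans by blast
    then show False using r(2) by (auto simp: prefix_def)
  qed
  ultimately have "length m \<le> length \<rho>" by (rule m(3))
  then show ?thesis using prefix_length_le[OF r(1)] by simp
qed

text \<open>Send each address to the shortest splitting node above the corresponding successor of the previous one.
A node \<open>t\<close> not below any value of this map would have values at arbitrarily long addresses as proper
initial segments.\<close>

lemma perfect_emb:
  assumes T: "perfect_tree T" "T \<noteq> {}"
  obtains E where "emb E" "T = tree_of E"
proof -
  note tT = perfect_is_tree[OF T(1)]
  define least where "least t m \<longleftrightarrow> m \<in> Split T \<and> prefix t m \<and>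
    (\<forall>s. s \<in> Split T \<and> prefix t s \<longrightarrow> length m \<le> length s)" for t m
  define nx where "nx n t = (SOME m. least t m)" for n :: nat and t
  have nxl: "least t (nx n t)" if t: "t \<in> T" for n t
  proof -
    have "\<exists>s\<in>Split T. prefix t s" using T(1) t unfolding perfect_tree_def by simp
    then obtain s0 where s0: "s0 \<in> Split T \<and> prefix t s0" by blast
    have "\<exists>m. (m \<in> Split T \<and> prefix t m) \<and> (\<forall>s. s \<in> Split T \<and> prefix t s \<longrightarrow> length m \<le> length s)"
      using s0 by (rule ex_has_least_nat)
    then have "\<exists>m. least t m" by (simp add: least_def)
    then show ?thesis unfolding nx_def by (rule someI_ex)
  qed
  have nx: "nx n t \<in> Split T \<and> prefix t (nx n t)" "s \<in> Split T \<Longrightarrow> prefix t s \<Longrightarrow> prefix (nx n t) s"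
    if t: "t \<in> T" for n t s
  proof -
    have l: "nx n t \<in> Split T" "prefix t (nx n t)"
      "\<And>s. s \<in> Split T \<Longrightarrow> prefix t s \<Longrightarrow> length (nx n t) \<le> length s"
      using nxl[OF t, of n] by (simp_all add: least_def)
    show "nx n t \<in> Split T \<and> prefix t (nx n t)" using l by simp
    show "s \<in> Split T \<Longrightarrow> prefix t s \<Longrightarrow> prefix (nx n t) s"
      by (rule shortest_split_prefix[OF tT l])
  qed
  obtain t0 where "t0 \<in> T" using T(2) by blast
  then have nil: "[] \<in> T" by (rule tree_prefix[OF tT _ Nil_prefix])
  define E where "E \<sigma> = grow nx (rev \<sigma>)" for \<sigma>
  have E0: "E [] = nx 0 []" and E1: "E (\<sigma> @ [b]) = nx (Suc (length \<sigma>)) (E \<sigma> @ [b])" for \<sigma> b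
    by (simp_all add: E_def)
  have ES: "E \<sigma> \<in> Split T" for \<sigma>
  proof (induction \<sigma> rule: rev_induct)
    case Nil then show ?case using nx(1)[OF nil] by (simp add: E0)
  next
    case (snoc b \<sigma>) then show ?case using nx(1)[OF Split_in(2)[OF snoc]] by (simp add: E1)
  qed
  have em: "emb E"
    unfolding emb_def E1 using nx(1)[OF Split_in(2)[OF ES]] by blast
  have "tree_of E \<subseteq> T" using ES Split_in(1) by (intro tree_of_subset[OF tT]) blast
  moreover have "T \<subseteq> tree_of E"
  proof
    fix t assume t: "t \<in> T"
    obtain s where s: "s \<in> Split T" "prefix t s" using T(1) t unfolding perfect_tree_def by blast
    \<comment> \<open>At each length \<open>n\<close>, either \<open>t\<close> has been passed or some value is properly below \<open>t\<close>.\<close>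
    have "(\<exists>\<sigma>. prefix t (E \<sigma>)) \<or> (\<exists>\<sigma>. length \<sigma> = n \<and> prefix (E \<sigma>) t \<and> E \<sigma> \<noteq> t)" for n
    proof (induction n)
      case 0
      have "prefix (E []) s" unfolding E0 by (rule nx(2)[OF nil s(1)]) simp
      from prefix_same_cases[OF this s(2)] show ?case by (metis list.size(3) prefix_order.refl)
    next
      case (Suc n)
      then show ?case
      proof
        assume "\<exists>\<sigma>. length \<sigma> = n \<and> prefix (E \<sigma>) t \<and> E \<sigma> \<noteq> t"
        then obtain \<sigma> where \<sigma>: "length \<sigma> = n" "prefix (E \<sigma>) t" "E \<sigma> \<noteq> t" by blast
        then obtain b \<rho> where "t = E \<sigma> @ b # \<rho>" by (metis prefixE append_Nil2 neq_Nil_conv)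
        then have "prefix (E \<sigma> @ [b]) t" by simp
        then have "prefix (E \<sigma> @ [b]) s" using s(2) prefix_order.trans by blast
        then have "prefix (E (\<sigma> @ [b])) s" unfolding E1 by (intro nx(2)[OF Split_in(2)[OF ES] s(1)])
        from prefix_same_cases[OF this s(2)] show ?thesis
          using \<sigma>(1) by (metis length_append_singleton prefix_order.refl)
      qed blast
    qed
    from this[of "length t"] have "\<exists>\<sigma>. prefix t (E \<sigma>)"
    proof
      assume "\<exists>\<sigma>. length \<sigma> = length t \<and> prefix (E \<sigma>) t \<and> E \<sigma> \<noteq> t"
      then obtain \<sigma> where \<sigma>: "length \<sigma> = length t" "prefix (E \<sigma>) t" "E \<sigma> \<noteq> t" by blast
      then have "length (E \<sigma>) < length t" by (metis prefix_length_less strict_prefix_iff_prefix)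
      then show ?thesis using emb_length_ge[OF em, of \<sigma>] \<sigma>(1) by simp
    qed
    then show "t \<in> tree_of E" by (simp add: tree_of_def)
  qed
  ultimately show thesis using em by (intro that[of E]) blast+
qed

text \<open>The empty set satisfies the definition of a good tree; it is excluded here.\<close>

definition good :: "tree \<Rightarrow> bool" where
  "good T \<longleftrightarrow> good_tree T \<and> T \<noteq> {}"

text \<open>The splitting node of depth \<open>k\<close>. Through this enumeration, good trees are handled as sequences of nodes
indexed in heap order.\<close>

definition sp :: "tree \<Rightarrow> nat \<Rightarrow> node" where
  "sp T k = (THE s. s \<in> Split T \<and> depth s T = k)"

lemma sp_emb:
  assumes "emb E"
  shows "sp (tree_of E) (idx \<sigma>) = E \<sigma>"
  unfolding sp_def
proof (rule the_equality)
  show "E \<sigma> \<in> Split (tree_of E) \<and> depth (E \<sigma>) (tree_of E) = idx \<sigma>"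
    by (simp add: Split_tree_of[OF assms] depth_emb[OF assms])
  fix s assume s: "s \<in> Split (tree_of E) \<and> depth s (tree_of E) = idx \<sigma>"
  then obtain \<tau> where "s = E \<tau>" using Split_tree_of[OF assms] by blast
  then show "s = E \<sigma>" using s by (simp add: depth_emb[OF assms] idx_eq_iff)
qed

text \<open>Goodness says precisely that lengths grow along the heap order of addresses.\<close>

lemma good_cases:
  assumes "good T"
  shows "\<exists>E. emb E \<and> T = tree_of E \<and> (\<forall>\<sigma>. sp T (idx \<sigma>) = E \<sigma>) \<and>
    (\<forall>\<sigma> \<tau>. idx \<sigma> \<le> idx \<tau> \<longrightarrow> length (E \<sigma>) \<le> length (E \<tau>))"
proof -
  have T: "perfect_tree T" "T \<noteq> {}" using assms by (simp_all add: good_def good_tree_def)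
  obtain E where E: "emb E" "T = tree_of E" by (rule perfect_emb[OF T])
  have "length (E \<sigma>) \<le> length (E \<tau>)" if "idx \<sigma> \<le> idx \<tau>" for \<sigma> \<tau>
  proof -
    have "split_le T (E \<sigma>) (E \<tau>)" using that by (simp add: E(2) split_le_emb[OF E(1)])
    moreover have "E \<sigma> \<in> Split T" "E \<tau> \<in> Split T" by (simp_all add: E(2) Split_tree_of[OF E(1)])
    ultimately show ?thesis using assms unfolding good_def good_tree_def by blast
  qed
  then show ?thesis using sp_emb[OF E(1)] E by blast
qed

lemma goodI:
  assumes E: "emb E" and mono: "\<And>\<sigma> \<tau>. idx \<sigma> \<le> idx \<tau> \<Longrightarrow> length (E \<sigma>) \<le> length (E \<tau>)"
  shows "good (tree_of E)"
  unfolding good_def good_tree_def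
proof (intro conjI ballI impI)
  show "perfect_tree (tree_of E)" by (rule perfect_tree_of[OF E])
  show "tree_of E \<noteq> {}" using tree_of_mem by blast
  fix s t assume "s \<in> Split (tree_of E)" "t \<in> Split (tree_of E)" "split_le (tree_of E) s t"
  then show "length s \<le> length t"
    using mono by (auto simp: Split_tree_of[OF E] split_le_emb[OF E])
qed

lemma good_perfect: "good T \<Longrightarrow> perfect_tree T" "good T \<Longrightarrow> T \<noteq> {}" "good T \<Longrightarrow> is_tree T"
  by (simp_all add: good_def good_tree_def perfect_tree_def)

lemma Split_eq_range_sp: assumes "good T" shows "Split T = range (sp T)"
proof -
  obtain E where E: "emb E" "T = tree_of E" "\<And>\<sigma>. sp T (idx \<sigma>) = E \<sigma>"
    "\<And>\<sigma> \<tau>. idx \<sigma> \<le> idx \<tau> \<Longrightarrow> length (E \<sigma>) \<le> length (E \<tau>)" using good_cases[OF assms] by blast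
  have "range (sp T) = range E"
  proof
    show "range E \<subseteq> range (sp T)" by (auto simp flip: E(3))
    show "range (sp T) \<subseteq> range E"
    proof
      fix s assume "s \<in> range (sp T)"
      then obtain k where "s = sp T k" by blast
      moreover obtain \<sigma> where "idx \<sigma> = k" using idx_surj by blast
      ultimately have "s = E \<sigma>" using E(3)[of \<sigma>] by simp
      then show "s \<in> range E" by simp
    qed
  qed
  then show ?thesis using E(2) Split_tree_of[OF E(1)] by simp
qed

lemma sp_in_Split: "good T \<Longrightarrow> sp T k \<in> Split T"
  by (simp add: Split_eq_range_sp)

lemma Split_spE: assumes "good T" "s \<in> Split T" obtains k where "s = sp T k"
  using assms Split_eq_range_sp by blast

lemma depth_sp: assumes "good T" shows "depth (sp T k) T = k"
proof -
  obtain E where E: "emb E" "T = tree_of E" "\<And>\<sigma>. sp T (idx \<sigma>) = E \<sigma>"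
    "\<And>\<sigma> \<tau>. idx \<sigma> \<le> idx \<tau> \<Longrightarrow> length (E \<sigma>) \<le> length (E \<tau>)" using good_cases[OF assms] by blast
  obtain \<sigma> where "idx \<sigma> = k" using idx_surj by blast
  then show ?thesis using E(3)[of \<sigma>] depth_emb[OF E(1), of \<sigma>] E(2) by simp
qed

lemma sp_eq_iff: "good T \<Longrightarrow> sp T j = sp T k \<longleftrightarrow> j = k"
  by (metis depth_sp)

lemma sp_length_mono: assumes "good T" "j \<le> k" shows "length (sp T j) \<le> length (sp T k)"
proof -
  obtain E where E: "emb E" "T = tree_of E" "\<And>\<sigma>. sp T (idx \<sigma>) = E \<sigma>"
    "\<And>\<sigma> \<tau>. idx \<sigma> \<le> idx \<tau> \<Longrightarrow> length (E \<sigma>) \<le> length (E \<tau>)" using good_cases[OF assms(1)] by blast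
  obtain \<sigma> where "idx \<sigma> = j" using idx_surj by blast
  moreover obtain \<tau> where "idx \<tau> = k" using idx_surj by blast
  ultimately show ?thesis using E(3)[of \<sigma>] E(3)[of \<tau>] E(4)[of \<sigma> \<tau>] assms(2) by simp
qed

lemma sp_child: assumes "good T" shows "prefix (sp T p @ [b]) (sp T (2 * p + 1 + of_bool b))"
proof -
  obtain E where E: "emb E" "T = tree_of E" "\<And>\<sigma>. sp T (idx \<sigma>) = E \<sigma>"
    "\<And>\<sigma> \<tau>. idx \<sigma> \<le> idx \<tau> \<Longrightarrow> length (E \<sigma>) \<le> length (E \<tau>)" using good_cases[OF assms] by blast
  obtain \<sigma> where "idx \<sigma> = p" using idx_surj by blast
  then show ?thesis using E(3)[of \<sigma>] E(3)[of "\<sigma> @ [b]"] emb_step[OF E(1), of \<sigma> b] by simp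
qed

lemma sp_child_least:
  assumes "good T" "s \<in> Split T" "prefix (sp T p @ [b]) s"
  shows "prefix (sp T (2 * p + 1 + of_bool b)) s"
proof -
  obtain E where E: "emb E" "T = tree_of E" "\<And>\<sigma>. sp T (idx \<sigma>) = E \<sigma>"
    "\<And>\<sigma> \<tau>. idx \<sigma> \<le> idx \<tau> \<Longrightarrow> length (E \<sigma>) \<le> length (E \<tau>)" using good_cases[OF assms(1)] by blast
  obtain \<sigma> where "idx \<sigma> = p" using idx_surj by blast
  moreover obtain \<tau> where "s = E \<tau>" using assms(2) E(2) Split_tree_of[OF E(1)] by blast
  ultimately show ?thesis
    using assms(3) E(3)[of \<sigma>] E(3)[of "\<sigma> @ [b]"] emb_branch_iff[OF E(1)] emb_prefix_iff[OF E(1)] by simp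
qed

lemma sp_root_least: assumes "good T" "s \<in> Split T" shows "prefix (sp T 0) s"
proof -
  obtain E where E: "emb E" "T = tree_of E" "\<And>\<sigma>. sp T (idx \<sigma>) = E \<sigma>"
    "\<And>\<sigma> \<tau>. idx \<sigma> \<le> idx \<tau> \<Longrightarrow> length (E \<sigma>) \<le> length (E \<tau>)" using good_cases[OF assms(1)] by blast
  obtain \<tau> where "s = E \<tau>" using assms(2) E(2) Split_tree_of[OF E(1)] by blast
  then show ?thesis using E(3)[of "[]"] emb_prefix_iff[OF E(1), of "[]" \<tau>] by simp
qed

lemma sp_cover: assumes "good T" "t \<in> T" shows "\<exists>k. prefix t (sp T k)"
proof -
  obtain s where "s \<in> Split T" "prefix t s"
    using good_perfect(1)[OF assms(1)] assms(2) unfolding perfect_tree_def by blast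
  then show ?thesis using Split_spE[OF assms(1)] by metis
qed

lemma sp_long: assumes "good T" shows "\<exists>k. n \<le> length (sp T k)"
proof -
  obtain t where "t \<in> T" using good_perfect(2)[OF assms] by blast
  then obtain s where "s \<in> Split T" "n \<le> length s"
    using perfect_long_split[OF good_perfect(1)[OF assms]] by blast
  then show ?thesis using Split_spE[OF assms] by metis
qed

lemma good_from_sequence:
  assumes child: "\<And>p b. prefix (e p @ [b]) (e (2 * p + 1 + of_bool b))"
    and mono: "\<And>i j. i \<le> j \<Longrightarrow> length (e i) \<le> length (e j)"
    and T: "is_tree T" "\<And>k. e k \<in> T"
  obtains S where "good S" "S \<subseteq> T" "\<And>k. sp S k = e k"
proof -
  define E where "E \<sigma> = e (idx \<sigma>)" for \<sigma>
  have E: "emb E" using child by (simp add: emb_def E_def)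
  show thesis
  proof (rule that)
    show "good (tree_of E)" by (rule goodI[OF E]) (simp add: E_def mono)
    show "tree_of E \<subseteq> T" by (rule tree_of_subset[OF T(1)]) (use T(2) in \<open>auto simp: E_def\<close>)
    fix k
    obtain \<sigma> where "idx \<sigma> = k" using idx_surj by blast
    then show "sp (tree_of E) k = e k" using sp_emb[OF E, of \<sigma>] by (simp add: E_def)
  qed
qed

text \<open>In both trees, the splitting node at a position is the shortest one above a successor of the node at
the parent position.\<close>

lemma sp_agree:
  assumes T: "good T" and S: "good S" "S \<subseteq> T" and keep: "\<And>j. j < m \<Longrightarrow> sp T j \<in> Split S"
  shows "j < m \<Longrightarrow> sp S j = sp T j"
proof (induction j rule: less_induct)
  case (less j)
  note ST = Split_mono[OF S(2)]
  have inS: "sp T j \<in> Split S" and inT: "sp S j \<in> Split T"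
    using keep[OF less.prems] sp_in_Split[OF S(1)] ST by blast+
  show ?case
  proof (rule nat_child_cases[of j])
    assume "j = 0"
    then show ?thesis
      using sp_root_least[OF T inT] sp_root_least[OF S(1) inS] by (auto intro: prefix_order.antisym)
  next
    fix p b assume j: "j = 2 * p + 1 + of_bool b" "p < j"
    then have p: "sp S p = sp T p" using less by simp
    have "prefix (sp S p @ [b]) (sp T j)" using sp_child[OF T, of p b] p j(1) by simp
    moreover have "prefix (sp T p @ [b]) (sp S j)" using sp_child[OF S(1), of p b] p j(1) by simp
    ultimately have "prefix (sp S j) (sp T j)" "prefix (sp T j) (sp S j)"
      using sp_child_least[OF T inT, of p b] sp_child_least[OF S(1) inS, of p b] unfolding j(1) by blast+
    then show ?thesis by (rule prefix_order.antisym)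
  qed
qed

section \<open>Levels of perfect trees\<close>

definition lev :: "tree \<Rightarrow> nat \<Rightarrow> node set" where
  "lev T h = {t \<in> T. length t = h}"

lemma finite_lev: "finite (lev T h)"
proof (rule finite_subset)
  show "lev T h \<subseteq> {t. set t \<subseteq> UNIV \<and> length t = h}" by (auto simp: lev_def)
  show "finite {t. set t \<subseteq> (UNIV :: bool set) \<and> length t = h}" by (rule finite_lists_length_eq) simp
qed

lemma lev_mono: "S \<subseteq> T \<Longrightarrow> lev S h \<subseteq> lev T h"
  by (auto simp: lev_def)

lemma perfect_extend:
  assumes "perfect_tree T" "t \<in> T" "length t \<le> h"
  obtains y where "y \<in> lev T h" "prefix t y"
proof -
  obtain s where s: "s \<in> Split T" "prefix t s" "h \<le> length s"
    using perfect_long_split[OF assms(1,2)] by blast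
  have "take h s \<in> T" using tree_prefix[OF perfect_is_tree[OF assms(1)] Split_in(1)[OF s(1)] take_is_prefix] .
  then have "take h s \<in> lev T h" using s(3) by (simp add: lev_def)
  moreover have "prefix t (take h s)"
    by (rule prefix_length_prefix[OF s(2) take_is_prefix]) (use assms(3) s(3) in simp)
  ultimately show thesis by (rule that)
qed

lemma perfect_child: assumes "perfect_tree T" "t \<in> T" obtains b where "t @ [b] \<in> T"
proof -
  obtain y where "y \<in> lev T (Suc (length t))" "prefix t y" by (rule perfect_extend[OF assms, of "Suc (length t)"]) simp_all
  then obtain zs where "t @ zs \<in> T" "length zs = 1" by (auto simp: lev_def prefix_def)
  moreover from this obtain b where "zs = [b]" by (auto simp: length_Suc_conv)
  ultimately show thesis using that by blast
qed

text \<open>By induction along a node: at a node that does not split in \<open>T\<close>, every perfect subtree has to follow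
\<open>T\<close>, so that differences can only arise at splitting nodes.\<close>

lemma level_transfer:
  assumes T: "is_tree T" and S: "is_tree S" "S \<subseteq> T" and S': "perfect_tree S'" "S' \<subseteq> T" "S' \<noteq> {}"
    and br: "\<And>u b. u \<in> Split T \<Longrightarrow> length u < h \<Longrightarrow> u @ [b] \<in> S \<Longrightarrow> u @ [b] \<in> S'"
  shows "t \<in> S \<Longrightarrow> length t \<le> h \<Longrightarrow> t \<in> S'"
proof (induction t rule: rev_induct)
  case Nil
  obtain x where "x \<in> S'" using S'(3) by blast
  then show ?case by (rule tree_prefix[OF perfect_is_tree[OF S'(1)] _ Nil_prefix])
next
  case (snoc b u)
  have "u \<in> S'" using snoc tree_prefix[OF S(1) snoc.prems(1), of u] by simp
  then obtain c where c: "u @ [c] \<in> S'" by (rule perfect_child[OF S'(1)])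
  show ?case
  proof (cases "c = b")
    case False
    then have "u \<in> Split T"
      using c snoc.prems(1) S(2) S'(2) by (cases b; cases c) (auto intro!: SplitI[OF _ _ T])
    then show ?thesis using snoc.prems by (intro br) simp_all
  qed (use c in simp)
qed

lemma lev_eq_if_keeps_splits:
  assumes "is_tree T" "perfect_tree S" "S \<subseteq> T" "S \<noteq> {}" "\<And>u. u \<in> Split T \<Longrightarrow> length u < h \<Longrightarrow> u \<in> Split S"
  shows "lev S h = lev T h"
proof
  show "lev T h \<subseteq> lev S h"
    using level_transfer[OF assms(1,1) order_refl assms(2,3,4), of h] assms(5) Split_in(2)
    by (auto simp: lev_def)
qed (rule lev_mono[OF assms(3)])

lemma lev_below:
  assumes "perfect_tree T" "is_tree S" "lev T h \<subseteq> S" "t \<in> T" "length t \<le> h"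
  shows "t \<in> S"
proof -
  obtain y where "y \<in> lev T h" "prefix t y" by (rule perfect_extend[OF assms(1,4,5)])
  then show ?thesis using assms(2,3) tree_prefix by blast
qed

lemma lev_eq_below:
  assumes "perfect_tree T" "perfect_tree S" "lev S h = lev T h" "length t \<le> h"
  shows "t \<in> S \<longleftrightarrow> t \<in> T"
  using lev_below[OF assms(1) perfect_is_tree[OF assms(2)] _ _ assms(4)]
    lev_below[OF assms(2) perfect_is_tree[OF assms(1)] _ _ assms(4)] assms(3)
  by (auto simp: lev_def)

lemma lev_eq_Split:
  assumes "perfect_tree T" "perfect_tree S" "lev S h = lev T h" "length u < h"
  shows "u \<in> Split S \<longleftrightarrow> u \<in> Split T"
  using lev_eq_below[OF assms(1-3)] assms(4) by (simp add: Split_def)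

section \<open>Thinning, grafting and fusion\<close>

lemma split_count:
  assumes "good T"
  obtains m where "\<And>j. length (sp T j) < h \<longleftrightarrow> j < m"
proof -
  define m where "m = (LEAST j. h \<le> length (sp T j))"
  have m: "h \<le> length (sp T m)" unfolding m_def by (rule LeastI_ex) (rule sp_long[OF assms])
  have "length (sp T j) < h \<longleftrightarrow> j < m" for j
    using m sp_length_mono[OF assms, of m j] not_less_Least[of j "\<lambda>j. h \<le> length (sp T j)"]
    unfolding m_def[symmetric] by (meson leD leI le_trans)
  then show thesis by (rule that)
qed

text \<open>Choose the nodes in heap order, keeping the first \<open>m\<close> and taking from then on splitting nodes of \<open>T0\<close>
longer than \<open>H\<close> and than everything chosen before. Good trees exist inside every perfect subtree
because lengths can be increased at will.\<close>

lemma thin: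
  assumes T: "good T" and T0: "perfect_tree T0" "T0 \<subseteq> T" "T0 \<noteq> {}" and keep: "\<And>j. j < m \<Longrightarrow> sp T j \<in> Split T0"
  obtains S where "good S" "S \<subseteq> T0" "\<And>j. j < m \<Longrightarrow> sp S j = sp T j" "\<And>j. m \<le> j \<Longrightarrow> H < length (sp S j)"
    "\<And>i j. m \<le> j \<Longrightarrow> i < j \<Longrightarrow> length (sp S i) < length (sp S j)"
proof -
  note tT0 = perfect_is_tree[OF T0(1)]
  \<comment> \<open>The condition on the node \<open>r\<close> at position \<open>k\<close>, given the earlier nodes \<open>f\<close>. The parent of \<open>k\<close> is
    \<open>(k - 1) div 2\<close>, and even positions are right children.\<close>
  define P where "P f k r \<longleftrightarrow> r \<in> Split T0 \<and> (k < m \<longrightarrow> r = sp T k) \<and>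
      (m \<le> k \<longrightarrow> H < length r \<and> (\<forall>j<k. length (f j) < length r)) \<and>
      (0 < k \<longrightarrow> prefix (f ((k - 1) div 2) @ [even k]) r)" for f :: "nat \<Rightarrow> node" and k r
  have "\<exists>f. \<forall>k. P f k (f k)"
  proof (rule dependent_wellorder_choice)
    fix r k and f g :: "nat \<Rightarrow> node" assume eq: "\<And>j. j < k \<Longrightarrow> f j = g j"
    have "0 < k \<Longrightarrow> f ((k - 1) div 2) = g ((k - 1) div 2)" by (rule eq) linarith
    then show "P f k r = P g k r" unfolding P_def using eq by auto
  next
    fix k f assume IH: "\<And>j. j < k \<Longrightarrow> P f j (f j)"
    show "\<exists>r. P f k r"
    proof (cases "k < m")
      case True
      have "prefix (f ((k - 1) div 2) @ [even k]) (sp T k)" if "0 < k"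
      proof -
        let ?p = "(k - 1) div 2"
        have k: "k = 2 * ?p + 1 + of_bool (even k)" "?p < k" using that by (auto elim!: evenE oddE)
        have "f ?p = sp T ?p" using IH[OF k(2)] k(2) True unfolding P_def by simp
        then show ?thesis using sp_child[OF T, of ?p "even k"] k(1) by metis
      qed
      then have "P f k (sp T k)" unfolding P_def using True keep by simp
      then show ?thesis by blast
    next
      case False
      define t where "t = (if k = 0 then [] else f ((k - 1) div 2) @ [even k])"
      have "t \<in> T0"
      proof (cases "k = 0")
        case True
        obtain x where "x \<in> T0" using T0(3) by blast
        then have "[] \<in> T0" by (rule tree_prefix[OF tT0 _ Nil_prefix])
        then show ?thesis using True by (simp add: t_def)
      next
        case False
        then have "(k - 1) div 2 < k" by linarith
        then have "f ((k - 1) div 2) \<in> Split T0" using IH unfolding P_def by blast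
        then show ?thesis using False Split_in(2) by (simp add: t_def)
      qed
      then obtain r where r: "r \<in> Split T0" "prefix t r" "Suc (H + (\<Sum>j<k. length (f j))) \<le> length r"
        using perfect_long_split[OF T0(1)] by blast
      have "length (f j) \<le> (\<Sum>j<k. length (f j))" if "j < k" for j
        by (rule member_le_sum) (use that in auto)
      then have "\<forall>j<k. length (f j) < length r" using r(3) by fastforce
      moreover have "0 < k \<Longrightarrow> prefix (f ((k - 1) div 2) @ [even k]) r" using r(2) by (simp add: t_def)
      ultimately have "P f k r" unfolding P_def using r False by simp
      then show ?thesis by blast
    qed
  qed
  then obtain f where f: "\<And>k. P f k (f k)" by blast
  have child: "prefix (f p @ [b]) (f (2 * p + 1 + of_bool b))" for p b
  proof -
    have "(2 * p + 1 + of_bool b - 1) div 2 = p" "even (2 * p + 1 + of_bool b) = b" by (cases b; simp)+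
    then show ?thesis using f[of "2 * p + 1 + of_bool b"] unfolding P_def by simp
  qed
  have fm: "f j = sp T j" if "j < m" for j using f[of j] that unfolding P_def by blast
  have fM: "H < length (f j)" "i < j \<Longrightarrow> length (f i) < length (f j)" if "m \<le> j" for i j
    using f[of j] that unfolding P_def by blast+
  have mono: "length (f i) \<le> length (f j)" if "i \<le> j" for i j
  proof (cases "j < m")
    case True then show ?thesis using that fm sp_length_mono[OF T] by simp
  next
    case False then show ?thesis using fM(2)[of j i] that by (cases "i = j") auto
  qed
  obtain S where S: "good S" "S \<subseteq> T0" "\<And>k. sp S k = f k"
    by (rule good_from_sequence[OF child mono tT0]) (use f Split_in(1) in \<open>auto simp: P_def\<close>)
  show thesis using S fm fM by (intro that[of S]) simp_all
qed

text \<open>Replacing the cones above the nodes of a level by perfect subtrees leaves a perfect tree, which need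
not be good; thinning repairs this above the level.\<close>

lemma graft:
  assumes T: "good T" and U: "\<And>i. i \<in> lev T h \<Longrightarrow> perfect_tree (U i)" "\<And>i. i \<in> lev T h \<Longrightarrow> U i \<subseteq> T"
    "\<And>i. i \<in> lev T h \<Longrightarrow> i \<in> U i"
  obtains S where "good S" "S \<subseteq> T" "lev S h = lev T h" "\<And>t. t \<in> S \<Longrightarrow> h \<le> length t \<Longrightarrow> t \<in> U (take h t)"
proof -
  note pT = good_perfect(1)[OF T] and tT = good_perfect(3)[OF T]
  define T0 where "T0 = {t \<in> T. h \<le> length t \<longrightarrow> t \<in> U (take h t)}"
  have sub: "T0 \<subseteq> T" by (auto simp: T0_def)
  have takeT: "take h t \<in> lev T h" if "t \<in> T" "h \<le> length t" for t
    using that tree_prefix[OF tT that(1) take_is_prefix] by (simp add: lev_def)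
  have lev0: "lev T h \<subseteq> T0" using U(3) by (auto simp: T0_def lev_def)
  have tT0: "is_tree T0"
    unfolding is_tree_def
  proof (intro ballI allI impI)
    fix t s assume t: "t \<in> T0" and st: "prefix s t"
    have s: "s \<in> T" using t st tree_prefix[OF tT] sub by blast
    have "s \<in> U (take h s)" if h: "h \<le> length s"
    proof -
      have ht: "h \<le> length t" using h prefix_length_le[OF st] by simp
      have eq: "take h s = take h t" using st h by (auto simp: prefix_def)
      have "t \<in> U (take h t)" using t ht by (simp add: T0_def)
      moreover have "is_tree (U (take h t))"
        using takeT[of t] ht t sub U(1) perfect_is_tree by blast
      ultimately show ?thesis using tree_prefix st eq by metis
    qed
    then show "s \<in> T0" using s by (simp add: T0_def)
  qed
  have "\<exists>s\<in>Split T0. prefix t s" if t: "t \<in> T0" for t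
  proof -
    obtain t' where t': "t' \<in> T0" "prefix t t'" "h \<le> length t'"
    proof (cases "h \<le> length t")
      case True then show ?thesis using that[of t] t by simp
    next
      case False
      then have hle: "length t \<le> h" by simp
      have tT: "t \<in> T" using t sub by blast
      obtain y where "y \<in> lev T h" "prefix t y" by (rule perfect_extend[OF pT tT hle])
      then show ?thesis using that[of y] lev0 by (auto simp: lev_def)
    qed
    define i where "i = take h t'"
    have i: "i \<in> lev T h" unfolding i_def using takeT t' sub by blast
    have "t' \<in> U i" using t' by (simp add: T0_def i_def)
    then obtain s where s: "s \<in> Split (U i)" "prefix t' s" using U(1)[OF i] unfolding perfect_tree_def by blast
    have "x \<in> T0" if "x \<in> U i" "prefix t' x" for x
    proof -
      have "take h x = i" using that(2) t'(3) by (auto simp: i_def prefix_def)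
      then show ?thesis using that U(2)[OF i] by (auto simp: T0_def)
    qed
    then have "s @ [b] \<in> T0" for b
      using Split_in(2)[OF s(1)] s(2) prefix_prefix[of t' s "[b]"] by blast
    then have "s \<in> Split T0" by (intro SplitI[OF _ _ tT0])
    then show ?thesis using s(2) t'(2) prefix_order.trans by blast
  qed
  then have pT0: "perfect_tree T0" using tT0 by (simp add: perfect_tree_def)
  have levT0: "lev T0 h = lev T h" using lev_mono[OF sub] lev0 by (auto simp: lev_def)
  have ne: "T0 \<noteq> {}"
  proof -
    obtain x where x: "x \<in> T" using good_perfect(2)[OF T] by blast
    have "[] \<in> T" by (rule tree_prefix[OF tT x Nil_prefix])
    then obtain y where "y \<in> lev T h" by (rule perfect_extend[OF pT, of "[]" h]) simp_all
    then show ?thesis using lev0 by blast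
  qed
  obtain m where m: "\<And>j. length (sp T j) < h \<longleftrightarrow> j < m" using split_count[OF T] by blast
  have keep: "sp T j \<in> Split T0" if "j < m" for j
    using lev_eq_Split[OF pT pT0 levT0] m that sp_in_Split[OF T] by blast
  obtain S where S: "good S" "S \<subseteq> T0" "\<And>j. j < m \<Longrightarrow> sp S j = sp T j"
    using thin[OF T pT0 sub ne keep] by metis
  show thesis
  proof (rule that[OF S(1)])
    show "S \<subseteq> T" using S(2) sub by blast
    show "lev S h = lev T h"
    proof (rule lev_eq_if_keeps_splits[OF tT good_perfect(1)[OF S(1)] _ good_perfect(2)[OF S(1)]])
      show "S \<subseteq> T" using S(2) sub by blast
      fix u assume u: "u \<in> Split T" "length u < h"
      then obtain j where j: "u = sp T j" using Split_spE[OF T] by blast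
      then have "u = sp S j" using S(3) m u(2) by simp
      then show "u \<in> Split S" using sp_in_Split[OF S(1)] by simp
    qed
    show "t \<in> U (take h t)" if "t \<in> S" "h \<le> length t" for t using that S(2) by (auto simp: T0_def)
  qed
qed

lemma sp_agree_lev:
  assumes T: "good T" and S: "good S" "S \<subseteq> T" and eq: "lev S h = lev T h" and j: "length (sp T j) < h"
  shows "sp S j = sp T j"
proof -
  obtain m where m: "\<And>j. length (sp T j) < h \<longleftrightarrow> j < m" using split_count[OF T] by blast
  have "sp T i \<in> Split S" if "i < m" for i
    using lev_eq_Split[OF good_perfect(1)[OF T] good_perfect(1)[OF S(1)] eq, of "sp T i"] m that sp_in_Split[OF T] by blast
  then show ?thesis using sp_agree[OF T S] m j by blast
qed

text \<open>If \<open>T\<close> changes at step \<open>n\<close> only beyond its first \<open>n\<close> splitting nodes, then the node at each position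
is eventually constant. The limits form a good tree, because being good only compares two nodes at a
time.\<close>

lemma fusion:
  fixes \<Psi> :: "nat \<Rightarrow> tree \<Rightarrow> bool"
  assumes T0: "good T0" "\<Psi> m T0"
    and step: "\<And>n T. m \<le> n \<Longrightarrow> good T \<Longrightarrow> T \<subseteq> T0 \<Longrightarrow> (\<And>j. j < m \<Longrightarrow> sp T j = sp T0 j) \<Longrightarrow> \<Psi> n T \<Longrightarrow>
      \<exists>T'. good T' \<and> T' \<subseteq> T \<and> (\<forall>j<n. sp T' j = sp T j) \<and> \<Psi> (Suc n) T'"
    and hered: "\<And>n T T'. good T \<Longrightarrow> good T' \<Longrightarrow> T' \<subseteq> T \<Longrightarrow> (\<And>j. j < n \<Longrightarrow> sp T' j = sp T j) \<Longrightarrow> \<Psi> n T \<Longrightarrow> \<Psi> n T'"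
  obtains S where "good S" "S \<subseteq> T0" "\<And>j. j < m \<Longrightarrow> sp S j = sp T0 j" "\<And>n. m \<le> n \<Longrightarrow> \<Psi> n S"
proof -
  define P where "P i T \<longleftrightarrow> good T \<and> T \<subseteq> T0 \<and> (\<forall>j<m. sp T j = sp T0 j) \<and> \<Psi> (m + i) T" for i T
  define Q where "Q i T T' \<longleftrightarrow> T' \<subseteq> T \<and> (\<forall>j<m + i. sp T' j = sp T j)" for i and T T' :: tree
  have "\<exists>F. \<forall>i. P i (F i) \<and> Q i (F i) (F (Suc i))"
  proof (rule dependent_nat_choice)
    have "P 0 T0" unfolding P_def using T0 by simp
    then show "\<exists>T. P 0 T" by (rule exI)
  next
    fix T i assume "P i T"
    then have T: "good T" "T \<subseteq> T0" "\<And>j. j < m \<Longrightarrow> sp T j = sp T0 j" "\<Psi> (m + i) T" unfolding P_def by simp_all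
    have "\<exists>T'. good T' \<and> T' \<subseteq> T \<and> (\<forall>j<m + i. sp T' j = sp T j) \<and> \<Psi> (Suc (m + i)) T'"
      by (rule step[OF le_add1 T(1,2) _ T(4)]) (rule T(3))
    then obtain T' where T': "good T'" "T' \<subseteq> T" "\<forall>j<m + i. sp T' j = sp T j" "\<Psi> (Suc (m + i)) T'"
      by (elim exE conjE)
    have "\<forall>j<m. sp T' j = sp T0 j" using T'(3) T(3) by simp
    moreover have "T' \<subseteq> T0" using T'(2) T(2) by (rule order_trans)
    moreover have "\<Psi> (m + Suc i) T'" using T'(4) by simp
    ultimately have "P (Suc i) T'" unfolding P_def using T'(1) by (intro conjI)
    moreover have "Q i T T'" unfolding Q_def using T'(2,3) by (rule conjI)
    ultimately show "\<exists>T'. P (Suc i) T' \<and> Q i T T'" by (intro exI[of _ T'] conjI)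
  qed
  then obtain F where F: "\<forall>i. P i (F i) \<and> Q i (F i) (F (Suc i))" by (rule exE)
  have FP: "good (F i)" "F i \<subseteq> T0" "j < m \<Longrightarrow> sp (F i) j = sp T0 j" "\<Psi> (m + i) (F i)" for i j
    using F[THEN spec, of i] unfolding P_def by simp_all
  have FQ: "F (Suc i) \<subseteq> F i" "j < m + i \<Longrightarrow> sp (F (Suc i)) j = sp (F i) j" for i j
    using F[THEN spec, of i] unfolding Q_def by simp_all
  have dec: "F (i + d) \<subseteq> F i" "j < m + i \<Longrightarrow> sp (F (i + d)) j = sp (F i) j" for i d j
  proof (induction d)
    case (Suc d)
    { case 1 show ?case using Suc(1) FQ(1)[of "i + d"] by simp }
    { case 2 then show ?case using Suc(2) FQ(2)[of j "i + d"] by simp }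
  qed simp_all
  \<comment> \<open>The node at position \<open>k\<close> does not change from step \<open>Suc k\<close> on.\<close>
  define e where "e k = sp (F (Suc k)) k" for k
  have eF: "e k = sp (F i) k" if "k < m + i" for k i
  proof (cases "Suc k \<le> i")
    case True
    then obtain d where "i = Suc k + d" using le_Suc_ex by blast
    then show ?thesis using dec(2)[of k "Suc k" d] by (simp add: e_def)
  next
    case False
    then obtain d where "Suc k = i + d" using le_Suc_ex[of i "Suc k"] by auto
    then show ?thesis using dec(2)[of k i d] that by (simp add: e_def)
  qed
  have "prefix (e p @ [b]) (e (2 * p + 1 + of_bool b))" for p b
    using sp_child[OF FP(1), of "Suc (2 * p + 1 + of_bool b)" p b]
      eF[of p "Suc (2 * p + 1 + of_bool b)"] eF[of "2 * p + 1 + of_bool b" "Suc (2 * p + 1 + of_bool b)"] by simp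
  moreover have "length (e i) \<le> length (e j)" if "i \<le> j" for i j
    using sp_length_mono[OF FP(1) that, of "Suc j"] eF[of i "Suc j"] eF[of j "Suc j"] that by simp
  moreover have eFin: "e k \<in> F i" for k i
  proof -
    have "e k = sp (F (i + Suc k)) k" by (rule eF) simp
    then have "e k \<in> F (i + Suc k)" using sp_in_Split[OF FP(1)] Split_in(1) by metis
    then show ?thesis using dec(1) by blast
  qed
  moreover have "is_tree UNIV" by (simp add: is_tree_def)
  ultimately obtain S where S: "good S" "\<And>k. sp S k = e k"
    using good_from_sequence[of e UNIV] by (metis UNIV_I)
  have SF: "S \<subseteq> F i" for i
  proof
    fix t assume "t \<in> S"
    then obtain k where "prefix t (e k)" using sp_cover[OF S(1)] S(2) by metis
    then show "t \<in> F i" using tree_prefix[OF good_perfect(3)[OF FP(1)] eFin] by blast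
  qed
  show thesis
  proof (rule that[OF S(1)])
    show "S \<subseteq> T0" using SF FP(2) by blast
    show "sp S j = sp T0 j" if "j < m" for j using S(2) eF[of j 0] FP(3)[OF that, of 0] that by simp
    fix n assume "m \<le> n"
    then obtain i where n: "n = m + i" using le_Suc_ex by blast
    show "\<Psi> n S"
      unfolding n
    proof (rule hered[OF FP(1) S(1) SF _ FP(4)])
      fix j assume "j < m + i" then show "sp S j = sp (F i) j" using S(2) eF by simp
    qed
  qed
qed

lemma restr_good:
  assumes "good T"
  shows "restr T n = {t. \<exists>k\<le>n. \<exists>b. prefix t (sp T k @ [b])}"
proof
  show "restr T n \<subseteq> {t. \<exists>k\<le>n. \<exists>b. prefix t (sp T k @ [b])}"
  proof
    fix t assume "t \<in> restr T n"
    then obtain k s b where s: "k \<le> n" "s \<in> Split T" "depth s T = k" "prefix t (s @ [b])"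
      unfolding restr_def by blast
    then obtain j where "s = sp T j" using Split_spE[OF assms] by blast
    then have "s = sp T k" using s(3) depth_sp[OF assms] by simp
    then show "t \<in> {t. \<exists>k\<le>n. \<exists>b. prefix t (sp T k @ [b])}" using s by blast
  qed
  show "{t. \<exists>k\<le>n. \<exists>b. prefix t (sp T k @ [b])} \<subseteq> restr T n"
  proof
    fix t assume "t \<in> {t. \<exists>k\<le>n. \<exists>b. prefix t (sp T k @ [b])}"
    then obtain k b where k: "k \<le> n" "prefix t (sp T k @ [b])" by blast
    note s = sp_in_Split[OF assms, of k]
    have "t \<in> T" by (rule tree_prefix[OF good_perfect(3)[OF assms] Split_in(2)[OF s] k(2)])
    then show "t \<in> restr T n" unfolding restr_def using k s depth_sp[OF assms] by blast
  qed
qed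

section \<open>Amoeba-Sacks conditions\<close>

text \<open>Truncations serve as the finite parts of conditions. They are determined by the level \<open>h\<close> of the tree.\<close>

definition trunc :: "tree \<Rightarrow> nat \<Rightarrow> tree" where
  "trunc S h = {t \<in> S. length t \<le> h}"

lemma infinite_good: assumes "good T" shows "infinite T"
proof -
  have "inj (sp T)" using sp_eq_iff[OF assms] by (auto intro: injI)
  then have "infinite (range (sp T))" using finite_imageD[of "sp T" UNIV] by auto
  then show ?thesis using sp_in_Split[OF assms] Split_in(1) by (meson finite_subset image_subsetI)
qed

text \<open>A finite tree never equals a nonempty good tree, so the strictness in the definition of conditions
only excludes the empty tree.\<close>

lemma AS_iff: "(p, S) \<in> AS \<longleftrightarrow> good S \<and> p \<sqsubseteq>\<^sub>e S"
proof
  assume "(p, S) \<in> AS"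
  then have *: "good_tree S" "p \<sqsubseteq>\<^sub>e S" "p \<noteq> S" by (simp_all add: AS_def strict_end_ext_def)
  have "S \<noteq> {}" using *(2,3) unfolding end_ext_def by blast
  then show "good S \<and> p \<sqsubseteq>\<^sub>e S" using * by (simp add: good_def)
next
  assume *: "good S \<and> p \<sqsubseteq>\<^sub>e S"
  then have "p \<noteq> S" using infinite_good[of S] by (auto simp: end_ext_def)
  then show "(p, S) \<in> AS" using * by (simp add: AS_def strict_end_ext_def good_def)
qed

lemma end_ext_refl: "is_tree p \<Longrightarrow> finite p \<Longrightarrow> p \<sqsubseteq>\<^sub>e p"
  by (simp add: end_ext_def)

lemma end_ext_trans:
  assumes pq: "p \<sqsubseteq>\<^sub>e q" and qr: "q \<sqsubseteq>\<^sub>e r"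
  shows "p \<sqsubseteq>\<^sub>e r"
proof -
  have 1: "\<exists>s\<in>Term p. prefix s t" if "t \<in> q - p" for t using pq that unfolding end_ext_def by blast
  have "\<exists>s\<in>Term p. prefix s t" if t: "t \<in> r - p" for t
  proof (cases "t \<in> q")
    case True then show ?thesis using 1 t by blast
  next
    case False
    then obtain s where s: "s \<in> Term q" "prefix s t" using qr t unfolding end_ext_def by blast
    show ?thesis
    proof (cases "s \<in> p")
      case True
      then have "s \<in> Term p" using s(1) pq unfolding Term_def end_ext_def by blast
      then show ?thesis using s(2) by blast
    next
      case False
      then have "s \<in> q - p" using s(1) unfolding Term_def by blast
      then show ?thesis using 1 s(2) prefix_order.trans by blast
    qed
  qed
  then show ?thesis using pq qr unfolding end_ext_def by blast
qed

lemma end_ext_between: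
  assumes "p \<sqsubseteq>\<^sub>e S" "is_tree q" "p \<subseteq> q" "q \<subseteq> S"
  shows "p \<sqsubseteq>\<^sub>e q"
  using assms unfolding end_ext_def by blast

lemma AS_le_refl: "(p, S) \<in> AS \<Longrightarrow> AS_le (p, S) (p, S)"
  unfolding AS_le_def by (auto simp: AS_iff end_ext_def)

lemma AS_le_trans: "AS_le a b \<Longrightarrow> AS_le b c \<Longrightarrow> AS_le a c"
  unfolding AS_le_def using end_ext_trans by blast

lemma finite_trunc: "finite (trunc S h)"
proof (rule finite_subset)
  show "trunc S h \<subseteq> {t. set t \<subseteq> UNIV \<and> length t \<le> h}" by (auto simp: trunc_def)
  show "finite {t. set t \<subseteq> (UNIV :: bool set) \<and> length t \<le> h}" by (rule finite_lists_length_le) simp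
qed

lemma is_tree_trunc: "is_tree S \<Longrightarrow> is_tree (trunc S h)"
  unfolding is_tree_def trunc_def by (auto dest: prefix_length_le)

lemma trunc_AS:
  assumes "good S"
  shows "(trunc S h, S) \<in> AS"
proof -
  note tS = good_perfect(3)[OF assms]
  have "\<exists>s\<in>Term (trunc S h). prefix s t" if t: "t \<in> S - trunc S h" for t
  proof (intro bexI)
    have l: "h < length t" using t by (auto simp: trunc_def)
    have "take h t \<in> S" using tree_prefix[OF tS _ take_is_prefix] t by blast
    then show "take h t \<in> Term (trunc S h)"
      using l unfolding Term_def trunc_def by (auto dest: prefix_length_less)
  qed (rule take_is_prefix)
  then show ?thesis
    unfolding AS_iff end_ext_def using assms tS finite_trunc is_tree_trunc[OF tS]
    by (auto simp: trunc_def)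
qed

lemma trunc_eq:
  assumes "good T" "good S" "lev S h = lev T h"
  shows "trunc S h = trunc T h"
  using lev_eq_below[OF good_perfect(1)[OF assms(1)] good_perfect(1)[OF assms(2)] assms(3)]
  by (auto simp: trunc_def)

lemma AS_le_truncD:
  assumes "AS_le (p, S') (trunc S h, S)"
  shows "good S'" "S' \<subseteq> S" "lev S' h = lev S h"
proof -
  have *: "(p, S') \<in> AS" "S' \<subseteq> S" "trunc S h \<sqsubseteq>\<^sub>e p" using assms by (simp_all add: AS_le_def)
  then show "good S'" "S' \<subseteq> S" by (simp_all add: AS_iff)
  have "trunc S h \<subseteq> S'" using * by (auto simp: AS_iff end_ext_def)
  then show "lev S' h = lev S h" using *(2) by (auto simp: lev_def trunc_def)
qed

lemma AS_le_trunc_same: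
  assumes "(p, S) \<in> AS" "\<And>t. t \<in> p \<Longrightarrow> length t \<le> h"
  shows "AS_le (trunc S h, S) (p, S)"
proof -
  have S: "good S" "p \<sqsubseteq>\<^sub>e S" using assms(1) by (simp_all add: AS_iff)
  have "p \<sqsubseteq>\<^sub>e trunc S h"
  proof (rule end_ext_between[OF S(2) is_tree_trunc[OF good_perfect(3)[OF S(1)]]])
    show "p \<subseteq> trunc S h" using S(2) assms(2) by (auto simp: end_ext_def trunc_def)
  qed (auto simp: trunc_def)
  then show ?thesis using assms(1) trunc_AS[OF S(1)] by (simp add: AS_le_def)
qed

lemma AS_le_trunc:
  assumes "good S" "good S'" "S' \<subseteq> S" "lev S' h = lev S h" "h \<le> h'"
  shows "AS_le (trunc S' h', S') (trunc S h, S)"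
proof -
  have "AS_le (trunc S' h', S') (trunc S' h, S')"
    by (rule AS_le_trunc_same[OF trunc_AS[OF assms(2)]]) (use assms(5) in \<open>auto simp: trunc_def\<close>)
  moreover have "AS_le (trunc S' h, S') (trunc S h, S)"
    using trunc_AS[OF assms(1), of h] trunc_AS[OF assms(2), of h] assms(3)
      end_ext_refl[OF is_tree_trunc[OF good_perfect(3)[OF assms(1)]] finite_trunc]
    by (simp add: AS_le_def trunc_eq[OF assms(1,2,4)])
  ultimately show ?thesis by (rule AS_le_trans)
qed

text \<open>Read \<open>E\<close> as the set of conditions at which the name is seen to have a certain value; density
of \<open>E\<close> below the truncated condition says that this condition forces the value.\<close>

definition decides :: "cond set \<Rightarrow> nat \<Rightarrow> tree \<Rightarrow> bool" where
  "decides E h S \<longleftrightarrow> dense_below AS AS_le E (trunc S h, S)"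

lemma dense_below_mono: "dense_below AS AS_le E c \<Longrightarrow> AS_le c' c \<Longrightarrow> dense_below AS AS_le E c'"
  unfolding dense_below_def using AS_le_trans by blast

lemma decides_mono:
  assumes "decides E h S" "good S" "good S'" "S' \<subseteq> S" "lev S' h = lev S h" "h \<le> h'"
  shows "decides E h' S'"
  using assms(1) AS_le_trunc[OF assms(2-6)] unfolding decides_def by (rule dense_below_mono)

text \<open>Below a truncated condition, every condition contains a tree with the same level \<open>h\<close>, and its finite
part can be enlarged to a truncation at an arbitrary height.\<close>

lemma decides_local:
  assumes S: "good S"
    and loc: "\<And>S'. good S' \<Longrightarrow> S' \<subseteq> S \<Longrightarrow> lev S' h = lev S h \<Longrightarrow> \<exists>h'\<ge>h. decides E h' S'"
  shows "decides E h S"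
  unfolding decides_def dense_below_def
proof (intro ballI impI)
  fix q assume q: "q \<in> AS" "AS_le q (trunc S h, S)"
  obtain p S' where qp: "q = (p, S')" by (cases q)
  note S' = AS_le_truncD[OF q(2)[unfolded qp]]
  obtain h' where h': "h' \<ge> h" "decides E h' S'" using loc[OF S'] by blast
  have fin: "finite p" using q(1) by (simp add: qp AS_iff end_ext_def)
  define h2 where "h2 = h' + (\<Sum>t\<in>p. length t)"
  have "length t \<le> h2" if "t \<in> p" for t
    using member_le_sum[OF that _ fin, of length] by (simp add: h2_def)
  then have le: "AS_le (trunc S' h2, S') q" unfolding qp by (intro AS_le_trunc_same) (use q(1) qp in auto)
  have "decides E h2 S'" by (rule decides_mono[OF h'(2) S'(1) S'(1)]) (simp_all add: h2_def)
  then obtain r where "r \<in> E" "r \<in> AS" "AS_le r (trunc S' h2, S')"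
    using AS_le_refl[OF trunc_AS[OF S'(1)]] trunc_AS[OF S'(1)] unfolding decides_def dense_below_def by blast
  then show "\<exists>r\<in>E. r \<in> AS \<and> AS_le r q" using AS_le_trans[OF _ le] by blast
qed

section \<open>The next splitting node\<close>

text \<open>The splitting node of \<open>S\<close> that comes first among those of length at least \<open>h\<close>.\<close>

definition first_split :: "tree \<Rightarrow> nat \<Rightarrow> node \<Rightarrow> bool" where
  "first_split S h z \<longleftrightarrow> (\<exists>n. z = sp S n \<and> h \<le> length (sp S n) \<and> (\<forall>j<n. length (sp S j) < h))"

lemma first_split_exists: assumes "good S" shows "\<exists>z. first_split S h z"
proof -
  obtain m where m: "\<And>j. length (sp S j) < h \<longleftrightarrow> j < m" using split_count[OF assms] by blast
  have "first_split S h (sp S m)" unfolding first_split_def using m by (intro exI[of _ m]) (simp add: not_less[symmetric])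
  then show ?thesis by blast
qed

lemma first_split_facts:
  assumes "good S" "first_split S h z"
  shows "z \<in> Split S" "h \<le> length z" "u \<in> Split S \<Longrightarrow> h \<le> length u \<Longrightarrow> length z \<le> length u"
proof -
  obtain n where n: "z = sp S n" "h \<le> length (sp S n)" "\<And>j. j < n \<Longrightarrow> length (sp S j) < h"
    using assms(2) unfolding first_split_def by blast
  show "z \<in> Split S" "h \<le> length z" using n(1,2) sp_in_Split[OF assms(1)] by simp_all
  assume u: "u \<in> Split S" "h \<le> length u"
  then obtain j where j: "u = sp S j" using Split_spE[OF assms(1)] by blast
  then have "n \<le> j" using n(3)[of j] u(2) by (metis leI not_le)
  then show "length z \<le> length u" using n(1) j sp_length_mono[OF assms(1)] by simp
qed

lemma sp_tail_length:
  assumes "good T" "good S" "S \<subseteq> T" "\<And>j. j < n \<Longrightarrow> sp S j = sp T j" "\<And>j. n \<le> j \<Longrightarrow> h \<le> length (sp T j)" "n \<le> j"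
  shows "h \<le> length (sp S j)"
proof (rule ccontr)
  assume "\<not> h \<le> length (sp S j)"
  moreover obtain i where i: "sp S j = sp T i"
    using Split_spE[OF assms(1)] Split_mono[OF assms(3)] sp_in_Split[OF assms(2)] by blast
  ultimately have "i < n" using assms(5)[of i] by (metis leI)
  then have "sp S j = sp S i" using i assms(4) by simp
  then have "j = i" by (simp add: sp_eq_iff[OF assms(2)])
  then show False using \<open>i < n\<close> assms(6) by simp
qed

text \<open>The splitting nodes shorter than \<open>h\<close> are the same in both trees and fix the position of the next one
in the heap order. So \<open>z\<close> is an initial segment of \<open>z'\<close>.\<close>

lemma next_position:
  assumes S: "good S" and S': "good S'" "S' \<subseteq> S" "lev S' h = lev S h" and z: "first_split S h z" "first_split S' h z'"
  shows "take h z' = take h z"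
proof -
  obtain n where n: "z = sp S n" "h \<le> length (sp S n)" "\<And>j. j < n \<Longrightarrow> length (sp S j) < h"
    using z(1) unfolding first_split_def by blast
  obtain n' where n': "z' = sp S' n'" "h \<le> length (sp S' n')" "\<And>j. j < n' \<Longrightarrow> length (sp S' j) < h"
    using z(2) unfolding first_split_def by blast
  have agree: "sp S' j = sp S j" if "j < n" for j by (rule sp_agree_lev[OF S S' n(3)[OF that]])
  have "h \<le> length (sp S j)" if "n \<le> j" for j using n(2) sp_length_mono[OF S that] by simp
  then have "h \<le> length (sp S' n)" using sp_tail_length[OF S S'(1,2) agree] by blast
  then have "n' \<le> n" using n'(3)[of n] by (metis leD leI)
  moreover have "n \<le> n'" using n'(2) agree[of n'] n(3)[of n'] by (metis leD leI)
  ultimately have nn: "n' = n" by simp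
  have z'S: "z' \<in> Split S" using n'(1) sp_in_Split[OF S'(1)] Split_mono[OF S'(2)] by blast
  have "prefix z z'"
  proof (rule nat_child_cases[of n])
    assume "n = 0" then show ?thesis using sp_root_least[OF S z'S] n(1) by simp
  next
    fix p b assume p: "n = 2 * p + 1 + of_bool b" "p < n"
    have "prefix (sp S p @ [b]) z'"
      using sp_child[OF S'(1), of p b] agree[OF p(2)] n'(1) nn p(1) by simp
    then show ?thesis using sp_child_least[OF S z'S] n(1) p(1) by simp
  qed
  then show ?thesis using n(1,2) by (auto simp: prefix_def)
qed

text \<open>Skewness makes the next splitting node unique, and with it the shape of the level just above it.\<close>

definition skew :: "nat \<Rightarrow> tree \<Rightarrow> bool" where
  "skew h T \<longleftrightarrow> (\<forall>u\<in>Split T. \<forall>v\<in>Split T. h \<le> length u \<longrightarrow> length u = length v \<longrightarrow> u = v)"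

lemma skewD: "skew h T \<Longrightarrow> u \<in> Split T \<Longrightarrow> v \<in> Split T \<Longrightarrow> h \<le> length u \<Longrightarrow> length u = length v \<Longrightarrow> u = v"
  unfolding skew_def by blast

lemma skew_subset: "skew h T \<Longrightarrow> S \<subseteq> T \<Longrightarrow> skew h S"
  unfolding skew_def using Split_mono by blast

lemma branching_point:
  assumes S: "is_tree S" and y: "y \<in> S" "y' \<in> S" "length y = length y'" "take h y = take h y'" "y \<noteq> y'"
  obtains u where "u \<in> Split S" "prefix u y" "h \<le> length u" "length u < length y"
proof (rule list_compare[of y y'])
  assume "prefix y y'" then show thesis using y(3,5) by (metis prefix_length_less strict_prefix_iff_prefix less_irrefl)
next
  fix b assume "prefix (y' @ [b]) y" then show thesis using y(3) by (auto dest: prefix_length_le)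
next
  fix \<rho> b assume r: "prefix (\<rho> @ [b]) y" "prefix (\<rho> @ [\<not> b]) y'"
  have "\<rho> @ [b] \<in> S" "\<rho> @ [\<not> b] \<in> S" using tree_prefix[OF S] r y(1,2) by blast+
  then have "\<rho> \<in> Split S" by (cases b) (auto intro: SplitI[OF _ _ S])
  moreover have "h \<le> length \<rho>"
  proof (rule ccontr)
    assume "\<not> h \<le> length \<rho>"
    then have l: "length (\<rho> @ [b]) \<le> h" "length (\<rho> @ [\<not> b]) \<le> h" by simp_all
    have "take (Suc (length \<rho>)) (take h y) = \<rho> @ [b]" "take (Suc (length \<rho>)) (take h y') = \<rho> @ [\<not> b]"
      using r l by (auto simp: prefix_def min_def)
    then show False using y(4) by simp
  qed
  ultimately show thesis
    using that[of \<rho>] prefix_length_le[OF r(1)] append_prefixD[OF r(1)] by simp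
qed

text \<open>Between \<open>h\<close> and \<open>|z| + 1\<close> the tree branches only at \<open>z\<close>. This makes its level at \<open>|z| + 1\<close> a tuple of the
kind that the Halpern-Laeuchli theorem colours.\<close>

lemma level_after_first_split:
  assumes S: "good S" "skew h0 S" "h0 \<le> h" and z: "first_split S h z"
  obtains w where "\<And>i. i \<in> lev S h - {take h z} \<Longrightarrow> w i \<in> S \<and> length (w i) = Suc (length z) \<and> prefix i (w i)"
    "lev S (Suc (length z)) = {z @ [False], z @ [True]} \<union> w ` (lev S h - {take h z})"
proof -
  note pS = good_perfect(1)[OF S(1)] and tS = good_perfect(3)[OF S(1)]
  note zf = first_split_facts[OF S(1) z]
  have "\<exists>y. y \<in> S \<and> length y = Suc (length z) \<and> prefix i y" if i: "i \<in> lev S h - {take h z}" for i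
  proof -
    have "i \<in> S" "length i \<le> Suc (length z)" using i zf(2) by (auto simp: lev_def)
    then obtain y where "y \<in> lev S (Suc (length z))" "prefix i y" using perfect_extend[OF pS] by blast
    then show ?thesis by (auto simp: lev_def)
  qed
  then have "\<exists>w. \<forall>i\<in>lev S h - {take h z}. w i \<in> S \<and> length (w i) = Suc (length z) \<and> prefix i (w i)"
    by (intro bchoice ballI)
  then obtain w where w: "\<forall>i\<in>lev S h - {take h z}. w i \<in> S \<and> length (w i) = Suc (length z) \<and> prefix i (w i)" ..
  have "lev S (Suc (length z)) \<subseteq> {z @ [False], z @ [True]} \<union> w ` (lev S h - {take h z})"
  proof
    fix y assume "y \<in> lev S (Suc (length z))"
    then have y: "y \<in> S" "length y = Suc (length z)" by (simp_all add: lev_def)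
    define i where "i = take h y"
    have "i \<in> S" unfolding i_def by (rule tree_prefix[OF tS y(1) take_is_prefix])
    then have i: "i \<in> lev S h" using y(2) zf(2) by (simp add: lev_def i_def)
    show "y \<in> {z @ [False], z @ [True]} \<union> w ` (lev S h - {take h z})"
    proof (cases "i = take h z")
      case True
      have "take (length z) y = z"
      proof (rule ccontr)
        assume ne: "take (length z) y \<noteq> z"
        have "take (length z) y \<in> S" by (rule tree_prefix[OF tS y(1) take_is_prefix])
        moreover have "take h (take (length z) y) = take h z" using True zf(2) by (simp add: i_def min_def)
        ultimately obtain u where "u \<in> Split S" "h \<le> length u" "length u < length z"
          using branching_point[OF tS, of "take (length z) y" z h] Split_in(1)[OF zf(1)] ne y(2) by auto
        then show False using zf(3) by fastforce
      qed
      then have "y = z @ [y ! length z]" using y(2) by (metis lessI take_Suc_conv_app_nth take_all order_refl)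
      then show ?thesis by (cases "y ! length z") auto
    next
      case False
      then have wi: "w i \<in> S" "length (w i) = Suc (length z)" "prefix i (w i)" using w i by blast+
      have "y = w i"
      proof (rule ccontr)
        assume ne: "y \<noteq> w i"
        have "take h (w i) = i" using wi(3) i by (auto simp: prefix_def lev_def)
        then obtain u where u: "u \<in> Split S" "prefix u y" "h \<le> length u" "length u < length y"
          using branching_point[OF tS y(1) wi(1), of h] wi(2) y(2) ne i_def by metis
        have "length u = length z" using zf(3)[OF u(1,3)] u(4) y(2) by simp
        then have "u = z" using skewD[OF S(2) u(1) zf(1)] u(3) S(3) by simp
        then have "take h z = i" using u(2,3) by (auto simp: i_def prefix_def)
        then show False using False by simp
      qed
      then show ?thesis using False i by blast
    qed
  qed
  moreover have "{z @ [False], z @ [True]} \<union> w ` (lev S h - {take h z}) \<subseteq> lev S (Suc (length z))"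
    using w Split_in(2)[OF zf(1)] by (auto simp: lev_def)
  ultimately show thesis using w by (intro that[of w]) auto
qed

section \<open>Decisive trees\<close>

text \<open>The family \<open>E\<close> has one set of conditions for each value. Since levels of good trees are nonempty, \<open>Y\<close>
determines the height \<open>h\<close>.\<close>

definition accepts :: "('k \<Rightarrow> cond set) \<Rightarrow> tree \<Rightarrow> node set \<Rightarrow> 'k \<Rightarrow> bool" where
  "accepts E T Y k \<longleftrightarrow> (\<forall>S h. good S \<longrightarrow> S \<subseteq> T \<longrightarrow> lev S h = Y \<longrightarrow> decides (E k) h S)"

definition rejects :: "('k \<Rightarrow> cond set) \<Rightarrow> 'k set \<Rightarrow> tree \<Rightarrow> nat \<Rightarrow> node set \<Rightarrow> bool" where
  "rejects E A T h Y \<longleftrightarrow> (\<forall>S. good S \<longrightarrow> S \<subseteq> T \<longrightarrow> lev S h = Y \<longrightarrow> (\<forall>k\<in>A. \<not> decides (E k) h S))"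

definition decisive :: "('k \<Rightarrow> cond set) \<Rightarrow> 'k set \<Rightarrow> tree \<Rightarrow> nat \<Rightarrow> bool" where
  "decisive E A T h \<longleftrightarrow> (\<forall>Y\<subseteq>lev T h. (\<exists>k\<in>A. accepts E T Y k) \<or> rejects E A T h Y)"

lemma acceptsD: "accepts E T Y k \<Longrightarrow> good S \<Longrightarrow> S \<subseteq> T \<Longrightarrow> lev S h = Y \<Longrightarrow> decides (E k) h S"
  by (simp add: accepts_def)

lemma acceptsI: "(\<And>S h. good S \<Longrightarrow> S \<subseteq> T \<Longrightarrow> lev S h = Y \<Longrightarrow> decides (E k) h S) \<Longrightarrow> accepts E T Y k"
  by (simp add: accepts_def)

lemma rejectsD: "rejects E A T h Y \<Longrightarrow> good S \<Longrightarrow> S \<subseteq> T \<Longrightarrow> lev S h = Y \<Longrightarrow> k \<in> A \<Longrightarrow> \<not> decides (E k) h S"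
  by (simp add: rejects_def)

lemma rejectsI:
  "(\<And>S k. good S \<Longrightarrow> S \<subseteq> T \<Longrightarrow> lev S h = Y \<Longrightarrow> k \<in> A \<Longrightarrow> \<not> decides (E k) h S) \<Longrightarrow> rejects E A T h Y"
  by (simp add: rejects_def)

lemma accepts_subset: assumes "accepts E T Y k" "T' \<subseteq> T" shows "accepts E T' Y k"
  by (rule acceptsI, rule acceptsD[OF assms(1)]) (use assms(2) in auto)

lemma rejects_subset: assumes "rejects E A T h Y" "T' \<subseteq> T" shows "rejects E A T' h Y"
  by (rule rejectsI, rule rejectsD[OF assms(1)]) (use assms(2) in auto)

lemma decisive_subset:
  assumes "decisive E A T h" "T' \<subseteq> T"
  shows "decisive E A T' h"
  unfolding decisive_def
proof (intro allI impI)
  fix Y assume "Y \<subseteq> lev T' h"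
  then have "Y \<subseteq> lev T h" using lev_mono[OF assms(2)] by blast
  then have "(\<exists>k\<in>A. accepts E T Y k) \<or> rejects E A T h Y" using assms(1) unfolding decisive_def by blast
  then show "(\<exists>k\<in>A. accepts E T' Y k) \<or> rejects E A T' h Y"
  proof
    assume "\<exists>k\<in>A. accepts E T Y k"
    then obtain k where k: "k \<in> A" "accepts E T Y k" by blast
    have "accepts E T' Y k" by (rule accepts_subset[OF k(2) assms(2)])
    then show ?thesis using k(1) by blast
  next
    assume "rejects E A T h Y"
    then have "rejects E A T' h Y" by (rule rejects_subset[OF _ assms(2)])
    then show ?thesis by blast
  qed
qed

lemma lev_nonempty: assumes "good S" shows "lev S h \<noteq> {}"
proof -
  obtain x where "x \<in> S" using good_perfect(2)[OF assms] by blast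
  then have "[] \<in> S" by (rule tree_prefix[OF good_perfect(3)[OF assms] _ Nil_prefix])
  then obtain y where "y \<in> lev S h" by (rule perfect_extend[OF good_perfect(1)[OF assms], of "[]" h]) simp_all
  then show ?thesis by blast
qed

lemma lev_height_unique: assumes "good S" "lev S h = lev S' h'" shows "h = h'"
proof -
  obtain y where "y \<in> lev S h" using lev_nonempty[OF assms(1)] by blast
  moreover from this have "y \<in> lev S' h'" using assms(2) by simp
  ultimately show ?thesis by (simp add: lev_def)
qed

text \<open>Put \<open>S\<close> into the cones above its own level and leave the other cones alone. This shrinks \<open>T\<close> for the
subtrees through the level of \<open>S\<close> and keeps the level of \<open>T\<close>.\<close>

lemma graft_into:
  assumes T: "good T" and S: "good S" "S \<subseteq> T"
  obtains T' where "good T'" "T' \<subseteq> T" "lev T' h = lev T h"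
    "\<And>R. good R \<Longrightarrow> R \<subseteq> T' \<Longrightarrow> lev R h = lev S h \<Longrightarrow> R \<subseteq> S"
proof -
  let ?U = "\<lambda>i. if i \<in> lev S h then S else T"
  obtain T' where T': "good T'" "T' \<subseteq> T" "lev T' h = lev T h" "\<And>t. t \<in> T' \<Longrightarrow> h \<le> length t \<Longrightarrow> t \<in> ?U (take h t)"
  proof (rule graft[OF T, of h ?U])
    fix i assume "i \<in> lev T h"
    show "perfect_tree (?U i)" using good_perfect(1)[OF T] good_perfect(1)[OF S(1)] by simp
    show "?U i \<subseteq> T" using S(2) by simp
    show "i \<in> ?U i" using \<open>i \<in> lev T h\<close> by (simp add: lev_def)
  qed blast
  show thesis
  proof (rule that[OF T'(1-3)])
    fix R assume R: "good R" "R \<subseteq> T'" "lev R h = lev S h"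
    show "R \<subseteq> S"
    proof
      fix t assume t: "t \<in> R"
      show "t \<in> S"
      proof (cases "h \<le> length t")
        case True
        then have "take h t \<in> lev R h"
          using tree_prefix[OF good_perfect(3)[OF R(1)] t take_is_prefix] by (simp add: lev_def)
        then show ?thesis using T'(4)[of t] t R(2,3) True by auto
      next
        case False
        then show ?thesis
          using lev_eq_below[OF good_perfect(1)[OF S(1)] good_perfect(1)[OF R(1)] R(3), of t] t by simp
      qed
    qed
  qed
qed

lemma accept_by_graft:
  assumes T: "good T" and S: "good S" "S \<subseteq> T" "decides (E k) h S"
  shows "\<exists>T'. good T' \<and> T' \<subseteq> T \<and> lev T' h = lev T h \<and> accepts E T' (lev S h) k"
proof -
  obtain T' where T': "good T'" "T' \<subseteq> T" "lev T' h = lev T h"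
    "\<And>R. good R \<Longrightarrow> R \<subseteq> T' \<Longrightarrow> lev R h = lev S h \<Longrightarrow> R \<subseteq> S"
    using graft_into[OF T S(1,2), of h] by blast
  have "accepts E T' (lev S h) k"
  proof (rule acceptsI)
    fix R h' assume R: "good R" "R \<subseteq> T'" "lev R h' = lev S h"
    have h': "h' = h" using lev_height_unique[OF R(1)] R(3) by blast
    show "decides (E k) h' R"
      using decides_mono[OF S(3,1) R(1) T'(4)[OF R(1,2)], of h] R(3) h' by simp
  qed
  then show ?thesis using T'(1-3) by blast
qed

text \<open>The requirements will be indexed by the candidates for levels of subtrees, of which there are finitely
many at each height.\<close>

lemma iterate_requirements:
  assumes R: "finite R" and T: "good T"
    and step: "\<And>r T'. r \<in> R \<Longrightarrow> good T' \<Longrightarrow> T' \<subseteq> T \<Longrightarrow> lev T' h = lev T h \<Longrightarrow>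
      \<exists>T''. good T'' \<and> T'' \<subseteq> T' \<and> lev T'' h = lev T' h \<and> \<Phi> r T''"
    and hered: "\<And>r T' T''. \<Phi> r T' \<Longrightarrow> T'' \<subseteq> T' \<Longrightarrow> \<Phi> r T''"
  shows "\<exists>T'. good T' \<and> T' \<subseteq> T \<and> lev T' h = lev T h \<and> (\<forall>r\<in>R. \<Phi> r T')"
  using R step
proof induction
  case empty then show ?case using T by blast
next
  case (insert r R)
  have "\<exists>T'. good T' \<and> T' \<subseteq> T \<and> lev T' h = lev T h \<and> (\<forall>r\<in>R. \<Phi> r T')"
    by (rule insert.IH) (rule insert.prems, simp_all)
  then obtain T' where T': "good T'" "T' \<subseteq> T" "lev T' h = lev T h" "\<forall>r\<in>R. \<Phi> r T'" by (elim exE conjE)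
  have "\<exists>T''. good T'' \<and> T'' \<subseteq> T' \<and> lev T'' h = lev T' h \<and> \<Phi> r T''"
    by (rule insert.prems[OF _ T'(1-3)]) simp
  then obtain T'' where T'': "good T''" "T'' \<subseteq> T'" "lev T'' h = lev T' h" "\<Phi> r T''" by (elim exE conjE)
  have "\<Phi> r' T''" if "r' \<in> insert r R" for r'
  proof (cases "r' = r")
    case True then show ?thesis using T''(4) by simp
  next
    case False
    then have "r' \<in> R" using that by simp
    then have "\<Phi> r' T'" by (rule T'(4)[THEN bspec])
    then show ?thesis by (rule hered[OF _ T''(2)])
  qed
  then show ?case using T' T'' by (intro exI[of _ T''] conjI ballI) auto
qed

lemma make_decisive:
  assumes T: "good T"
  shows "\<exists>T'. good T' \<and> T' \<subseteq> T \<and> lev T' h = lev T h \<and> decisive E A T' h"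
proof -
  define \<Phi> where "\<Phi> Y T \<longleftrightarrow> (\<exists>k\<in>A. accepts E T Y k) \<or> rejects E A T h Y" for Y T
  have "\<exists>T'. good T' \<and> T' \<subseteq> T \<and> lev T' h = lev T h \<and> (\<forall>Y\<in>Pow (lev T h). \<Phi> Y T')"
  proof (rule iterate_requirements[OF _ T])
    show "finite (Pow (lev T h))" using finite_lev by simp
    show "\<Phi> Y T''" if "\<Phi> Y T'" "T'' \<subseteq> T'" for Y T' T''
      using that(1) accepts_subset[OF _ that(2), of E Y] rejects_subset[OF _ that(2), of E A h Y]
      unfolding \<Phi>_def by blast
    fix Y T' assume T': "good T'" "T' \<subseteq> T"
    show "\<exists>T''. good T'' \<and> T'' \<subseteq> T' \<and> lev T'' h = lev T' h \<and> \<Phi> Y T''"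
    proof (cases "rejects E A T' h Y")
      case True then show ?thesis using T' unfolding \<Phi>_def by blast
    next
      case False
      then obtain S k where S: "good S" "S \<subseteq> T'" "lev S h = Y" "k \<in> A" "decides (E k) h S"
        unfolding rejects_def by blast
      obtain T'' where T'': "good T''" "T'' \<subseteq> T'" "lev T'' h = lev T' h" "accepts E T'' Y k"
        using accept_by_graft[of T' S E k h, OF T'(1) S(1,2,5)] S(3) by blast
      then show ?thesis using T'' S(4) unfolding \<Phi>_def by blast
    qed
  qed
  then obtain T' where T': "good T'" "T' \<subseteq> T" "lev T' h = lev T h" "\<forall>Y\<in>Pow (lev T h). \<Phi> Y T'" by blast
  then have "decisive E A T' h" unfolding decisive_def \<Phi>_def by simp
  then show ?thesis using T' by blast
qed

section \<open>Pure decision\<close>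

definition admissible :: "tree \<Rightarrow> nat \<Rightarrow> node set \<Rightarrow> tree \<Rightarrow> bool" where
  "admissible T h X S \<longleftrightarrow> good S \<and> S \<subseteq> T \<and> lev S h = X"

lemma admissible_subset: "admissible T' h X S \<Longrightarrow> T' \<subseteq> T \<Longrightarrow> admissible T h X S"
  unfolding admissible_def by blast

definition accept_color :: "('k \<Rightarrow> cond set) \<Rightarrow> 'k set \<Rightarrow> tree \<Rightarrow> node set \<Rightarrow> 'k option" where
  "accept_color E A T Y =
    (if \<exists>k\<in>A. accepts E T Y k then Some (SOME k. k \<in> A \<and> accepts E T Y k) else None)"

lemma accept_color_Some:
  assumes "accept_color E A T Y = Some k"
  shows "k \<in> A" "accepts E T Y k"
proof -
  have ex: "\<exists>k. k \<in> A \<and> accepts E T Y k" using assms unfolding accept_color_def by (auto split: if_splits)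
  then have "k = (SOME k. k \<in> A \<and> accepts E T Y k)" using assms unfolding accept_color_def by (auto split: if_splits)
  then have "k \<in> A \<and> accepts E T Y k" using someI_ex[OF ex] by simp
  then show "k \<in> A" "accepts E T Y k" by simp_all
qed

lemma accept_color_None:
  assumes "accept_color E A T Y = None" "k \<in> A"
  shows "\<not> accepts E T Y k"
  using assms unfolding accept_color_def by (auto split: if_splits)

lemma finite_accept_color: assumes "finite A" shows "finite (range (accept_color E A T))"
proof (rule finite_subset)
  show "range (accept_color E A T) \<subseteq> insert None (Some ` A)"
  proof
    fix x assume "x \<in> range (accept_color E A T)"
    then obtain Y where Y: "x = accept_color E A T Y" by blast
    show "x \<in> insert None (Some ` A)"
    proof (cases x)
      case (Some k) then show ?thesis using accept_color_Some(1)[of E A T Y k] Y by simp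
    qed simp
  qed
qed (use assms in simp)

lemma perfect_cone:
  assumes T: "perfect_tree T" and i: "i \<in> T"
  shows "perfect_tree {t \<in> T. prefix t i \<or> prefix i t}"
proof -
  let ?C = "{t \<in> T. prefix t i \<or> prefix i t}"
  note tT = perfect_is_tree[OF T]
  have tC: "is_tree ?C"
    unfolding is_tree_def
  proof (intro ballI allI impI)
    fix t s assume t: "t \<in> ?C" and st: "prefix s t"
    have "s \<in> T" using tree_prefix[OF tT _ st] t by blast
    moreover have "prefix s i \<or> prefix i s"
      using t st prefix_order.trans[OF st] prefix_same_cases[OF st] by blast
    ultimately show "s \<in> ?C" by blast
  qed
  have "\<exists>s\<in>Split ?C. prefix t s" if t: "t \<in> ?C" for t
  proof -
    obtain u where u: "u \<in> T" "prefix i u" "prefix t u"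
      using t i by blast
    obtain s where s: "s \<in> Split T" "prefix u s" using T u(1) unfolding perfect_tree_def by blast
    have ps: "prefix i s" "prefix t s" using u s(2) prefix_order.trans by blast+
    have "s @ [b] \<in> ?C" for b using Split_in(2)[OF s(1)] ps(1) by simp
    then have "s \<in> Split ?C" by (intro SplitI[OF _ _ tC])
    then show ?thesis using ps(2) by blast
  qed
  then show ?thesis using tC unfolding perfect_tree_def by blast
qed

text \<open>Fix a possible level \<open>X\<close> and one of its nodes \<open>x\<close> as the position of the next splitting node. The
Halpern-Laeuchli theorem makes the colour constant on the cones above \<open>X\<close>. If it were a value
and some subtree \<open>S\<close> had its next splitting node above \<open>x\<close>, then so would all its subtrees with the same
level, all of them would decide this value, and hence \<open>S\<close> would decide it at \<open>h\<close>.\<close>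

lemma homogenize_position:
  fixes E :: "'k \<Rightarrow> cond set"
  assumes T: "good T" "skew h0 T" "h0 \<le> h" and A: "finite A"
    and no: "\<And>S k. admissible T h0 X0 S \<Longrightarrow> k \<in> A \<Longrightarrow> \<not> decides (E k) h S"
    and dec: "\<And>z. z \<in> Split T \<Longrightarrow> h0 \<le> length z \<Longrightarrow> decisive E A T (Suc (length z))"
    and X: "X \<subseteq> lev T h" "x \<in> X"
  shows "\<exists>T'. good T' \<and> T' \<subseteq> T \<and> lev T' h = lev T h \<and>
    (\<forall>S z k. admissible T' h0 X0 S \<longrightarrow> lev S h = X \<longrightarrow> first_split S h z \<longrightarrow> take h z = x \<longrightarrow> k \<in> A \<longrightarrow>
      \<not> decides (E k) (Suc (length z)) S)"
proof -
  note pT = good_perfect(1)[OF T(1)]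
  let ?C = "\<lambda>i. {t \<in> T. prefix t i \<or> prefix i t}"
  have XT: "i \<in> T" "length i = h" if "i \<in> X" for i using X(1) that by (auto simp: lev_def)
  have finX: "finite X" by (rule finite_subset[OF X(1) finite_lev])
  obtain U c where U: "\<And>i. i \<in> X \<Longrightarrow> perfect_tree (U i)" "\<And>i. i \<in> X \<Longrightarrow> U i \<noteq> {}" "\<And>i. i \<in> X \<Longrightarrow> U i \<subseteq> ?C i"
    and col: "\<And>z w. z \<in> Split (U x) \<Longrightarrow> (\<And>i. i \<in> X - {x} \<Longrightarrow> w i \<in> U i \<and> length (w i) = Suc (length z)) \<Longrightarrow>
      accept_color E A T ({z @ [False], z @ [True]} \<union> w ` (X - {x})) = c"
  proof (rule halpern_lauchli[OF finX X(2), of ?C "accept_color E A T"])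
    show "perfect_tree (?C i)" if "i \<in> X" for i by (rule perfect_cone[OF pT XT(1)[OF that]])
    show "?C i \<noteq> {}" if "i \<in> X" for i using XT(1)[OF that] by blast
    show "finite (range (accept_color E A T))" by (rule finite_accept_color[OF A])
  qed blast
  have iU: "i \<in> U i" if i: "i \<in> X" for i
  proof -
    obtain u where u: "u \<in> U i" using U(2)[OF i] by blast
    have "[] \<in> U i" by (rule tree_prefix[OF perfect_is_tree[OF U(1)[OF i]] u Nil_prefix])
    then obtain y where "y \<in> lev (U i) h" by (rule perfect_extend[OF U(1)[OF i], of "[]" h]) simp_all
    then have y: "y \<in> U i" "length y = h" by (simp_all add: lev_def)
    then have "prefix y i \<or> prefix i y" using U(3)[OF i] by blast
    then have "y = i" using y(2) XT(2)[OF i] by (auto simp: prefix_def)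
    then show ?thesis using y(1) by simp
  qed
  let ?V = "\<lambda>i. if i \<in> X then U i else T"
  obtain T' where T': "good T'" "T' \<subseteq> T" "lev T' h = lev T h" "\<And>t. t \<in> T' \<Longrightarrow> h \<le> length t \<Longrightarrow> t \<in> ?V (take h t)"
  proof (rule graft[OF T(1), of h ?V])
    fix i assume "i \<in> lev T h"
    show "perfect_tree (?V i)" using pT U(1) by simp
    show "?V i \<subseteq> T" using U(3) by auto
    show "i \<in> ?V i" using \<open>i \<in> lev T h\<close> iU by (simp add: lev_def)
  qed blast
  have color: "accept_color E A T (lev S (Suc (length z))) = c"
    if S: "good S" "S \<subseteq> T'" "lev S h = X" and z: "first_split S h z" "take h z = x" for S z
  proof -
    note zf = first_split_facts[OF S(1) z(1)]
    have sk: "skew h0 S" by (rule skew_subset[OF T(2)]) (use S(2) T'(2) in blast)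
    have SU: "t \<in> U i" if "t \<in> S" "h \<le> length t" "take h t = i" "i \<in> X" for t i
      using T'(4)[of t] that S(2) by auto
    obtain w where w: "\<And>i. i \<in> lev S h - {take h z} \<Longrightarrow> w i \<in> S \<and> length (w i) = Suc (length z) \<and> prefix i (w i)"
      "lev S (Suc (length z)) = {z @ [False], z @ [True]} \<union> w ` (lev S h - {take h z})"
      using level_after_first_split[OF S(1) sk T(3) z(1)] by blast
    have "z @ [b] \<in> U x" for b
      by (rule SU[OF Split_in(2)[OF zf(1)] _ _ X(2)]) (use zf(2) z(2) in simp_all)
    then have zU: "z \<in> Split (U x)" by (intro SplitI[OF _ _ perfect_is_tree[OF U(1)[OF X(2)]]])
    have wU: "w i \<in> U i \<and> length (w i) = Suc (length z)" if i: "i \<in> X - {x}" for i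
    proof -
      have wi: "w i \<in> S" "length (w i) = Suc (length z)" "prefix i (w i)" using w(1)[of i] i S(3) z(2) by simp_all
      have "take h (w i) = i" using wi(3) XT(2)[of i] i by (auto simp: prefix_def)
      then show ?thesis using SU[OF wi(1)] wi(2) zf(2) i by simp
    qed
    show ?thesis using col[OF zU wU] w(2) S(3) z(2) by simp
  qed
  have "\<not> decides (E k) (Suc (length z)) S"
    if S: "admissible T' h0 X0 S" "lev S h = X" and z: "first_split S h z" "take h z = x" and k: "k \<in> A" for S z k
  proof
    assume d: "decides (E k) (Suc (length z)) S"
    have gS: "good S" "S \<subseteq> T'" using S(1) by (simp_all add: admissible_def)
    have ST: "S \<subseteq> T" using gS(2) T'(2) by blast
    have aS: "admissible T h0 X0 S" by (rule admissible_subset[OF S(1) T'(2)])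
    note zf = first_split_facts[OF gS(1) z(1)]
    have zT: "z \<in> Split T" using zf(1) Split_mono[OF ST] by blast
    let ?Y = "lev S (Suc (length z))"
    have dz: "decisive E A T (Suc (length z))" by (rule dec[OF zT]) (use T(3) zf(2) in simp)
    have "\<not> rejects E A T (Suc (length z)) ?Y"
    proof
      assume "rejects E A T (Suc (length z)) ?Y"
      from rejectsD[OF this gS(1) ST refl k] show False using d by simp
    qed
    then obtain k' where k': "k' \<in> A" "accepts E T ?Y k'"
      using dz lev_mono[OF ST, of "Suc (length z)"] unfolding decisive_def by blast
    \<comment> \<open>\<open>S\<close> witnesses that its level is not rejected, so decisiveness gives it a value.\<close>
    have "c \<noteq> None"
    proof
      assume "c = None"
      then have "accept_color E A T ?Y = None" using color[OF gS S(2) z] by simp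
      from accept_color_None[OF this k'(1)] show False using k'(2) by simp
    qed
    then obtain k1 where k1: "c = Some k1" by blast
    have "decides (E k1) h S"
    proof (rule decides_local[OF gS(1)])
      fix S' assume S': "good S'" "S' \<subseteq> S" "lev S' h = lev S h"
      obtain z' where z': "first_split S' h z'" using first_split_exists[OF S'(1)] by blast
      have "take h z' = x" using next_position[OF gS(1) S' z(1) z'] z(2) by simp
      moreover have "S' \<subseteq> T'" using S'(2) gS(2) by blast
      ultimately have "accept_color E A T (lev S' (Suc (length z'))) = Some k1"
        using color[OF S'(1) _ _ z'] S'(3) S(2) k1 by simp
      from accept_color_Some(2)[OF this] have "decides (E k1) (Suc (length z')) S'"
        by (rule acceptsD[OF _ S'(1) _ refl]) (use S'(2) ST in blast)
      moreover have "h \<le> Suc (length z')" using first_split_facts(2)[OF S'(1) z'] by simp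
      ultimately show "\<exists>h'\<ge>h. decides (E k1) h' S'" by blast
    qed
    moreover have "k1 \<in> A"
    proof (rule accept_color_Some(1))
      show "accept_color E A T ?Y = Some k1" using color[OF gS S(2) z] k1 by simp
    qed
    ultimately show False using no[OF aS] by simp
  qed
  then show ?thesis using T'(1-3) by blast
qed

text \<open>There are only finitely many pairs of a level and a position in it.\<close>

lemma homogenize_next_split:
  fixes E :: "'k \<Rightarrow> cond set"
  assumes T: "good T" "skew h0 T" "h0 \<le> h" and A: "finite A"
    and no: "\<And>S k. admissible T h0 X0 S \<Longrightarrow> k \<in> A \<Longrightarrow> \<not> decides (E k) h S"
    and dec: "\<And>z. z \<in> Split T \<Longrightarrow> h0 \<le> length z \<Longrightarrow> decisive E A T (Suc (length z))"
  shows "\<exists>T'. good T' \<and> T' \<subseteq> T \<and> lev T' h = lev T h \<and>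
    (\<forall>S z k. admissible T' h0 X0 S \<longrightarrow> first_split S h z \<longrightarrow> k \<in> A \<longrightarrow> \<not> decides (E k) (Suc (length z)) S)"
proof -
  define \<Phi> where "\<Phi> r T' \<longleftrightarrow> (\<forall>S z k. admissible T' h0 X0 S \<longrightarrow> lev S h = fst r \<longrightarrow> first_split S h z \<longrightarrow>
    take h z = snd r \<longrightarrow> k \<in> A \<longrightarrow> \<not> decides (E k) (Suc (length z)) S)" for r T'
  let ?R = "{(X, x). X \<subseteq> lev T h \<and> x \<in> X}"
  have "\<exists>T'. good T' \<and> T' \<subseteq> T \<and> lev T' h = lev T h \<and> (\<forall>r\<in>?R. \<Phi> r T')"
  proof (rule iterate_requirements[OF _ T(1)])
    have "?R \<subseteq> Pow (lev T h) \<times> lev T h" by blast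
    then show "finite ?R" by (rule finite_subset) (simp add: finite_lev)
    show "\<Phi> r T''" if "\<Phi> r T'" "T'' \<subseteq> T'" for r T' T''
      unfolding \<Phi>_def
    proof (intro allI impI)
      fix S z k assume *: "admissible T'' h0 X0 S" "lev S h = fst r" "first_split S h z" "take h z = snd r" "k \<in> A"
      have "admissible T' h0 X0 S" by (rule admissible_subset[OF *(1) that(2)])
      then show "\<not> decides (E k) (Suc (length z)) S" using that(1) *(2-5) unfolding \<Phi>_def by simp
    qed
    fix r T' assume r: "r \<in> ?R" and T': "good T'" "T' \<subseteq> T" "lev T' h = lev T h"
    obtain X x where rx: "r = (X, x)" "X \<subseteq> lev T' h" "x \<in> X" using r T'(3) by auto
    show "\<exists>T''. good T'' \<and> T'' \<subseteq> T' \<and> lev T'' h = lev T' h \<and> \<Phi> r T''"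
      unfolding \<Phi>_def rx(1) fst_conv snd_conv
    proof (rule homogenize_position[OF T'(1) skew_subset[OF T(2) T'(2)] T(3) A _ _ rx(2,3)])
      fix S k assume S: "admissible T' h0 X0 S" and k: "k \<in> A"
      show "\<not> decides (E k) h S" by (rule no[OF admissible_subset[OF S T'(2)] k])
    next
      fix z assume z: "z \<in> Split T'" "h0 \<le> length z"
      have "z \<in> Split T" using z(1) Split_mono[OF T'(2)] by blast
      from dec[OF this z(2)] show "decisive E A T' (Suc (length z))" by (rule decisive_subset[OF _ T'(2)])
    qed
  qed
  then obtain T' where T': "good T'" "T' \<subseteq> T" "lev T' h = lev T h" "\<forall>r\<in>?R. \<Phi> r T'" by (elim exE conjE)
  have "\<not> decides (E k) (Suc (length z)) S" if S: "admissible T' h0 X0 S" and z: "first_split S h z" and k: "k \<in> A" for S z k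
  proof -
    have gS: "good S" "S \<subseteq> T'" using S by (simp_all add: admissible_def)
    have "take h z \<in> S"
      by (rule tree_prefix[OF good_perfect(3)[OF gS(1)] Split_in(1)[OF first_split_facts(1)[OF gS(1) z]] take_is_prefix])
    then have "take h z \<in> lev S h" using first_split_facts(2)[OF gS(1) z] by (simp add: lev_def)
    moreover have "lev S h \<subseteq> lev T h" using lev_mono[OF gS(2), of h] T'(3) by simp
    ultimately have "(lev S h, take h z) \<in> ?R" by simp
    then have "\<Phi> (lev S h, take h z) T'" by (rule T'(4)[THEN bspec])
    then show ?thesis unfolding \<Phi>_def using S z k by simp
  qed
  then show ?thesis using T'(1-3) by blast
qed

lemma keeps_level:
  assumes "good T" "good S" "S \<subseteq> T" "\<And>j. length (sp T j) < h \<Longrightarrow> sp S j = sp T j"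
  shows "lev S h = lev T h"
proof (rule lev_eq_if_keeps_splits[OF good_perfect(3)[OF assms(1)] good_perfect(1)[OF assms(2)] assms(3) good_perfect(2)[OF assms(2)]])
  fix u assume u: "u \<in> Split T" "length u < h"
  then obtain j where j: "u = sp T j" using Split_spE[OF assms(1)] by blast
  then have "u = sp S j" using assms(4) u(2) by simp
  then show "u \<in> Split S" using sp_in_Split[OF assms(2)] by simp
qed

text \<open>At step \<open>n\<close> the tree is made decisive just above its splitting node of depth \<open>n\<close>.\<close>

lemma decisive_fusion:
  assumes T: "good T"
  shows "\<exists>S. good S \<and> S \<subseteq> T \<and> lev S h0 = lev T h0 \<and>
    (\<forall>z\<in>Split S. h0 \<le> length z \<longrightarrow> decisive E A S (Suc (length z)))"
proof -
  obtain m where m: "\<And>j. length (sp T j) < h0 \<longleftrightarrow> j < m" using split_count[OF T] by blast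
  define \<Psi> where "\<Psi> n T \<longleftrightarrow> (\<forall>j. m \<le> j \<longrightarrow> j < n \<longrightarrow> decisive E A T (Suc (length (sp T j))))" for n T
  have "\<exists>S. good S \<and> S \<subseteq> T \<and> (\<forall>j<m. sp S j = sp T j) \<and> (\<forall>n\<ge>m. \<Psi> n S)"
  proof (rule fusion[OF T, of \<Psi> m])
    show "\<Psi> m T" by (simp add: \<Psi>_def)
  next
    fix n T1 assume T1: "good T1" "\<Psi> n T1"
    obtain T' where T': "good T'" "T' \<subseteq> T1" "lev T' (Suc (length (sp T1 n))) = lev T1 (Suc (length (sp T1 n)))"
      "decisive E A T' (Suc (length (sp T1 n)))"
      using make_decisive[OF T1(1), of "Suc (length (sp T1 n))" E A] by blast
    have agree: "sp T' j = sp T1 j" if "j \<le> n" for j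
      by (rule sp_agree_lev[OF T1(1) T'(1-3)]) (use sp_length_mono[OF T1(1) that] in simp)
    have "\<Psi> (Suc n) T'"
      unfolding \<Psi>_def
    proof (intro allI impI)
      fix j assume j: "m \<le> j" "j < Suc n"
      show "decisive E A T' (Suc (length (sp T' j)))"
      proof (cases "j = n")
        case True then show ?thesis using T'(4) agree[of n] by simp
      next
        case False
        then have "decisive E A T1 (Suc (length (sp T1 j)))" using T1(2) j unfolding \<Psi>_def by simp
        then show ?thesis using decisive_subset[OF _ T'(2)] agree[of j] j(2) by simp
      qed
    qed
    then show "\<exists>T'. good T' \<and> T' \<subseteq> T1 \<and> (\<forall>j<n. sp T' j = sp T1 j) \<and> \<Psi> (Suc n) T'"
      using T'(1,2) agree by (intro exI[of _ T']) simp
  next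
    fix n T1 T' assume *: "T' \<subseteq> T1" "\<And>j. j < n \<Longrightarrow> sp T' j = sp T1 j" "\<Psi> n T1"
    show "\<Psi> n T'"
      unfolding \<Psi>_def
    proof (intro allI impI)
      fix j assume j: "m \<le> j" "j < n"
      then have "decisive E A T1 (Suc (length (sp T1 j)))" using *(3) unfolding \<Psi>_def by simp
      then show "decisive E A T' (Suc (length (sp T' j)))" using decisive_subset[OF _ *(1)] *(2)[OF j(2)] by simp
    qed
  next
    fix S assume "good S" "S \<subseteq> T" "\<And>j. j < m \<Longrightarrow> sp S j = sp T j" "\<And>n. m \<le> n \<Longrightarrow> \<Psi> n S"
    then show ?thesis by blast
  qed
  then obtain S where S: "good S" "S \<subseteq> T" "\<And>j. j < m \<Longrightarrow> sp S j = sp T j" "\<And>n. m \<le> n \<Longrightarrow> \<Psi> n S" by blast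
  have "lev S h0 = lev T h0" by (rule keeps_level[OF T S(1,2)]) (use S(3) m in blast)
  moreover have "decisive E A S (Suc (length z))" if z: "z \<in> Split S" "h0 \<le> length z" for z
  proof -
    obtain j where j: "z = sp S j" using Split_spE[OF S(1) z(1)] by blast
    have "m \<le> j"
    proof (rule ccontr)
      assume "\<not> m \<le> j"
      then show False using S(3)[of j] m[of j] z(2) j by simp
    qed
    then show ?thesis using S(4)[of "Suc j"] j unfolding \<Psi>_def by simp
  qed
  ultimately show ?thesis using S(1,2) by blast
qed

lemma skew_thinning:
  assumes T: "good T"
  shows "\<exists>S. good S \<and> S \<subseteq> T \<and> lev S h0 = lev T h0 \<and> skew h0 S"
proof -
  obtain m where m: "\<And>j. length (sp T j) < h0 \<longleftrightarrow> j < m" using split_count[OF T] by blast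
  obtain S where S: "good S" "S \<subseteq> T" "\<And>j. j < m \<Longrightarrow> sp S j = sp T j"
    "\<And>i j. m \<le> j \<Longrightarrow> i < j \<Longrightarrow> length (sp S i) < length (sp S j)"
    using thin[OF T good_perfect(1)[OF T] order_refl good_perfect(2)[OF T] sp_in_Split[OF T], of m] by metis
  have "lev S h0 = lev T h0" by (rule keeps_level[OF T S(1,2)]) (use S(3) m in blast)
  moreover have "skew h0 S"
    unfolding skew_def
  proof (intro ballI impI)
    fix u v assume uv: "u \<in> Split S" "v \<in> Split S" "h0 \<le> length u" "length u = length v"
    obtain i where i: "u = sp S i" using Split_spE[OF S(1) uv(1)] by blast
    obtain j where j: "v = sp S j" using Split_spE[OF S(1) uv(2)] by blast
    have "m \<le> i" "m \<le> j"
      using S(3)[of i] m[of i] S(3)[of j] m[of j] uv(3,4) i j by (metis leI leD)+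
    then show "u = v" using S(4)[of i j] S(4)[of j i] uv(4) i j by (metis linorder_neqE_nat less_irrefl)
  qed
  ultimately show ?thesis using S(1,2) by blast
qed

text \<open>Suppose that no admissible tree decides at \<open>h0\<close>. Starting from a skew and decisive tree, a fusion
preserves that no admissible subtree decides just above the splitting node of depth \<open>n - 1\<close>. For the
step, the next splitting node is homogenized; a subtree that omits this node does not branch between
the two levels, so deciding at the upper one would be deciding at the lower one. In the fusion no
admissible subtree decides at any height, contrary to density.\<close>

theorem pure_decision:
  fixes E :: "'k \<Rightarrow> cond set"
  assumes T: "good T" and A: "finite A"
    and dense: "\<And>S. admissible T h0 (lev T h0) S \<Longrightarrow>
      \<exists>S' h k. admissible S h0 (lev T h0) S' \<and> h0 \<le> h \<and> k \<in> A \<and> decides (E k) h S'"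
  shows "\<exists>S k. admissible T h0 (lev T h0) S \<and> k \<in> A \<and> decides (E k) h0 S"
proof (rule ccontr)
  assume neg: "\<not> ?thesis"
  let ?X = "lev T h0"
  obtain T1 where T1: "good T1" "T1 \<subseteq> T" "lev T1 h0 = ?X" "skew h0 T1" using skew_thinning[OF T] by blast
  obtain T2 where T2: "good T2" "T2 \<subseteq> T1" "lev T2 h0 = lev T1 h0"
    and dec: "\<forall>z\<in>Split T2. h0 \<le> length z \<longrightarrow> decisive E A T2 (Suc (length z))"
    using decisive_fusion[OF T1(1), of h0 E A] by blast
  have T2T: "T2 \<subseteq> T" and X2: "lev T2 h0 = ?X" using T2 T1 by simp_all
  have sk: "skew h0 T2" by (rule skew_subset[OF T1(4) T2(2)])
  obtain m where m: "\<And>j. length (sp T2 j) < h0 \<longleftrightarrow> j < m" using split_count[OF T2(1)] by blast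
  \<comment> \<open>The height just above the splitting node of depth \<open>n - 1\<close>, starting with \<open>h0\<close>.\<close>
  define ht where "ht n T = (if n \<le> m then h0 else Suc (length (sp T (n - 1))))" for n T
  define \<Psi> where "\<Psi> n T \<longleftrightarrow> (\<forall>S k. admissible T h0 ?X S \<longrightarrow> k \<in> A \<longrightarrow> \<not> decides (E k) (ht n T) S)" for n T
  have "\<exists>S. good S \<and> S \<subseteq> T2 \<and> (\<forall>j<m. sp S j = sp T2 j) \<and> (\<forall>n\<ge>m. \<Psi> n S)"
  proof (rule fusion[OF T2(1), of \<Psi> m])
    show "\<Psi> m T2"
      unfolding \<Psi>_def ht_def
    proof (intro allI impI)
      fix S k assume S: "admissible T2 h0 ?X S" and k: "k \<in> A"
      have "admissible T h0 ?X S" by (rule admissible_subset[OF S T2T])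
      then show "\<not> decides (E k) (if m \<le> m then h0 else Suc (length (sp T2 (m - 1)))) S" using neg k by auto
    qed
  next
    fix n T' assume n: "m \<le> n" and T': "good T'" "T' \<subseteq> T2" "\<And>j. j < m \<Longrightarrow> sp T' j = sp T2 j" "\<Psi> n T'"
    define h where "h = ht n T'"
    have sk': "skew h0 T'" by (rule skew_subset[OF sk T'(2)])
    have tail: "h0 \<le> length (sp T' j)" if "m \<le> j" for j
      by (rule sp_tail_length[OF T2(1) T'(1-3) _ that]) (use m in \<open>auto simp: not_less[symmetric]\<close>)
    have less: "length (sp T' i) < length (sp T' j)" if "m \<le> i" "i < j" for i j
    proof -
      have "length (sp T' i) \<noteq> length (sp T' j)"
        using skewD[OF sk' sp_in_Split[OF T'(1), of i] sp_in_Split[OF T'(1), of j] tail[OF that(1)]]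
          sp_eq_iff[OF T'(1), of i j] that(2) by auto
      then show ?thesis using sp_length_mono[OF T'(1), of i j] that(2) by simp
    qed
    have hh0: "h0 \<le> h"
    proof (cases "n \<le> m")
      case False
      then have "h0 \<le> length (sp T' (n - 1))" by (intro tail) simp
      then show ?thesis using False by (simp add: h_def ht_def)
    qed (simp add: h_def ht_def)
    have below: "length (sp T' j) < h" if "j < n" for j
    proof (cases "n \<le> m")
      case True then show ?thesis using that T'(3)[of j] m[of j] by (simp add: h_def ht_def)
    next
      case False
      have "length (sp T' j) \<le> length (sp T' (n - 1))" by (rule sp_length_mono[OF T'(1)]) (use that in simp)
      then show ?thesis using False by (simp add: h_def ht_def)
    qed
    have above: "h \<le> length (sp T' j)" if "n \<le> j" for j
    proof (cases "n \<le> m")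
      case True then show ?thesis using tail[of j] that n by (simp add: h_def ht_def)
    next
      case False
      have "length (sp T' (n - 1)) < length (sp T' j)" by (rule less) (use that False in simp_all)
      then show ?thesis using False by (simp add: h_def ht_def)
    qed
    have "\<exists>T''. good T'' \<and> T'' \<subseteq> T' \<and> lev T'' h = lev T' h \<and>
        (\<forall>S z k. admissible T'' h0 ?X S \<longrightarrow> first_split S h z \<longrightarrow> k \<in> A \<longrightarrow> \<not> decides (E k) (Suc (length z)) S)"
    proof (rule homogenize_next_split[OF T'(1) sk' hh0 A])
      fix S k assume "admissible T' h0 ?X S" "k \<in> A"
      then show "\<not> decides (E k) h S" using T'(4) unfolding \<Psi>_def h_def by simp
    next
      fix z assume z: "z \<in> Split T'" "h0 \<le> length z"
      then have "z \<in> Split T2" using Split_mono[OF T'(2)] by blast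
      then have "decisive E A T2 (Suc (length z))" using dec z(2) by simp
      then show "decisive E A T' (Suc (length z))" by (rule decisive_subset[OF _ T'(2)])
    qed
    then obtain T'' where T'': "good T''" "T'' \<subseteq> T'" "lev T'' h = lev T' h"
      and hom: "\<forall>S z k. admissible T'' h0 ?X S \<longrightarrow> first_split S h z \<longrightarrow> k \<in> A \<longrightarrow> \<not> decides (E k) (Suc (length z)) S"
      by (elim exE conjE)
    have agree: "sp T'' j = sp T' j" if "j < n" for j
      by (rule sp_agree_lev[OF T'(1) T'' below[OF that]])
    define z0 where "z0 = sp T'' n"
    have f0: "first_split T'' h z0"
      unfolding first_split_def z0_def
      using sp_tail_length[OF T'(1) T''(1,2) agree above] agree below by (intro exI[of _ n]) simp
    note zf0 = first_split_facts[OF T''(1) f0]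
    have ht': "ht (Suc n) T'' = Suc (length z0)" using n by (simp add: ht_def z0_def)
    have sk'': "skew h0 T''" by (rule skew_subset[OF sk' T''(2)])
    have "\<Psi> (Suc n) T''"
      unfolding \<Psi>_def ht'
    proof (intro allI impI notI)
      fix S k assume S: "admissible T'' h0 ?X S" and k: "k \<in> A" and d: "decides (E k) (Suc (length z0)) S"
      have gS: "good S" "S \<subseteq> T''" "lev S h0 = ?X" using S by (simp_all add: admissible_def)
      obtain z where z: "first_split S h z" using first_split_exists[OF gS(1)] by blast
      note zf = first_split_facts[OF gS(1) z]
      have zT: "z \<in> Split T''" using zf(1) Split_mono[OF gS(2)] by blast
      \<comment> \<open>If \<open>S\<close> keeps \<open>z0\<close>, homogeneity applies. Otherwise \<open>S\<close> does not branch between \<open>h\<close> and \<open>|z0| + 1\<close>.\<close>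
      show False
      proof (cases "z = z0")
        case True then show False using hom S z k d by blast
      next
        case False
        have "length z0 \<noteq> length z" using skewD[OF sk'' zf0(1) zT] zf0(2) hh0 False by auto
        then have long: "length z0 < length z" using zf0(3)[OF zT zf(2)] by simp
        have "decides (E k) h S"
        proof (rule decides_local[OF gS(1)])
          fix S' assume S': "good S'" "S' \<subseteq> S" "lev S' h = lev S h"
          have "lev S' (Suc (length z0)) = lev S (Suc (length z0))"
          proof (rule lev_eq_if_keeps_splits[OF good_perfect(3)[OF gS(1)] good_perfect(1)[OF S'(1)] S'(2) good_perfect(2)[OF S'(1)]])
            fix u assume u: "u \<in> Split S" "length u < Suc (length z0)"
            have "length u < h"
            proof (rule ccontr)
              assume "\<not> length u < h"
              then have "length z \<le> length u" using zf(3)[OF u(1)] by simp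
              then show False using long u(2) by simp
            qed
            then show "u \<in> Split S'"
              using lev_eq_Split[OF good_perfect(1)[OF gS(1)] good_perfect(1)[OF S'(1)] S'(3)] u(1) by simp
          qed
          then have "decides (E k) (Suc (length z0)) S'" by (rule decides_mono[OF d gS(1) S'(1,2)]) simp
          moreover have "h \<le> Suc (length z0)" using zf0(2) by simp
          ultimately show "\<exists>h'\<ge>h. decides (E k) h' S'" by blast
        qed
        moreover have "admissible T' h0 ?X S" by (rule admissible_subset[OF S T''(2)])
        ultimately show False using T'(4) k unfolding \<Psi>_def h_def by simp
      qed
    qed
    then show "\<exists>T''. good T'' \<and> T'' \<subseteq> T' \<and> (\<forall>j<n. sp T'' j = sp T' j) \<and> \<Psi> (Suc n) T''"
      using T''(1,2) agree by (intro exI[of _ T'']) simp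
  next
    fix n T' T'' assume *: "T'' \<subseteq> T'" "\<And>j. j < n \<Longrightarrow> sp T'' j = sp T' j" "\<Psi> n T'"
    have "ht n T'' = ht n T'" using *(2)[of "n - 1"] by (simp add: ht_def)
    then show "\<Psi> n T''"
      unfolding \<Psi>_def
    proof (intro allI impI)
      fix S k assume S: "admissible T'' h0 ?X S" and k: "k \<in> A"
      have "admissible T' h0 ?X S" by (rule admissible_subset[OF S *(1)])
      then show "\<not> decides (E k) (ht n T'') S" using *(3) k \<open>ht n T'' = ht n T'\<close> unfolding \<Psi>_def by simp
    qed
  next
    fix S assume "good S" "S \<subseteq> T2" "\<And>j. j < m \<Longrightarrow> sp S j = sp T2 j" "\<And>n. m \<le> n \<Longrightarrow> \<Psi> n S"
    then show ?thesis by blast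
  qed
  then obtain S where S: "good S" "S \<subseteq> T2" "\<And>j. j < m \<Longrightarrow> sp S j = sp T2 j" "\<And>n. m \<le> n \<Longrightarrow> \<Psi> n S" by blast
  have SX: "lev S h0 = ?X"
    using keeps_level[OF T2(1) S(1,2), of h0] S(3) m X2 by simp
  have "S \<subseteq> T" using S(2) T2T by blast
  then have "admissible T h0 ?X S" using S(1) SX by (simp add: admissible_def)
  then obtain S' h k where S': "admissible S h0 ?X S'" and k: "k \<in> A" "decides (E k) h S'" using dense by blast
  have gS': "good S'" using S' by (simp add: admissible_def)
  obtain j where j: "h \<le> length (sp S j)" using sp_long[OF S(1)] by blast
  define n where "n = Suc (max m j)"
  have "\<not> n \<le> m" "n - 1 = max m j" by (simp_all add: n_def)
  then have hn: "ht n S = Suc (length (sp S (max m j)))" by (simp only: ht_def if_False)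
  have "decides (E k) (ht n S) S'"
    by (rule decides_mono[OF k(2) gS' gS' order_refl refl])
      (use j sp_length_mono[OF S(1), of j "max m j"] in \<open>simp add: hn\<close>)
  moreover have "\<Psi> n S" by (rule S(4)) (simp add: n_def)
  ultimately show False using S' k(1) unfolding \<Psi>_def by simp
qed

section \<open>Good trees through a fixed finite tree\<close>

lemma end_ext_sibling:
  assumes "p \<sqsubseteq>\<^sub>e T" "u @ [b] \<in> p" "u @ [c] \<in> T"
  shows "u @ [c] \<in> p"
proof (rule ccontr)
  assume n: "u @ [c] \<notin> p"
  then obtain s where s: "s \<in> Term p" "prefix s (u @ [c])" using assms(1,3) unfolding end_ext_def by blast
  then have "s \<noteq> u @ [c]" using n unfolding Term_def by blast
  then have "prefix s u" using s(2) by simp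
  then have "strict_prefix s (u @ [b])" by (auto simp: strict_prefix_def prefix_def)
  then show False using s(1) assms(2) unfolding Term_def by blast
qed

text \<open>A node of \<open>p\<close> can be missing from \<open>S\<close> only if \<open>S\<close> fails to branch at an earlier splitting node of \<open>p\<close>.\<close>

lemma end_ext_iff_Split:
  assumes T: "p \<sqsubseteq>\<^sub>e T" and S: "good S" "S \<subseteq> T"
  shows "p \<sqsubseteq>\<^sub>e S \<longleftrightarrow> Split p \<subseteq> Split S"
proof
  assume "p \<sqsubseteq>\<^sub>e S" then show "Split p \<subseteq> Split S" using Split_mono unfolding end_ext_def by blast
next
  assume sub: "Split p \<subseteq> Split S"
  have p: "is_tree p" "finite p" "p \<subseteq> T" "is_tree T" using T unfolding end_ext_def by blast+
  have "t \<in> p \<Longrightarrow> t \<in> S" for t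
  proof (induction t rule: rev_induct)
    case Nil
    obtain x where "x \<in> S" using good_perfect(2)[OF S(1)] by blast
    then show ?case by (rule tree_prefix[OF good_perfect(3)[OF S(1)] _ Nil_prefix])
  next
    case (snoc b u)
    have "u \<in> S" using snoc tree_prefix[OF p(1) snoc.prems, of u] by simp
    then obtain c where c: "u @ [c] \<in> S" by (rule perfect_child[OF good_perfect(1)[OF S(1)]])
    show ?case
    proof (cases "c = b")
      case False
      have "u @ [c] \<in> p" using end_ext_sibling[OF T snoc.prems, of c] c S(2) by blast
      then have "u \<in> Split p" using snoc.prems False by (cases b; cases c) (auto intro!: SplitI[OF _ _ p(1)])
      then show ?thesis using sub Split_in(2) by blast
    qed (use c in simp)
  qed
  then have "p \<subseteq> S" by blast
  then show "p \<sqsubseteq>\<^sub>e S" using T S(2) good_perfect(3)[OF S(1)] unfolding end_ext_def by blast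
qed

lemma end_ext_of_lev:
  assumes p: "p \<sqsubseteq>\<^sub>e T" "\<And>t. t \<in> p \<Longrightarrow> length t < h"
    and S0: "good S0" "p \<sqsubseteq>\<^sub>e S0" and S: "good S" "S \<subseteq> T" "lev S h = lev S0 h"
  shows "p \<sqsubseteq>\<^sub>e S"
proof -
  have "Split p \<subseteq> Split S"
  proof
    fix u assume u: "u \<in> Split p"
    then have "u \<in> Split S0" using S0(2) Split_mono unfolding end_ext_def by blast
    then show "u \<in> Split S"
      using lev_eq_Split[OF good_perfect(1)[OF S0(1)] good_perfect(1)[OF S(1)] S(3), of u] p(2)[OF Split_in(1)[OF u]] by simp
  qed
  then show ?thesis using end_ext_iff_Split[OF p(1) S(1,2)] by simp
qed

text \<open>If all splitting nodes of \<open>T\<close> below a splitting node survive in \<open>S\<close>, then its address and hence its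
depth are the same in both trees.\<close>

lemma index_agree:
  assumes T: "good T" and S: "good S" "S \<subseteq> T"
  shows "sp T j \<in> Split S \<Longrightarrow> (\<And>u. u \<in> Split T \<Longrightarrow> strict_prefix u (sp T j) \<Longrightarrow> u \<in> Split S) \<Longrightarrow> sp S j = sp T j"
proof (induction j rule: less_induct)
  case (less j)
  have inT: "sp S j \<in> Split T" using sp_in_Split[OF S(1)] Split_mono[OF S(2)] by blast
  show ?case
  proof (rule nat_child_cases[of j])
    assume "j = 0"
    then show ?thesis
      using sp_root_least[OF T inT] sp_root_least[OF S(1) less.prems(1)] by (auto intro: prefix_order.antisym)
  next
    fix q b assume j: "j = 2 * q + 1 + of_bool b" "q < j"
    have pr: "prefix (sp T q @ [b]) (sp T j)" using sp_child[OF T, of q b] j(1) by simp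
    then have st: "strict_prefix (sp T q) (sp T j)" by (auto simp: strict_prefix_def prefix_def)
    have "sp S q = sp T q"
    proof (rule less.IH[OF j(2)])
      show "sp T q \<in> Split S" by (rule less.prems(2)[OF sp_in_Split[OF T] st])
      fix u assume "u \<in> Split T" "strict_prefix u (sp T q)"
      then show "u \<in> Split S" using less.prems(2)[of u] st prefix_order.less_trans by blast
    qed
    then have "prefix (sp S q @ [b]) (sp T j)" "prefix (sp T q @ [b]) (sp S j)"
      using pr sp_child[OF S(1), of q b] j(1) by simp_all
    then have "prefix (sp S j) (sp T j)" "prefix (sp T j) (sp S j)"
      using sp_child_least[OF T inT, of q b] sp_child_least[OF S(1) less.prems(1), of q b] unfolding j(1) by blast+
    then show ?thesis by (rule prefix_order.antisym)
  qed
qed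

text \<open>A count: the first \<open>M + 1\<close> splitting nodes of \<open>S\<close> are among those of \<open>T\<close> that are no longer than the
node of depth \<open>M\<close>, and there are only \<open>M + 1\<close> of these. This is how splitting nodes outside the core
become forced.\<close>

lemma kept_if_short:
  assumes T: "good T" and S: "good S" "S \<subseteq> T" and M: "sp S M = sp T M"
    and long: "\<And>j. M < j \<Longrightarrow> length (sp T M) < length (sp T j)" and j: "j \<le> M"
  shows "sp T j \<in> Split S"
proof -
  have "sp S ` {..M} \<subseteq> sp T ` {..M}"
  proof
    fix s assume "s \<in> sp S ` {..M}"
    then obtain i where i: "i \<le> M" "s = sp S i" by auto
    have "s \<in> Split T" using i(2) sp_in_Split[OF S(1)] Split_mono[OF S(2)] by blast
    then obtain l where l: "s = sp T l" using Split_spE[OF T] by blast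
    have "length s \<le> length (sp T M)" using sp_length_mono[OF S(1) i(1)] i(2) M by simp
    then have "l \<le> M" using long[of l] l by (metis leD leI)
    then show "s \<in> sp T ` {..M}" using l by simp
  qed
  moreover have "card (sp S ` {..M}) = card (sp T ` {..M})"
    using sp_eq_iff[OF S(1)] sp_eq_iff[OF T] by (simp add: card_image inj_on_def)
  ultimately have "sp S ` {..M} = sp T ` {..M}" by (intro card_subset_eq) simp_all
  moreover have "sp T j \<in> sp T ` {..M}" using j by simp
  ultimately have "sp T j \<in> sp S ` {..M}" by simp
  then show ?thesis using sp_in_Split[OF S(1)] by auto
qed

section \<open>The core of a condition\<close>

lemma decided_iff:
  "decided p0 T p \<longleftrightarrow> finite p \<and> is_tree p \<and> p0 \<sqsubseteq>\<^sub>e p \<and> (\<forall>S. S \<subseteq> T \<longrightarrow> good S \<longrightarrow> p0 \<sqsubseteq>\<^sub>e S \<longrightarrow> p \<sqsubseteq>\<^sub>e S)"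
proof -
  have "p \<sqsubset>\<^sub>e S \<longleftrightarrow> p \<sqsubseteq>\<^sub>e S" if "good S" for S
    using infinite_good[OF that] by (auto simp: strict_end_ext_def end_ext_def)
  then show ?thesis unfolding decided_def AS_iff by blast
qed

text \<open>The longest initial segment of \<open>t\<close> in the union is terminal there: a node of some \<open>p\<close> properly above it
would be properly above the terminal node of \<open>p\<close> that \<open>t\<close> extends.\<close>

lemma end_ext_Union:
  assumes C: "C \<noteq> {}" "finite (\<Union>C)" "\<And>p. p \<in> C \<Longrightarrow> p \<sqsubseteq>\<^sub>e S"
  shows "\<Union>C \<sqsubseteq>\<^sub>e S"
proof -
  have ct: "is_tree p" "p \<subseteq> S" if "p \<in> C" for p using C(3)[OF that] unfolding end_ext_def by blast+
  obtain p1 where p1: "p1 \<in> C" using C(1) by blast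
  have tS: "is_tree S" using C(3)[OF p1] unfolding end_ext_def by blast
  have tU: "is_tree (\<Union>C)" using ct(1) unfolding is_tree_def by blast
  have "\<exists>s\<in>Term (\<Union>C). prefix s t" if t: "t \<in> S - \<Union>C" for t
  proof -
    let ?P = "\<lambda>s. prefix s t \<and> s \<in> \<Union>C"
    have "t \<in> S - p1" using t p1 by blast
    then obtain s1 where "s1 \<in> Term p1" "prefix s1 t" using C(3)[OF p1] unfolding end_ext_def by blast
    then have "?P s1" using p1 unfolding Term_def by blast
    moreover have "\<forall>s. ?P s \<longrightarrow> length s < Suc (length t)" by (auto dest: prefix_length_le)
    ultimately obtain u where u: "?P u" "\<forall>s. ?P s \<longrightarrow> length s \<le> length u"
      using ex_has_greatest_nat[of ?P s1 length "Suc (length t)"] by blast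
    have "\<not> strict_prefix u v" if v: "v \<in> \<Union>C" for v
    proof
      assume uv: "strict_prefix u v"
      obtain p where p: "p \<in> C" "v \<in> p" using v by blast
      have "t \<in> S - p" using t p(1) by blast
      then obtain s where s: "s \<in> Term p" "prefix s t" using C(3)[OF p(1)] unfolding end_ext_def by blast
      then have "s \<in> \<Union>C" using p(1) unfolding Term_def by blast
      then have "length s \<le> length u" using u(2) s(2) by blast
      then have "prefix s u" using prefix_length_prefix[OF s(2)] u(1) by blast
      then have "strict_prefix s v" using uv prefix_order.le_less_trans by blast
      then show False using s(1) p(2) unfolding Term_def by blast
    qed
    then have "u \<in> Term (\<Union>C)" using u(1) unfolding Term_def by blast
    then show ?thesis using u(1) by blast
  qed
  then show ?thesis using C(2) tU tS ct(2) unfolding end_ext_def by blast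
qed

text \<open>Removing the cone above a successor of a late splitting node leaves a perfect tree in which all
earlier nodes still split.\<close>

lemma avoid_cone:
  assumes T: "good T" and keep: "m \<le> j"
  shows "\<exists>S. good S \<and> S \<subseteq> T \<and> (\<forall>i<m. sp S i = sp T i) \<and> (\<forall>t\<in>S. \<not> prefix (sp T j @ [b]) t)"
proof -
  note tT = good_perfect(3)[OF T]
  let ?x = "sp T j @ [b]"
  let ?T0 = "{t \<in> T. \<not> prefix ?x t}"
  have t0: "is_tree ?T0"
    unfolding is_tree_def using tree_prefix[OF tT] prefix_order.trans by blast
  have "\<exists>s\<in>Split ?T0. prefix t s" if t: "t \<in> ?T0" for t
  proof -
    \<comment> \<open>Leave the path to the forbidden cone at the last moment if \<open>t\<close> lies on it.\<close>
    define y where "y = (if prefix t (sp T j) then sp T j @ [\<not> b] else t)"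
    have yT: "y \<in> T" unfolding y_def using t Split_in(2)[OF sp_in_Split[OF T]] by simp
    have ty: "prefix t y" unfolding y_def by simp
    have inc: "\<not> prefix ?x y \<and> \<not> prefix y ?x"
      using t unfolding y_def by (auto simp: prefix_snoc)
    have av: "\<not> prefix ?x s" if "prefix y s" for s
      using inc prefix_same_cases[OF that] by blast
    obtain s where s: "s \<in> Split T" "prefix y s"
      using good_perfect(1)[OF T] yT unfolding perfect_tree_def by blast
    have "s @ [c] \<in> ?T0" for c using Split_in(2)[OF s(1)] av[of "s @ [c]"] s(2) by simp
    then have "s \<in> Split ?T0" by (intro SplitI[OF _ _ t0])
    then show ?thesis using ty s(2) prefix_order.trans by blast
  qed
  then have p0: "perfect_tree ?T0" using t0 unfolding perfect_tree_def by blast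
  have keep: "sp T i \<in> Split ?T0" if "i < m" for i
  proof -
    have "\<not> prefix ?x (sp T i @ [c])" for c
    proof
      assume p: "prefix ?x (sp T i @ [c])"
      have "length (sp T i) \<le> length (sp T j)" using sp_length_mono[OF T] that keep by simp
      moreover obtain zs where zs: "sp T i @ [c] = ?x @ zs" using p by (rule prefixE)
      moreover from arg_cong[OF zs, of length] have "length (sp T i) = length (sp T j) + length zs" by simp
      ultimately have "zs = []" by simp
      then have "sp T j = sp T i" using zs by simp
      then have "j = i" using sp_eq_iff[OF T] by simp
      then show False using that keep by simp
    qed
    then have "sp T i @ [c] \<in> ?T0" for c
      using Split_in(2)[OF sp_in_Split[OF T]] by blast
    then show ?thesis by (intro SplitI[OF _ _ t0])
  qed
  have "[] \<in> ?T0"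
  proof -
    obtain t where "t \<in> T" using good_perfect(2)[OF T] by blast
    then have "[] \<in> T" by (rule tree_prefix[OF tT _ Nil_prefix])
    then show ?thesis by simp
  qed
  then have ne: "?T0 \<noteq> {}" by blast
  obtain S where "good S" "S \<subseteq> ?T0" "\<And>i. i < m \<Longrightarrow> sp S i = sp T i"
    using thin[OF T p0 _ ne keep] by (metis (no_types, lifting) mem_Collect_eq subsetI)
  then show ?thesis by blast
qed

lemma finite_Split_index:
  assumes "good T" "finite P" "P \<subseteq> Split T"
  obtains m where "\<And>j. sp T j \<in> P \<Longrightarrow> j < m"
proof -
  have "finite {j. sp T j \<in> P}"
    by (rule finite_subset[OF _ finite_imageI[OF assms(2), of "\<lambda>s. depth s T"]]) (force simp: depth_sp[OF assms(1)] image_iff)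
  then obtain m where "\<forall>j\<in>{j. sp T j \<in> P}. j < m" using finite_nat_set_iff_bounded by blast
  then show thesis using that by blast
qed

text \<open>A decided tree contains no successor of a splitting node of depth at least \<open>m\<close>, where \<open>m\<close> exceeds the
depths of the splitting nodes of \<open>p0\<close>, because its cone can be avoided. By the heap order, nodes
of \<open>T\<close> longer than the splitting node of depth \<open>2 * m\<close> do extend such a successor.\<close>

lemma decided_bounded:
  assumes T: "good T" and p0: "p0 \<sqsubseteq>\<^sub>e T"
  shows "finite (\<Union>{p. decided p0 T p})"
proof -
  have fin: "finite (Split p0)" by (rule finite_subset[of _ p0]) (use p0 in \<open>auto simp: Split_def end_ext_def\<close>)
  have sub: "Split p0 \<subseteq> Split T" using p0 Split_mono unfolding end_ext_def by blast
  obtain m where m: "\<And>j. sp T j \<in> Split p0 \<Longrightarrow> j < m" using finite_Split_index[OF T fin sub] by blast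
  have no: "\<not> prefix (sp T j @ [b]) v" if v: "decided p0 T p" "v \<in> p" and j: "m \<le> j" for p v j b
  proof -
    obtain S where S: "good S" "S \<subseteq> T" "\<forall>i<m. sp S i = sp T i" "\<forall>t\<in>S. \<not> prefix (sp T j @ [b]) t"
      using avoid_cone[OF T j, of b] by blast
    have "Split p0 \<subseteq> Split S"
    proof
      fix u assume u: "u \<in> Split p0"
      then obtain i where i: "u = sp T i" using Split_spE[OF T] sub by blast
      then have "u = sp S i" using S(3) m u by simp
      then show "u \<in> Split S" using sp_in_Split[OF S(1)] by simp
    qed
    then have "p0 \<sqsubseteq>\<^sub>e S" using end_ext_iff_Split[OF p0 S(1,2)] by simp
    then have "p \<sqsubseteq>\<^sub>e S" using v(1) S(1,2) unfolding decided_iff by blast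
    then show ?thesis using S(4) v(2) unfolding end_ext_def by blast
  qed
  \<comment> \<open>Walking from \<open>k\<close> to its parents meets the positions from \<open>m\<close> to \<open>2 * m\<close>.\<close>
  have range: "\<exists>j. m \<le> j \<and> j \<le> 2 * m \<and> prefix (sp T j) (sp T k)" if "m \<le> k" for k
    using that
  proof (induction k rule: less_induct)
    case (less k)
    show ?case
    proof (cases "k \<le> 2 * m")
      case True then show ?thesis using less.prems by (intro exI[of _ k]) simp
    next
      case False
      show ?thesis
      proof (rule nat_child_cases[of k])
        fix q b assume q: "k = 2 * q + 1 + of_bool b" "q < k"
        then have "m \<le> q" using False by (cases b) simp_all
        then obtain j where j: "m \<le> j" "j \<le> 2 * m" "prefix (sp T j) (sp T q)" using less.IH[OF q(2)] by blast
        have "prefix (sp T q) (sp T k)" using append_prefixD[OF sp_child[OF T, of q b]] q(1) by simp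
        then show ?thesis using j prefix_order.trans by blast
      qed (use False in simp)
    qed
  qed
  have "\<Union>{p. decided p0 T p} \<subseteq> trunc T (length (sp T (2 * m)))"
  proof
    fix v assume "v \<in> \<Union>{p. decided p0 T p}"
    then obtain p where v: "decided p0 T p" "v \<in> p" by blast
    have "p \<sqsubseteq>\<^sub>e T" using v(1) T p0 unfolding decided_iff by blast
    then have vT: "v \<in> T" using v(2) unfolding end_ext_def by blast
    obtain k where k: "prefix v (sp T k)" using sp_cover[OF T vT] by blast
    have "length v \<le> length (sp T (2 * m))"
    proof (cases "m \<le> k")
      case False
      then have "length (sp T k) \<le> length (sp T (2 * m))" by (intro sp_length_mono[OF T]) simp
      then show ?thesis using prefix_length_le[OF k] by simp
    next
      case True
      then obtain j where j: "m \<le> j" "j \<le> 2 * m" "prefix (sp T j) (sp T k)" using range by blast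
      have "prefix v (sp T j)"
      proof (rule ccontr)
        assume n: "\<not> prefix v (sp T j)"
        then have "prefix (sp T j) v" using prefix_same_cases[OF k j(3)] by blast
        then obtain \<rho> where \<rho>: "v = sp T j @ \<rho>" by (rule prefixE)
        then obtain b \<rho>' where "\<rho> = b # \<rho>'" using n by (cases \<rho>) simp_all
        then have "prefix (sp T j @ [b]) v" using \<rho> by simp
        then show False using no[OF v j(1)] by blast
      qed
      then show ?thesis using prefix_length_le sp_length_mono[OF T j(2)] by (meson le_trans)
    qed
    then show "v \<in> trunc T (length (sp T (2 * m)))" using vT by (simp add: trunc_def)
  qed
  then show ?thesis using finite_trunc by (rule finite_subset)
qed

text \<open>The decided trees have a largest element, their union, which is therefore the only maximal one.\<close>

lemma decided_core:
  assumes T: "good T" and p0: "p0 \<sqsubseteq>\<^sub>e T"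
  shows "decided p0 T (core p0 T)"
proof -
  let ?C = "{p. decided p0 T p}"
  have "decided p0 T p0" using p0 end_ext_refl unfolding decided_iff end_ext_def by blast
  then have ne: "?C \<noteq> {}" "p0 \<in> ?C" by blast+
  note fin = decided_bounded[OF T p0]
  have ext: "\<Union>?C \<sqsubseteq>\<^sub>e S" if "S \<subseteq> T" "good S" "p0 \<sqsubseteq>\<^sub>e S" for S
    by (rule end_ext_Union[OF ne(1) fin]) (use that decided_iff in blast)
  have qT: "\<Union>?C \<sqsubseteq>\<^sub>e T" by (rule ext[OF order_refl T p0])
  then have tq: "is_tree (\<Union>?C)" and qsub: "\<Union>?C \<subseteq> T" unfolding end_ext_def by blast+
  have below: "p \<sqsubseteq>\<^sub>e \<Union>?C" if "decided p0 T p" for p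
    by (rule end_ext_between[OF _ tq _ qsub, of p]) (use that T p0 in \<open>auto simp: decided_iff\<close>)
  have dq: "decided p0 T (\<Union>?C)"
    unfolding decided_iff[of p0 T "\<Union>?C"]
    by (intro conjI allI impI fin tq below[OF \<open>decided p0 T p0\<close>] ext)
  have "core p0 T = \<Union>?C"
    unfolding core_def
  proof (rule the_equality)
    show "decided p0 T (\<Union>?C) \<and> (\<forall>q. decided p0 T q \<and> \<Union>?C \<sqsubseteq>\<^sub>e q \<longrightarrow> q = \<Union>?C)"
    proof (intro conjI dq allI impI)
      fix q assume q: "decided p0 T q \<and> \<Union>?C \<sqsubseteq>\<^sub>e q"
      then have "q \<subseteq> \<Union>?C" by (intro Union_upper) simp
      moreover have "\<Union>?C \<subseteq> q" using q by (simp add: end_ext_def)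
      ultimately show "q = \<Union>?C" by (rule subset_antisym)
    qed
    fix p assume p: "decided p0 T p \<and> (\<forall>q. decided p0 T q \<and> p \<sqsubseteq>\<^sub>e q \<longrightarrow> q = p)"
    have "p \<sqsubseteq>\<^sub>e \<Union>?C" using p by (intro below) simp
    then have "\<Union>?C = p" using p[THEN conjunct2, THEN spec, of "\<Union>?C"] dq by simp
    then show "p = \<Union>?C" by (rule sym)
  qed
  then show ?thesis using dq by simp
qed

text \<open>The depth of a splitting node counts splitting nodes other than itself.\<close>

lemma max_depth_bound:
  assumes "finite p"
  shows "max_depth p + 1 \<le> int (card (Split p))"
proof (cases "Split p = {}")
  case True then show ?thesis by (simp add: max_depth_def)
next
  case False
  have fin: "finite (Split p)" by (rule finite_subset[OF _ assms]) (auto simp: Split_def)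
  let ?K = "{k. \<exists>t\<in>Split p. depth t p = k}"
  have "?K = (\<lambda>t. depth t p) ` Split p" by blast
  then have "finite ?K" "?K \<noteq> {}" using fin False by simp_all
  then have "Max ?K \<in> ?K" by (rule Max_in)
  then obtain t where t: "t \<in> Split p" "depth t p = Max ?K" by blast
  have "depth t p < card (Split p)"
    unfolding depth_def by (rule psubset_card_mono[OF fin]) (use t(1) in blast)
  then show ?thesis using False t(2) by (simp add: max_depth_def)
qed

section \<open>Counting the possible values\<close>

text \<open>If no \<open>E k\<close> is dense below a stronger condition, then one can pass to stronger conditions that avoid
one \<open>E k\<close> after the other, and finally their union.\<close>

lemma some_color:
  assumes "finite A"
  shows "c \<in> AS \<Longrightarrow> dense_below AS AS_le (\<Union>k\<in>A. E k) c \<Longrightarrow>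
    \<exists>c' k. c' \<in> AS \<and> AS_le c' c \<and> k \<in> A \<and> dense_below AS AS_le (E k) c'"
  using assms
proof (induction A arbitrary: c)
  case empty
  have "AS_le c c" using AS_le_refl empty.prems(1) by (cases c) simp
  then show ?case using empty.prems unfolding dense_below_def by blast
next
  case (insert k A)
  show ?case
  proof (cases "dense_below AS AS_le (E k) c")
    case True
    have "AS_le c c" using AS_le_refl insert.prems(1) by (cases c) simp
    then show ?thesis using True insert.prems(1) by blast
  next
    case False
    then obtain q where q: "q \<in> AS" "AS_le q c" "\<And>r. r \<in> E k \<Longrightarrow> r \<in> AS \<Longrightarrow> \<not> AS_le r q"
      unfolding dense_below_def by blast
    have "dense_below AS AS_le (\<Union>k\<in>A. E k) q"
      unfolding dense_below_def
    proof (intro ballI impI)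
      fix q' assume q': "q' \<in> AS" "AS_le q' q"
      then obtain r where r: "r \<in> (\<Union>k\<in>insert k A. E k)" "r \<in> AS" "AS_le r q'"
        using insert.prems(2) AS_le_trans[OF q'(2) q(2)] unfolding dense_below_def by blast
      have "r \<notin> E k" using q(3)[OF _ r(2)] AS_le_trans[OF r(3) q'(2)] by blast
      then show "\<exists>r\<in>\<Union>k\<in>A. E k. r \<in> AS \<and> AS_le r q'" using r by blast
    qed
    then obtain c' k' where c': "c' \<in> AS" "AS_le c' q" "k' \<in> A" "dense_below AS AS_le (E k') c'"
      using insert.IH[OF q(1)] by blast
    then show ?thesis using AS_le_trans[OF c'(2) q(2)] by blast
  qed
qed

lemma dense_below_decides:
  assumes "dense_below AS AS_le E (q, S)" "(q, S) \<in> AS"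
  shows "\<exists>h'\<ge>h. decides E h' S"
proof -
  have fin: "finite q" using assms(2) by (simp add: AS_iff end_ext_def)
  define h2 where "h2 = h + (\<Sum>t\<in>q. length t)"
  have "length t \<le> h2" if "t \<in> q" for t
    using member_le_sum[OF that _ fin, of length] by (simp add: h2_def)
  then have "AS_le (trunc S h2, S) (q, S)" by (intro AS_le_trunc_same assms(2))
  then have "decides E h2 S" unfolding decides_def by (rule dense_below_mono[OF assms(1)])
  then show ?thesis by (intro exI[of _ h2]) (simp add: h2_def)
qed

text \<open>Density, the hypothesis of pure decision, holds because below every condition some value is forced.\<close>

lemma decide_one_option:
  fixes E :: "'k \<Rightarrow> cond set"
  assumes c: "(p0, T) \<in> AS" "dense_below AS AS_le (\<Union>k\<in>A. E k) (p0, T)" and A: "finite A"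
    and h: "\<And>t. t \<in> p0 \<Longrightarrow> length t < h"
    and S: "good S" "S \<subseteq> T" "p0 \<sqsubseteq>\<^sub>e S"
  shows "\<exists>S' k. good S' \<and> S' \<subseteq> S \<and> lev S' h = lev S h \<and> k \<in> A \<and> decides (E k) h S'"
proof -
  have p0T: "p0 \<sqsubseteq>\<^sub>e T" using c(1) by (simp add: AS_iff)
  have "\<exists>S' k. admissible S h (lev S h) S' \<and> k \<in> A \<and> decides (E k) h S'"
  proof (rule pure_decision[OF S(1) A])
    fix R assume "admissible S h (lev S h) R"
    then have R: "good R" "R \<subseteq> S" "lev R h = lev S h" by (simp_all add: admissible_def)
    have RT: "R \<subseteq> T" using R(2) S(2) by blast
    have "p0 \<sqsubseteq>\<^sub>e R" by (rule end_ext_of_lev[OF p0T h S(1,3) R(1) RT R(3)])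
    then have pR: "(p0, R) \<in> AS" using R(1) by (simp add: AS_iff)
    have "AS_le (p0, R) (p0, T)" using pR c(1) RT p0T end_ext_refl unfolding AS_le_def end_ext_def by simp
    moreover have "AS_le (trunc R h, R) (p0, R)" by (rule AS_le_trunc_same[OF pR]) (use h in \<open>auto intro: less_imp_le\<close>)
    ultimately have "AS_le (trunc R h, R) (p0, T)" using AS_le_trans by blast
    then have "dense_below AS AS_le (\<Union>k\<in>A. E k) (trunc R h, R)" by (rule dense_below_mono[OF c(2)])
    then obtain c' k where c': "c' \<in> AS" "AS_le c' (trunc R h, R)" "k \<in> A" "dense_below AS AS_le (E k) c'"
      using some_color[OF A trunc_AS[OF R(1)], of E] by blast
    obtain q S' where qS: "c' = (q, S')" by (cases c')
    note S' = AS_le_truncD[OF c'(2)[unfolded qS]]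
    obtain h' where "h \<le> h'" "decides (E k) h' S'"
      using dense_below_decides[of "E k" q S' h] c'(1,4) qS by blast
    then show "\<exists>S' h' k. admissible R h (lev S h) S' \<and> h \<le> h' \<and> k \<in> A \<and> decides (E k) h' S'"
      using S' R c'(3) unfolding admissible_def by blast
  qed
  then show ?thesis unfolding admissible_def by blast
qed

text \<open>Let \<open>J\<close> be the set of depths of splitting nodes of the core, \<open>m\<close> the least strict upper bound of \<open>J\<close>, and
\<open>K\<close> the number of nodes prescribed by \<open>\<le>\<^sub>n\<close>. Keep the first \<open>\<kappa> = max K m\<close> splitting nodes and make
all others longer than \<open>H\<close>. Let \<open>Z\<close> be the set of depths of kept nodes that some good subtree through \<open>p0\<close>
drops; it is disjoint from \<open>J\<close>. If \<open>K > m\<close>, then \<open>J\<close> consists of numbers below \<open>K\<close>, and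
\<open>K \<le> n + card J\<close> bounds the size of \<open>Z\<close> by \<open>n\<close>. If \<open>K \<le> m\<close>, then the last splitting node of the core
keeps its depth, and by counting all earlier nodes are forced, so \<open>Z\<close> is empty.\<close>

lemma forces_few_values:
  fixes E :: "'k \<Rightarrow> cond set"
  assumes c: "(p0, T) \<in> AS" "dense_below AS AS_le (\<Union>k\<in>A. E k) (p0, T)" and A: "finite A"
  shows "\<exists>T' B. AS_le_n n (p0, T') (p0, T) \<and> B \<subseteq> A \<and> card B \<le> 4 ^ n \<and>
    dense_below AS AS_le (\<Union>k\<in>B. E k) (p0, T')"
proof -
  have T: "good T" and p0T: "p0 \<sqsubseteq>\<^sub>e T" using c(1) by (simp_all add: AS_iff)
  define p where "p = core p0 T"
  have dp: "decided p0 T p" unfolding p_def by (rule decided_core[OF T p0T])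
  have finp: "finite p" and p0p: "p0 \<sqsubseteq>\<^sub>e p" and pS: "\<And>S. S \<subseteq> T \<Longrightarrow> good S \<Longrightarrow> p0 \<sqsubseteq>\<^sub>e S \<Longrightarrow> p \<sqsubseteq>\<^sub>e S"
    using dp unfolding decided_iff by blast+
  have pT: "p \<sqsubseteq>\<^sub>e T" by (rule pS[OF order_refl T p0T])
  have finSp: "finite (Split p)" by (rule finite_subset[OF _ finp]) (auto simp: Split_def)
  have SpT: "Split p \<subseteq> Split T" using pT Split_mono unfolding end_ext_def by blast
  have Sp0: "Split p0 \<subseteq> Split p" using p0p Split_mono unfolding end_ext_def by blast
  define J where "J = {j. sp T j \<in> Split p}"
  have Jimg: "sp T ` J = Split p" unfolding J_def using Split_eq_range_sp[OF T] SpT by auto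
  have injT: "inj_on (sp T) X" for X using sp_eq_iff[OF T] by (simp add: inj_on_def)
  have finJ: "finite J" using Jimg finSp finite_imageD[OF _ injT] by metis
  have cardJ: "card J = card (Split p)" using card_image[OF injT, of J] Jimg by simp
  define m where "m = (if J = {} then 0 else Suc (Max J))"
  have Jm: "j < m" if "j \<in> J" for j
    using Max_ge[OF finJ that] that by (auto simp: m_def)
  define N where "N = max_depth p"
  define K where "K = nat (int n + N + 1)"
  have KJ: "K \<le> n + card J"
    using max_depth_bound[OF finp] cardJ by (simp add: K_def N_def)
  define \<kappa> where "\<kappa> = max K m"
  have finp0: "finite p0" using p0T unfolding end_ext_def by blast
  define H where "H = (\<Sum>t\<in>p0. length t) + (\<Sum>j<\<kappa>. length (sp T j))"
  have Hp0: "length t < Suc H" if "t \<in> p0" for t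
    using member_le_sum[OF that _ finp0, of length] by (simp add: H_def)
  have HT: "length (sp T j) < Suc H" if "j < \<kappa>" for j
    using member_le_sum[of j "{..<\<kappa>}" "\<lambda>j. length (sp T j)"] that by (simp add: H_def)
  obtain T1 where T1: "good T1" "T1 \<subseteq> T" "\<And>j. j < \<kappa> \<Longrightarrow> sp T1 j = sp T j" "\<And>j. \<kappa> \<le> j \<Longrightarrow> H < length (sp T1 j)"
    using thin[OF T good_perfect(1)[OF T] order_refl good_perfect(2)[OF T] sp_in_Split[OF T], of \<kappa> H] by metis
  have SpT1: "Split p \<subseteq> Split T1"
  proof
    fix u assume "u \<in> Split p"
    then obtain j where j: "j \<in> J" "u = sp T j" using Jimg by blast
    then have "u = sp T1 j" using T1(3)[of j] Jm[of j] by (simp add: \<kappa>_def)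
    then show "u \<in> Split T1" using sp_in_Split[OF T1(1)] by simp
  qed
  have p0T1: "p0 \<sqsubseteq>\<^sub>e T1" using end_ext_iff_Split[OF p0T T1(1,2)] Sp0 SpT1 by blast
  define h where "h = Suc H"
  define cls where "cls S \<longleftrightarrow> good S \<and> S \<subseteq> T1 \<and> p0 \<sqsubseteq>\<^sub>e S" for S
  have clsD: "good S" "S \<subseteq> T1" "S \<subseteq> T" "p0 \<sqsubseteq>\<^sub>e S" "p \<sqsubseteq>\<^sub>e S" if "cls S" for S
    using that T1(2) pS unfolding cls_def by blast+
  have cls_lev: "cls S" if "cls S0" "good S" "S \<subseteq> T1" "lev S h = lev S0 h" for S S0
    unfolding cls_def
  proof (intro conjI that(2,3))
    show "p0 \<sqsubseteq>\<^sub>e S"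
      by (rule end_ext_of_lev[OF p0T _ clsD(1,4)[OF that(1)] that(2) _ that(4)])
        (use Hp0 h_def that(3) T1(2) in auto)
  qed
  define Z where "Z = {j. j < \<kappa> \<and> (\<exists>S. cls S \<and> sp T j \<notin> Split S)}"
  have finZ: "finite Z" unfolding Z_def by simp
  have ZJ: "Z \<inter> J = {}"
  proof -
    have "sp T j \<in> Split S" if "j \<in> J" "cls S" for j S
      using that(1) clsD(5)[OF that(2)] Split_mono unfolding J_def end_ext_def by blast
    then show ?thesis unfolding Z_def by blast
  qed
  have cardZ: "card Z \<le> n"
  proof (cases "m < K")
    case True
    then have \<kappa>: "\<kappa> = K" by (simp add: \<kappa>_def)
    have JK: "J \<subseteq> {..<K}" using Jm True by fastforce
    have "Z \<subseteq> {..<K} - J" using ZJ \<kappa> unfolding Z_def by blast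
    then have "card Z \<le> card ({..<K} - J)" by (rule card_mono[rotated]) simp
    also have "\<dots> = K - card J" using JK finJ by (simp add: card_Diff_subset)
    finally show ?thesis using KJ by simp
  next
    case False
    then have \<kappa>: "\<kappa> = m" by (simp add: \<kappa>_def)
    have "Z = {}"
    proof (rule ccontr)
      assume "Z \<noteq> {}"
      then obtain j S where j: "j < m" "cls S" "sp T j \<notin> Split S" unfolding Z_def \<kappa> by blast
      then have "J \<noteq> {}" by (auto simp: m_def)
      define M where "M = Max J"
      have m': "m = Suc M" using \<open>J \<noteq> {}\<close> by (simp add: m_def M_def)
      have MJ: "M \<in> J" unfolding M_def by (rule Max_in[OF finJ \<open>J \<noteq> {}\<close>])
      have eq: "sp T1 i = sp T i" if "i \<le> M" for i using T1(3) that \<kappa> m' by simp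
      have tp: "sp T M \<in> Split p" using MJ by (simp add: J_def)
      note S = clsD[OF j(2)]
      have SpS: "Split p \<subseteq> Split S" using S(5) Split_mono unfolding end_ext_def by blast
      have "sp S M = sp T1 M"
      proof (rule index_agree[OF T1(1) S(1,2)])
        show "sp T1 M \<in> Split S" using tp SpS eq[of M] by auto
        fix u assume u: "u \<in> Split T1" "strict_prefix u (sp T1 M)"
        have uT: "u @ [b] \<in> T" for b using Split_in(2)[OF u(1)] T1(2) by blast
        obtain b \<rho> where "sp T M = u @ b # \<rho>" using u(2) eq[of M] by (auto elim: strict_prefixE')
        then have "prefix (u @ [b]) (sp T M)" by simp
        moreover have tp': "is_tree p" using p0p unfolding end_ext_def by blast
        ultimately have "u @ [b] \<in> p" using tree_prefix[OF _ Split_in(1)[OF tp]] by blast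
        then have "u @ [c] \<in> p" for c using end_ext_sibling[OF pT _ uT] by blast
        then have "u \<in> Split p" by (intro SplitI[OF _ _ tp'])
        then show "u \<in> Split S" using SpS by blast
      qed
      then have "sp T1 j \<in> Split S"
      proof (rule kept_if_short[OF T1(1) S(1,2)])
        fix i assume "M < i"
        then have "H < length (sp T1 i)" using T1(4)[of i] \<kappa> m' by simp
        moreover have "length (sp T1 M) < Suc H" using HT[of M] eq[of M] \<kappa> m' by simp
        ultimately show "length (sp T1 M) < length (sp T1 i)" by simp
      next
        show "j \<le> M" using j(1) m' by simp
      qed
      then show False using j(3) eq[of j] j(1) m' by simp
    qed
    then show ?thesis by simp
  qed
  \<comment> \<open>The successors of unforced nodes, at most \<open>2 * n\<close> of them.\<close>
  define W where "W = (\<lambda>(j, b). sp T j @ [b]) ` (Z \<times> (UNIV :: bool set))"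
  have finW: "finite W" unfolding W_def using finZ by simp
  have cardW: "card W \<le> 2 * n"
  proof -
    have "card W \<le> card (Z \<times> (UNIV :: bool set))" unfolding W_def by (rule card_image_le) (use finZ in simp)
    then show ?thesis using cardZ by (simp add: card_cartesian_product)
  qed
  define Xs where "Xs = {lev S h | S. cls S}"
  have determined: "lev S h \<subseteq> lev S' h" if S: "cls S" "cls S'" "S \<inter> W = S' \<inter> W" for S S'
  proof -
    note C = clsD[OF S(1)] and C' = clsD[OF S(2)]
    have "t \<in> S'" if "t \<in> S" "length t \<le> h" for t
    proof (rule level_transfer[OF good_perfect(3)[OF T1(1)] good_perfect(3)[OF C(1)] C(2)
          good_perfect(1)[OF C'(1)] C'(2) good_perfect(2)[OF C'(1)] _ that])
      fix u b assume u: "u \<in> Split T1" "length u < h" "u @ [b] \<in> S"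
      obtain j where j: "u = sp T1 j" using Split_spE[OF T1(1) u(1)] by blast
      then have jk: "j < \<kappa>" using T1(4)[of j] u(2) by (auto simp: h_def not_less[symmetric])
      then have uj: "u = sp T j" using j T1(3) by simp
      show "u @ [b] \<in> S'"
      proof (cases "j \<in> Z")
        case True
        then have "u @ [b] \<in> W" unfolding W_def uj by force
        then show ?thesis using u(3) S(3) by blast
      next
        case False
        then have "u \<in> Split S'" using jk S(2) uj unfolding Z_def by blast
        then show ?thesis by (rule Split_in(2))
      qed
    qed
    then show ?thesis by (auto simp: lev_def)
  qed
  have cardX: "card Xs \<le> 4 ^ n" and finX: "finite Xs"
  proof -
    \<comment> \<open>The level as a function of the trace on \<open>W\<close>, by choosing any subtree with that trace.\<close>
    define \<psi> where "\<psi> Q = lev (SOME S. cls S \<and> S \<inter> W = Q) h" for Q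
    have "Xs \<subseteq> \<psi> ` Pow W"
    proof
      fix X assume "X \<in> Xs"
      then obtain S where S: "cls S" "X = lev S h" unfolding Xs_def by blast
      define S' where "S' = (SOME S'. cls S' \<and> S' \<inter> W = S \<inter> W)"
      have "cls S \<and> S \<inter> W = S \<inter> W" using S(1) by simp
      then have S': "cls S' \<and> S' \<inter> W = S \<inter> W" unfolding S'_def by (rule someI)
      then have "X = lev S' h" using determined[of S S'] determined[of S' S] S by auto
      then have "X = \<psi> (S \<inter> W)" by (simp add: \<psi>_def S'_def)
      then show "X \<in> \<psi> ` Pow W" by blast
    qed
    moreover have finP: "finite (Pow W)" using finW by simp
    ultimately show "finite Xs" by (meson finite_imageI finite_subset)
    have "card Xs \<le> card (Pow W)" using \<open>Xs \<subseteq> \<psi> ` Pow W\<close> by (rule surj_card_le[OF finP])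
    also have "\<dots> \<le> 2 ^ (2 * n)" unfolding card_Pow[OF finW] by (rule power_increasing[OF cardW]) simp
    finally show "card Xs \<le> 4 ^ n" by (simp add: power_mult)
  qed
  have ADp: "A \<noteq> {}"
    using c AS_le_refl[OF c(1)] unfolding dense_below_def by blast
  define \<Phi> where "\<Phi> X S \<longleftrightarrow> (\<exists>k\<in>A. accepts E S X k)" for X S
  have "\<exists>T'. good T' \<and> T' \<subseteq> T1 \<and> lev T' h = lev T1 h \<and> (\<forall>X\<in>Xs. \<Phi> X T')"
  proof (rule iterate_requirements[OF finX T1(1)])
    show "\<Phi> X T''" if X: "\<Phi> X T'" "T'' \<subseteq> T'" for X T' T''
    proof -
      obtain k where "k \<in> A" "accepts E T' X k" using X(1) unfolding \<Phi>_def by blast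
      then show ?thesis unfolding \<Phi>_def using accepts_subset[of E T' X k T''] X(2) by blast
    qed
    fix X T' assume X: "X \<in> Xs" and T': "good T'" "T' \<subseteq> T1"
    obtain S0 where S0: "cls S0" "X = lev S0 h" using X unfolding Xs_def by blast
    show "\<exists>T''. good T'' \<and> T'' \<subseteq> T' \<and> lev T'' h = lev T' h \<and> \<Phi> X T''"
    proof (cases "\<exists>S. good S \<and> S \<subseteq> T' \<and> lev S h = X")
      case True
      then obtain S where S: "good S" "S \<subseteq> T'" "lev S h = X" by blast
      have "cls S" by (rule cls_lev[OF S0(1) S(1)]) (use S T' S0 in auto)
      note CS = clsD[OF this]
      obtain S' k where S': "good S'" "S' \<subseteq> S" "lev S' h = lev S h" "k \<in> A" "decides (E k) h S'"
        using decide_one_option[OF c A _ CS(1,3,4), of h] Hp0 h_def by blast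
      have "S' \<subseteq> T'" using S'(2) S(2) by blast
      then obtain T'' where T'': "good T''" "T'' \<subseteq> T'" "lev T'' h = lev T' h" "accepts E T'' (lev S' h) k"
        using accept_by_graft[of T' S' E k h, OF T'(1) S'(1) _ S'(5)] by blast
      have "\<Phi> X T''" unfolding \<Phi>_def using T''(4) S'(3,4) S(3) by auto
      then show ?thesis using T''(1-3) by blast
    next
      \<comment> \<open>This option has been lost while thinning for others, so any value will do.\<close>
      case False
      obtain k where k: "k \<in> A" using ADp by blast
      have "accepts E T' X k"
      proof (rule acceptsI)
        fix S h' assume S: "good S" "S \<subseteq> T'" "lev S h' = X"
        have "h' = h" using lev_height_unique[OF S(1)] S(3) S0(2) by blast
        then show "decides (E k) h' S" using False S by blast
      qed
      then show ?thesis using T'(1) k unfolding \<Phi>_def by blast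
    qed
  qed
  then obtain T' where T': "good T'" "T' \<subseteq> T1" "lev T' h = lev T1 h" "\<forall>X\<in>Xs. \<Phi> X T'" by (elim exE conjE)
  then have "\<forall>X\<in>Xs. \<exists>k. k \<in> A \<and> accepts E T' X k" unfolding \<Phi>_def by blast
  then obtain \<chi> where \<chi>: "\<forall>X\<in>Xs. \<chi> X \<in> A \<and> accepts E T' X (\<chi> X)" by (rule bchoice[THEN exE])
  define B where "B = \<chi> ` Xs"
  have BA: "B \<subseteq> A" unfolding B_def using \<chi> by blast
  have cardB: "card B \<le> 4 ^ n" unfolding B_def using card_image_le[OF finX, of \<chi>] cardX by simp
  have clsT1: "cls T1" using T1(1) p0T1 by (simp add: cls_def)
  have clsT': "cls T'" by (rule cls_lev[OF clsT1 T'(1-3)])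
  have cT': "(p0, T') \<in> AS" using clsD[OF clsT'] by (simp add: AS_iff)
  have T'T: "T' \<subseteq> T" using T'(2) T1(2) by blast
  have "dense_below AS AS_le (\<Union>k\<in>B. E k) (p0, T')"
    unfolding dense_below_def
  proof (intro ballI impI)
    fix q assume q: "q \<in> AS" "AS_le q (p0, T')"
    obtain r S where rS: "q = (r, S)" by (cases q)
    have S: "good S" "S \<subseteq> T'" "p0 \<sqsubseteq>\<^sub>e r" "r \<sqsubseteq>\<^sub>e S" using q by (simp_all add: rS AS_le_def AS_iff)
    have "cls S" unfolding cls_def using S T'(2) end_ext_trans by blast
    then have X: "lev S h \<in> Xs" unfolding Xs_def by blast
    define k where "k = \<chi> (lev S h)"
    have kB: "k \<in> B" unfolding B_def k_def using X by blast
    have "accepts E T' (lev S h) k" using \<chi> X by (simp add: k_def)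
    then have d: "decides (E k) h S" by (rule acceptsD[OF _ S(1,2) refl])
    have finr: "finite r" using S(4) unfolding end_ext_def by blast
    define h2 where "h2 = h + (\<Sum>t\<in>r. length t)"
    have "length t \<le> h2" if "t \<in> r" for t
      using member_le_sum[OF that _ finr, of length] by (simp add: h2_def)
    then have le: "AS_le (trunc S h2, S) q" unfolding rS by (intro AS_le_trunc_same) (use q(1) rS in auto)
    have "decides (E k) h2 S" by (rule decides_mono[OF d S(1,1)]) (simp_all add: h2_def)
    then obtain r' where r': "r' \<in> E k" "r' \<in> AS" "AS_le r' (trunc S h2, S)"
      using AS_le_refl[OF trunc_AS[OF S(1)]] trunc_AS[OF S(1)] unfolding decides_def dense_below_def by blast
    then show "\<exists>r\<in>\<Union>k\<in>B. E k. r \<in> AS \<and> AS_le r q" using AS_le_trans[OF r'(3) le] kB by blast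
  qed
  moreover have "AS_le_n n (p0, T') (p0, T)"
  proof -
    have "AS_le (p0, T') (p0, T)"
      using cT' c(1) T'T p0T end_ext_refl unfolding AS_le_def end_ext_def by simp
    moreover have "sub_upto (int n + N) T' T"
      unfolding sub_upto_def
    proof (intro conjI impI T'T)
      assume "0 \<le> int n + N"
      have eqk: "sp T' k = sp T k" if "k \<le> nat (int n + N)" for k
      proof -
        have "k < \<kappa>" using that \<open>0 \<le> int n + N\<close> by (simp add: \<kappa>_def K_def)
        moreover from this have "sp T' k = sp T1 k"
          by (intro sp_agree_lev[OF T1(1) T'(1-3)]) (use HT T1(3) h_def in simp)
        ultimately show ?thesis using T1(3) by simp
      qed
      show "restr T' (nat (int n + N)) = restr T (nat (int n + N))"
        unfolding restr_good[OF T'(1)] restr_good[OF T]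
        by (intro Collect_cong ex_cong1 conj_cong refl) (simp add: eqk)
    qed
    ultimately show ?thesis unfolding AS_le_n_def by (simp add: N_def p_def)
  qed
  ultimately show ?thesis using BA cardB by blast
qed

theorem lemma19:
  fixes A :: "nat set" and f :: "nat \<Rightarrow> nat" and a :: "(cond, nat + 'i) pname"
  assumes "finite A"
    and "\<And>n. f n = 4 ^ n"
    and "is_name AS a"
  shows "\<forall>n. \<forall>p0 T. (p0, T) \<in> AS \<longrightarrow> AS_forces_in (p0, T) a A \<longrightarrow>
    (\<exists>T' B. AS_le_n n (p0, T') (p0, T) \<and> B \<subseteq> A \<and> card B \<le> f n \<and> AS_forces_in (p0, T') a B)"
proof (intro allI impI)
  fix n p0 T assume c: "(p0, T) \<in> AS" "AS_forces_in (p0, T) a A"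
  \<comment> \<open>The conditions that give the name the value \<open>k\<close> outright. Forcing the name into \<open>B\<close> is density of their
    union over \<open>B\<close>.\<close>
  define E where "E k = {q \<in> AS. AS_le q AS_top \<and> forces_eq AS AS_le a (check_nat AS_top k) q}" for k
  have elts: "elts (check_set AS_top B :: (cond, nat + 'i) pname) = (\<lambda>k. (check_nat AS_top k, AS_top)) ` B" for B
    by (auto simp: check_set_def ran_def split_sum_ex split: if_splits)
  have forces: "AS_forces_in c' a B \<longleftrightarrow> dense_below AS AS_le (\<Union>k\<in>B. E k) c'" for c' B
  proof -
    have "{q \<in> AS. \<exists>(\<rho>, r)\<in>elts (check_set AS_top B). AS_le q r \<and> forces_eq AS AS_le a \<rho> q} = (\<Union>k\<in>B. E k)"
      unfolding elts E_def by auto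
    then show ?thesis unfolding AS_forces_in_def forces_mem_def by simp
  qed
  show "\<exists>T' B. AS_le_n n (p0, T') (p0, T) \<and> B \<subseteq> A \<and> card B \<le> f n \<and> AS_forces_in (p0, T') a B"
    using forces_few_values[OF c(1) c(2)[unfolded forces] assms(1)] unfolding forces assms(2) .
qed

end
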